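(* Let $\mathfrak A$ be a Banach algebra and let $\phi$ be an $\mathfrak A$-valued measure which arises as a Lebesgue–Bochner integrable function times the Lebesgue measure on an interval. Suppose that $\int|\phi|\le 2$. Then $\phi$ is $M$-controlled. In particular, the Magnus series $\sum_{k=1}^\infty\mu_{k,\mathrm R}(\phi)$ is absolutely convergent, $\log\exp_{\mathrm R}(\phi)$ exists, and $\log\exp_{\mathrm R}(\phi)=\sum_{k=1}^\infty\mu_{k,\mathrm R}(\phi)$.
   Context: Banach algebras are unital, real or complex. For a real Banach algebra, spectra and expressions with complex scalars are taken in the complexification $\mathbb C\mathfrak A$ with norm $|x|=\inf\{\sum_i|t_i|\,|x_i|: x=\sum_i t_ix_i,\ x_i\in\mathfrak A,\ t_i\in\mathbb C\}$. The measure given by a Lebesgue–Bochner integrable $h:I\to\mathfrak A$ on an interval $I$ is $\phi(J)=\int_J h(t)\,\mathrm dt$ for subintervals $J\subset I$; then $\int|\phi|=\int_I|h(t)|\,\mathrm dt$. The time-ordered exponential is $\exp_{\mathrm R}(\phi)=1+\sum_{k\ge1}\int_{t_1\le\dots\le t_k\in I}\phi(t_1)\cdots\phi(t_k)$. For $\sigma\in\Sigma_k$, $\mathrm{asc}(\sigma)$ and $\mathrm{des}(\sigma)$ are the numbers of $i$ with $\sigma(i)<\sigma(i+1)$, resp. $\sigma(i)>\sigma(i+1)$; $\mu_k(X_1,\dots,X_k)=\sum_{\sigma\in\Sigma_k}(-1)^{\mathrm{des}(\sigma)}\frac{\mathrm{asc}(\sigma)!\,\mathrm{des}(\sigma)!}{k!}X_{\sigma(1)}\cdots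 X_{\sigma(k)}$ (the part of $\log(\exp(X_1)\cdots\exp(X_k))$ in which each variable has multiplicity exactly $1$), and $\mu_{k,\mathrm R}(\phi)=\int_{t_1\le\dots\le t_k\in I}\mu_k(\phi(t_1),\dots,\phi(t_k))$. $\log A$ exists (by definition) iff the spectrum of $A$ is disjoint from $(-\infty,0]$, and then $\log A=\int_0^1 (A-1)(\lambda+(1-\lambda)A)^{-1}\,\mathrm d\lambda$. $\phi$ is called $M$-controlled if $\log\exp_{\mathrm R}(t\cdot\phi)$ exists for every complex $t$ with $|t|\le1$. *)

theory Defs
  imports "HOL-Analysis.Analysis" "HOL-Combinatorics.Permutations"
begin

section \<open>Complex Banach algebras\<close>

class scaleC =
  fixes scaleC :: "complex \<Rightarrow> 'a \<Rightarrow> 'a"  (infixr \<open>*\<^sub>C\<close> 75)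

text \<open>Real Banach algebras are types of sort \<open>{real_normed_algebra_1, banach}\<close>. A complex Banach
  algebra carries in addition a complex scalar multiplication extending the real one.\<close>

class complex_banach_algebra = real_normed_algebra_1 + banach + scaleC +
  assumes scaleC_add_right: "t *\<^sub>C (x + y) = t *\<^sub>C x + t *\<^sub>C y"
    and scaleC_add_left: "(s + t) *\<^sub>C x = s *\<^sub>C x + t *\<^sub>C x"
    and scaleC_scaleC: "s *\<^sub>C t *\<^sub>C x = (s * t) *\<^sub>C x"
    and scaleC_of_real: "complex_of_real r *\<^sub>C x = r *\<^sub>R x"
    and mult_scaleC_left: "(t *\<^sub>C x) * y = t *\<^sub>C (x * y)"
    and mult_scaleC_right: "x * (t *\<^sub>C y) = t *\<^sub>C (x * y)"
    and norm_scaleC: "norm (t *\<^sub>C x) = cmod t * norm x"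


section \<open>The complexification of a real Banach algebra\<close>

datatype 'a complexification = Cx (re_part: 'a) (im_part: 'a)

lemma complexification_eq_iff: "x = y \<longleftrightarrow> re_part x = re_part y \<and> im_part x = im_part y"
  by (cases x; cases y) auto

instantiation complexification :: (real_vector) real_vector
begin
definition "0 = Cx 0 0"
definition "x + y = Cx (re_part x + re_part y) (im_part x + im_part y)"
definition "- x = Cx (- re_part x) (- im_part x)"
definition "x - y = Cx (re_part x - re_part y) (im_part x - im_part y)"
definition "r *\<^sub>R x = Cx (r *\<^sub>R re_part x) (r *\<^sub>R im_part x)"
instance
  by standard
    (simp_all add: complexification_eq_iff zero_complexification_def plus_complexification_def
      uminus_complexification_def minus_complexification_def scaleR_complexification_def
      scaleR_add_right scaleR_add_left)
end

instantiation complexification :: (real_vector) scaleC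
begin
definition "t *\<^sub>C x = Cx (Re t *\<^sub>R re_part x - Im t *\<^sub>R im_part x) (Re t *\<^sub>R im_part x + Im t *\<^sub>R re_part x)"
instance ..
end

instantiation complexification :: (real_algebra_1) real_algebra_1
begin
definition "1 = Cx 1 0"
definition "x * y = Cx (re_part x * re_part y - im_part x * im_part y)
                       (re_part x * im_part y + im_part x * re_part y)"
instance
  by standard
    (simp_all add: complexification_eq_iff zero_complexification_def plus_complexification_def
      scaleR_complexification_def one_complexification_def times_complexification_def
      algebra_simps)
end

definition complexify :: "'a::zero \<Rightarrow> 'a complexification" where
  "complexify a = Cx a 0"

lemma complexification_simps [simp]:
  "re_part 0 = 0" "im_part 0 = 0"
  "re_part (x + y) = re_part x + re_part y" "im_part (x + y) = im_part x + im_part y"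
  "re_part (- x) = - re_part x" "im_part (- x) = - im_part x"
  "re_part (x - y) = re_part x - re_part y" "im_part (x - y) = im_part x - im_part y"
  "re_part (r *\<^sub>R x) = r *\<^sub>R re_part x" "im_part (r *\<^sub>R x) = r *\<^sub>R im_part x"
  "re_part (t *\<^sub>C x) = Re t *\<^sub>R re_part x - Im t *\<^sub>R im_part x"
  "im_part (t *\<^sub>C x) = Re t *\<^sub>R im_part x + Im t *\<^sub>R re_part x"
  "re_part (complexify b) = b" "im_part (complexify b) = 0"
  for x y :: "'a::real_vector complexification" and b :: 'a
  by (simp_all add: zero_complexification_def plus_complexification_def
      uminus_complexification_def minus_complexification_def scaleR_complexification_def
      scaleC_complexification_def complexify_def)

lemma complexification_mult_simps [simp]:
  "re_part 1 = 1" "im_part 1 = 0"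
  "re_part (x * y) = re_part x * re_part y - im_part x * im_part y"
  "im_part (x * y) = re_part x * im_part y + im_part x * re_part y"
  for x y :: "'a::real_algebra_1 complexification"
  by (simp_all add: one_complexification_def times_complexification_def)

text \<open>A list of pairs \<open>(t\<^sub>i, x\<^sub>i)\<close> stands for the representation \<open>x = \<Sum>\<^sub>i t\<^sub>i x\<^sub>i\<close>; the norm below is the
  infimum of \<open>\<Sum>\<^sub>i |t\<^sub>i| |x\<^sub>i|\<close> over all representations.\<close>

definition lin_comb :: "(complex \<times> 'a::real_vector) list \<Rightarrow> 'a complexification" where
  "lin_comb xs = (\<Sum>(t, a)\<leftarrow>xs. t *\<^sub>C complexify a)"

definition lin_comb_cost :: "(complex \<times> 'a::real_normed_vector) list \<Rightarrow> real" where
  "lin_comb_cost xs = (\<Sum>(t, a)\<leftarrow>xs. cmod t * norm a)"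

lemma lin_comb_Nil [simp]: "lin_comb [] = 0"
  and lin_comb_Cons [simp]: "lin_comb ((t, a) # xs) = t *\<^sub>C complexify a + lin_comb xs"
  and lin_comb_append [simp]: "lin_comb (xs @ ys) = lin_comb xs + lin_comb ys"
  by (simp_all add: lin_comb_def)

lemma lin_comb_cost_Nil [simp]: "lin_comb_cost [] = 0"
  and lin_comb_cost_Cons [simp]: "lin_comb_cost ((t, a) # xs) = cmod t * norm a + lin_comb_cost xs"
  and lin_comb_cost_append [simp]: "lin_comb_cost (xs @ ys) = lin_comb_cost xs + lin_comb_cost ys"
  by (simp_all add: lin_comb_cost_def)

lemma norm_re_part_lin_comb: "norm (re_part (lin_comb xs)) \<le> lin_comb_cost xs"
proof (induction xs)
  case (Cons p xs)
  obtain t a where p: "p = (t, a)" by force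
  have "norm (Re t *\<^sub>R a) \<le> cmod t * norm a"
    by (simp add: abs_Re_le_cmod mult_right_mono)
  with Cons show ?case
    unfolding p by simp (smt (verit) norm_triangle_ineq norm_scaleR)
qed simp

lemma norm_im_part_lin_comb: "norm (im_part (lin_comb xs)) \<le> lin_comb_cost xs"
proof (induction xs)
  case (Cons p xs)
  obtain t a where p: "p = (t, a)" by force
  have "norm (Im t *\<^sub>R a) \<le> cmod t * norm a"
    by (simp add: abs_Im_le_cmod mult_right_mono)
  with Cons show ?case
    unfolding p by simp (smt (verit) norm_triangle_ineq norm_scaleR)
qed simp

lemma lin_comb_cost_nonneg: "0 \<le> lin_comb_cost xs"
  using norm_re_part_lin_comb[of xs] norm_ge_zero order_trans by blast

lemma lin_comb_parts: "lin_comb [(1, re_part x), (\<i>, im_part x)] = x"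
  by (simp add: complexification_eq_iff)

lemma lin_comb_scaleR:
  "lin_comb (map (\<lambda>(t, a). (t, r *\<^sub>R a)) xs) = r *\<^sub>R lin_comb xs"
  "lin_comb_cost (map (\<lambda>(t, a). (t, r *\<^sub>R a)) xs) = \<bar>r\<bar> * lin_comb_cost xs"
  by (induction xs) (auto simp: complexification_eq_iff algebra_simps)

lemma lin_comb_scaleC:
  "lin_comb (map (\<lambda>(t, a). (s * t, a)) xs) = s *\<^sub>C lin_comb xs"
  "lin_comb_cost (map (\<lambda>(t, a). (s * t, a)) xs) = cmod s * lin_comb_cost xs"
  by (induction xs) (auto simp: complexification_eq_iff algebra_simps norm_mult)

instantiation complexification :: (real_normed_vector) real_normed_vector
begin

definition norm_complexification_def:
  "norm x = Inf {lin_comb_cost xs | xs. x = lin_comb xs}"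

definition sgn_complexification_def:
  "sgn x = x /\<^sub>R norm (x :: 'a complexification)"

definition dist_complexification_def:
  "dist x y = norm (x - y :: 'a complexification)"

definition uniformity_complexification_def [code del]:
  "(uniformity :: ('a complexification \<times> 'a complexification) filter) =
    (INF e\<in>{0 <..}. principal {(x, y). dist x y < e})"

definition open_complexification_def [code del]:
  "open (U :: 'a complexification set) \<longleftrightarrow>
    (\<forall>x\<in>U. eventually (\<lambda>(x', y). x' = x \<longrightarrow> y \<in> U) uniformity)"

lemma norm_complexification_le: "norm (lin_comb xs) \<le> lin_comb_cost xs"
  unfolding norm_complexification_def
  by (rule cInf_lower) (auto intro!: bdd_belowI[of _ 0] lin_comb_cost_nonneg)

lemma norm_complexification_greatest:
  assumes "\<And>xs. x = lin_comb xs \<Longrightarrow> c \<le> lin_comb_cost xs"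
  shows "c \<le> norm x"
proof -
  have "lin_comb_cost [(1, re_part x), (\<i>, im_part x)] \<in> {lin_comb_cost xs | xs. x = lin_comb xs}"
    by (rule CollectI, rule exI[of _ "[(1, re_part x), (\<i>, im_part x)]"]) (simp only: lin_comb_parts)
  then have "{lin_comb_cost xs | xs. x = lin_comb xs} \<noteq> {}" by (metis empty_iff)
  then show ?thesis
    unfolding norm_complexification_def
    by (rule cInf_greatest) (elim CollectE exE conjE, metis assms)
qed

lemma norm_re_part_le: "norm (re_part x) \<le> norm x"
  by (rule norm_complexification_greatest) (simp only: norm_re_part_lin_comb)

lemma norm_im_part_le: "norm (im_part x) \<le> norm x"
  by (rule norm_complexification_greatest) (simp only: norm_im_part_lin_comb)

lemma norm_complexification_le_parts: "norm x \<le> norm (re_part x) + norm (im_part x)"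
proof -
  have "norm x \<le> lin_comb_cost [(1, re_part x), (\<i>, im_part x)]"
    using norm_complexification_le[of "[(1, re_part x), (\<i>, im_part x)]"]
    by (simp only: lin_comb_parts)
  then show ?thesis by simp
qed

lemma norm_complexification_approx:
  assumes "e > 0"
  obtains xs where "x = lin_comb xs" "lin_comb_cost xs < norm x + e"
proof -
  have "\<not> norm x + e \<le> norm x" using assms by simp
  then have "\<exists>xs. x = lin_comb xs \<and> \<not> norm x + e \<le> lin_comb_cost xs"
    using norm_complexification_greatest[of x "norm x + e"] by (metis (no_types))
  then obtain xs where "x = lin_comb xs" "\<not> norm x + e \<le> lin_comb_cost xs" by (elim exE conjE)
  then show ?thesis by (intro that[of xs]) (simp_all only: not_le)
qed

lemma norm_scaleR_complexification_le:
  "norm (r *\<^sub>R x) \<le> \<bar>r\<bar> * norm (x :: 'a complexification)"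
proof (cases "r = 0")
  case True
  then show ?thesis using norm_complexification_le[of "[]"] by simp
next
  case False
  have "norm (r *\<^sub>R x) / \<bar>r\<bar> \<le> norm x"
  proof (rule norm_complexification_greatest)
    fix xs :: "(complex \<times> 'a) list" assume "x = lin_comb xs"
    then show "norm (r *\<^sub>R x) / \<bar>r\<bar> \<le> lin_comb_cost xs"
      using norm_complexification_le[of "map (\<lambda>(t, a). (t, r *\<^sub>R a)) xs"] False
      by (simp add: lin_comb_scaleR field_simps)
  qed
  then show ?thesis using False by (simp add: field_simps)
qed

instance
proof
  fix r :: real and x y :: "'a complexification"
  show "norm x = 0 \<longleftrightarrow> x = 0"
  proof
    assume "norm x = 0"
    then show "x = 0"
      using norm_re_part_le[of x] norm_im_part_le[of x] by (simp add: complexification_eq_iff)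
  next
    assume "x = 0"
    then show "norm x = 0"
      using norm_complexification_le_parts[of x] norm_re_part_le[of x] by simp
  qed
  show "norm (x + y) \<le> norm x + norm y"
  proof (rule field_le_epsilon)
    fix e :: real assume "e > 0"
    then have "e / 2 > 0" by simp
    obtain xs where xs: "x = lin_comb xs" "lin_comb_cost xs < norm x + e / 2"
      using \<open>e / 2 > 0\<close> by (rule norm_complexification_approx)
    obtain ys where ys: "y = lin_comb ys" "lin_comb_cost ys < norm y + e / 2"
      using \<open>e / 2 > 0\<close> by (rule norm_complexification_approx)
    show "norm (x + y) \<le> norm x + norm y + e"
      using norm_complexification_le[of "xs @ ys"] xs ys by simp
  qed
  show "norm (r *\<^sub>R x) = \<bar>r\<bar> * norm x"
  proof (cases "r = 0")
    case True
    have "norm (0 :: 'a complexification) = 0"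
      using norm_complexification_le_parts[of "0 :: 'a complexification"]
        norm_re_part_le[of "0 :: 'a complexification"] by simp
    with True show ?thesis by simp
  next
    case False
    have "norm x = norm (inverse r *\<^sub>R r *\<^sub>R x)" using False by simp
    also have "\<dots> \<le> \<bar>inverse r\<bar> * norm (r *\<^sub>R x)" by (rule norm_scaleR_complexification_le)
    finally have "\<bar>r\<bar> * norm x \<le> norm (r *\<^sub>R x)" using False by (simp add: field_simps)
    with norm_scaleR_complexification_le[of r x] show ?thesis by simp
  qed
qed (rule sgn_complexification_def dist_complexification_def uniformity_complexification_def
    open_complexification_def)+

end

lemma norm_complexify [simp]: "norm (complexify a) = norm a"
  using norm_re_part_le[of "complexify a"] norm_complexification_le_parts[of "complexify a"]
  by simp

lemma norm_scaleC_complexification_le: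
  "norm (s *\<^sub>C x) \<le> cmod s * norm (x :: 'a::real_normed_vector complexification)"
proof (cases "s = 0")
  case True
  then have "s *\<^sub>C x = 0" by (simp add: complexification_eq_iff)
  with True show ?thesis by simp
next
  case False
  have "norm (s *\<^sub>C x) / cmod s \<le> norm x"
  proof (rule norm_complexification_greatest)
    fix xs :: "(complex \<times> 'a) list" assume "x = lin_comb xs"
    then show "norm (s *\<^sub>C x) / cmod s \<le> lin_comb_cost xs"
      using norm_complexification_le[of "map (\<lambda>(t, a). (s * t, a)) xs"] False
      unfolding lin_comb_scaleC by (simp add: divide_le_eq mult.commute)
  qed
  then show ?thesis using False by (simp add: field_simps)
qed

lemma norm_mult_lin_comb:
  fixes x :: "'a::real_normed_algebra_1 complexification"
  shows "norm (lin_comb xs * x) \<le> lin_comb_cost xs * norm x"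
proof (induction xs)
  case (Cons p xs)
  obtain t a where p: "p = (t, a)" by force
  have "norm (complexify a * x) \<le> norm a * norm x"
  proof (rule field_le_epsilon)
    fix e :: real assume e: "e > 0"
    define d where "d = e / (norm a + 1)"
    have d: "d > 0" "norm a * d \<le> e"
      using e by (simp_all add: d_def add_nonneg_pos divide_simps)
    obtain ys where ys: "x = lin_comb ys" "lin_comb_cost ys < norm x + d"
      using d(1) by (rule norm_complexification_approx)
    have 1: "complexify a * lin_comb ys = lin_comb (map (\<lambda>(t, b). (t, a * b)) ys)"
      by (induction ys) (auto simp: complexification_eq_iff algebra_simps)
    have 2: "lin_comb_cost (map (\<lambda>(t, b). (t, a * b)) ys) \<le> norm a * lin_comb_cost ys"
    proof (induction ys)
      case (Cons q ys)
      obtain s b where q: "q = (s, b)" by force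
      have "cmod s * norm (a * b) \<le> cmod s * (norm a * norm b)"
        by (intro mult_left_mono norm_mult_ineq) simp
      with Cons show ?case by (simp add: q algebra_simps)
    qed simp
    have "norm (complexify a * x) \<le> norm a * lin_comb_cost ys"
      unfolding ys(1) 1 using norm_complexification_le 2 order_trans by blast
    also have "\<dots> \<le> norm a * (norm x + d)" using ys(2) by (intro mult_left_mono) auto
    finally show "norm (complexify a * x) \<le> norm a * norm x + e"
      using d(2) by (simp add: algebra_simps)
  qed
  then have "cmod t * norm (complexify a * x) \<le> cmod t * (norm a * norm x)"
    by (intro mult_left_mono) auto
  moreover have "(t *\<^sub>C complexify a) * x = t *\<^sub>C (complexify a * x)"
    by (simp add: complexification_eq_iff algebra_simps)
  ultimately have "norm ((t *\<^sub>C complexify a) * x) \<le> cmod t * norm a * norm x"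
    using norm_scaleC_complexification_le[of t "complexify a * x"] by simp
  moreover have "norm (lin_comb (p # xs) * x)
      \<le> norm ((t *\<^sub>C complexify a) * x) + norm (lin_comb xs * x)"
    by (simp add: p distrib_right norm_triangle_ineq)
  ultimately show ?case using Cons by (simp add: p distrib_right)
qed simp

instance complexification :: (real_normed_algebra_1) real_normed_algebra_1
proof
  fix x y :: "'a complexification"
  show "norm (x * y) \<le> norm x * norm y"
  proof (rule field_le_epsilon)
    fix e :: real assume e: "e > 0"
    define d where "d = e / (norm y + 1)"
    have d: "d > 0" "d * norm y \<le> e"
      using e by (simp_all add: d_def add_nonneg_pos divide_simps)
    obtain xs where xs: "x = lin_comb xs" "lin_comb_cost xs < norm x + d"
      using d(1) by (rule norm_complexification_approx)
    have "norm (x * y) \<le> lin_comb_cost xs * norm y"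
      unfolding xs(1) by (rule norm_mult_lin_comb)
    also have "\<dots> \<le> (norm x + d) * norm y" using xs(2) by (intro mult_right_mono) auto
    finally show "norm (x * y) \<le> norm x * norm y + e"
      using d(2) by (simp add: algebra_simps)
  qed
  have one: "(1 :: 'a complexification) = complexify 1" by (simp add: complexification_eq_iff)
  show "norm (1 :: 'a complexification) = 1" by (subst one) simp
qed

instance complexification :: (banach) banach
proof
  fix X :: "nat \<Rightarrow> 'a complexification" assume X: "Cauchy X"
  have "Cauchy (\<lambda>n. re_part (X n))"
  proof (rule CauchyI)
    fix e :: real assume "0 < e"
    then obtain M where "\<forall>m\<ge>M. \<forall>n\<ge>M. norm (X m - X n) < e"
      using CauchyD[OF X] by blast
    then have M: "norm (X m - X n) < e" if "m \<ge> M" "n \<ge> M" for m n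
      using that by blast
    have le: "norm (re_part (X m) - re_part (X n)) \<le> norm (X m - X n)" for m n
      using norm_re_part_le[of "X m - X n"] by simp
    show "\<exists>M. \<forall>m\<ge>M. \<forall>n\<ge>M. norm (re_part (X m) - re_part (X n)) < e"
    proof (intro exI allI impI)
      fix m n assume "m \<ge> M" "n \<ge> M"
      then show "norm (re_part (X m) - re_part (X n)) < e"
        by (rule le_less_trans[OF le M])
    qed
  qed
  then obtain a where a: "(\<lambda>n. re_part (X n)) \<longlonglongrightarrow> a"
    using Cauchy_convergent convergent_def by blast
  have "Cauchy (\<lambda>n. im_part (X n))"
  proof (rule CauchyI)
    fix e :: real assume "0 < e"
    then obtain M where "\<forall>m\<ge>M. \<forall>n\<ge>M. norm (X m - X n) < e"
      using CauchyD[OF X] by blast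
    then have M: "norm (X m - X n) < e" if "m \<ge> M" "n \<ge> M" for m n
      using that by blast
    have le: "norm (im_part (X m) - im_part (X n)) \<le> norm (X m - X n)" for m n
      using norm_im_part_le[of "X m - X n"] by simp
    show "\<exists>M. \<forall>m\<ge>M. \<forall>n\<ge>M. norm (im_part (X m) - im_part (X n)) < e"
    proof (intro exI allI impI)
      fix m n assume "m \<ge> M" "n \<ge> M"
      then show "norm (im_part (X m) - im_part (X n)) < e"
        by (rule le_less_trans[OF le M])
    qed
  qed
  then obtain b where b: "(\<lambda>n. im_part (X n)) \<longlonglongrightarrow> b"
    using Cauchy_convergent convergent_def by blast
  have lim: "(\<lambda>n. norm (re_part (X n) - a) + norm (im_part (X n) - b)) \<longlonglongrightarrow> 0"
    using tendsto_add[OF tendsto_norm_zero[OF LIM_zero[OF a]] tendsto_norm_zero[OF LIM_zero[OF b]]]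
    by simp
  have "norm (X n - Cx a b) \<le> norm (re_part (X n) - a) + norm (im_part (X n) - b)" for n
    using norm_complexification_le_parts[of "X n - Cx a b"] by simp
  then have "(\<lambda>n. X n - Cx a b) \<longlonglongrightarrow> 0"
    by (intro Lim_null_comparison[OF _ lim] always_eventually allI)
  then have "X \<longlonglongrightarrow> Cx a b" by (rule LIM_zero_cancel)
  then show "convergent X" by (rule convergentI)
qed

instance complexification :: ("{real_normed_algebra_1, banach}") complex_banach_algebra
proof
  fix s t :: complex and r :: real and x y :: "'a complexification"
  have inv: "inverse t *\<^sub>C t *\<^sub>C x = x" if "t \<noteq> 0"
  proof -
    have "inverse t *\<^sub>C t *\<^sub>C x = (inverse t * t) *\<^sub>C x"
      unfolding complexification_eq_iff complexification_simps by (simp add: algebra_simps)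
    then show ?thesis using that by (simp add: complexification_eq_iff)
  qed
  show "norm (t *\<^sub>C x) = cmod t * norm x"
  proof (cases "t = 0")
    case True
    then have "t *\<^sub>C x = 0" by (simp add: complexification_eq_iff)
    with True show ?thesis by simp
  next
    case False
    have "norm x \<le> cmod (inverse t) * norm (t *\<^sub>C x)"
      using norm_scaleC_complexification_le[of "inverse t" "t *\<^sub>C x"] inv[OF False] by simp
    then have "cmod t * norm x \<le> cmod t * (cmod (inverse t) * norm (t *\<^sub>C x))"
      by (rule mult_left_mono) simp
    also have "\<dots> = norm (t *\<^sub>C x)" using False by (simp add: norm_inverse)
    finally have "cmod t * norm x \<le> norm (t *\<^sub>C x)" .
    with norm_scaleC_complexification_le[of t x] show ?thesis by simp
  qed
qed (simp_all add: complexification_eq_iff algebra_simps)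


section \<open>The Bochner integral\<close>

text \<open>The library's Bochner integral is restricted to second countable spaces, whereas a Banach
  algebra need not be separable. The following is the usual notion for arbitrary normed spaces:
  strong measurability is almost everywhere convergence of simple functions. The completion is used
  because the scalar function \<open>norm (f z - s i z)\<close> is in general only measurable up to null sets.\<close>

definition has_bochner_integral_normed ::
    "'a measure \<Rightarrow> ('a \<Rightarrow> 'b::real_normed_vector) \<Rightarrow> 'b \<Rightarrow> bool" where
  "has_bochner_integral_normed M f x \<longleftrightarrow>
    (\<exists>s. (\<forall>i. Bochner_Integration.simple_bochner_integrable M (s i)) \<and>
         (AE z in M. (\<lambda>i. s i z) \<longlonglongrightarrow> f z) \<and>
         (\<lambda>i. \<integral>\<^sup>+z. ennreal (norm (f z - s i z)) \<partial>completion M) \<longlonglongrightarrow> 0 \<and>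
         (\<lambda>i. Bochner_Integration.simple_bochner_integral M (s i)) \<longlonglongrightarrow> x)"

definition bochner_integrable_normed :: "'a measure \<Rightarrow> ('a \<Rightarrow> 'b::real_normed_vector) \<Rightarrow> bool" where
  "bochner_integrable_normed M f \<longleftrightarrow> (\<exists>x. has_bochner_integral_normed M f x)"

definition bochner_integral_normed :: "'a measure \<Rightarrow> ('a \<Rightarrow> 'b::real_normed_vector) \<Rightarrow> 'b" where
  "bochner_integral_normed M f =
    (if bochner_integrable_normed M f then THE x. has_bochner_integral_normed M f x else 0)"

definition bochner_integrable_on ::
    "(real \<Rightarrow> 'b::real_normed_vector) \<Rightarrow> real set \<Rightarrow> bool"  (infixr \<open>bochner'_integrable'_on\<close> 46) where
  "h bochner_integrable_on I \<longleftrightarrow> bochner_integrable_normed lborel (\<lambda>t. indicat_real I t *\<^sub>R h t)"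


section \<open>Time-ordered integrals\<close>

text \<open>A measure \<open>\<phi>(J) = \<integral>\<^sub>J h(t) dt\<close> on \<open>I\<close> is represented by its density \<open>h\<close>,
  so that \<open>\<phi>(t\<^sub>i)\<close> under an integral sign stands for \<open>h(t\<^sub>i) dt\<^sub>i\<close>.\<close>

definition time_simplex :: "nat \<Rightarrow> real set \<Rightarrow> (nat \<Rightarrow> real) set" where
  "time_simplex k I = {t \<in> {1..k} \<rightarrow>\<^sub>E I. \<forall>i\<in>{1..<k}. t i \<le> t (Suc i)}"

definition time_ordered_integral ::
    "nat \<Rightarrow> real set \<Rightarrow> ((nat \<Rightarrow> 'a) \<Rightarrow> 'a) \<Rightarrow> (real \<Rightarrow> 'a) \<Rightarrow> 'a::real_normed_vector" where
  "time_ordered_integral k I F h =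
    bochner_integral_normed (\<Pi>\<^sub>M i\<in>{1..k}. lborel)
      (\<lambda>t. indicat_real (time_simplex k I) t *\<^sub>R F (\<lambda>i. h (t i)))"

definition exp_R :: "real set \<Rightarrow> (real \<Rightarrow> 'a) \<Rightarrow> 'a::real_normed_algebra_1" where
  "exp_R I h =
    1 + (\<Sum>k. time_ordered_integral (Suc k) I (\<lambda>X. prod_list (map X [1..<Suc (Suc k)])) h)"


section \<open>Magnus commutators and the Magnus expansion\<close>

definition asc :: "nat \<Rightarrow> (nat \<Rightarrow> nat) \<Rightarrow> nat" where
  "asc k \<sigma> = card {i \<in> {1..<k}. \<sigma> i < \<sigma> (Suc i)}"

definition des :: "nat \<Rightarrow> (nat \<Rightarrow> nat) \<Rightarrow> nat" where
  "des k \<sigma> = card {i \<in> {1..<k}. \<sigma> i > \<sigma> (Suc i)}"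

definition magnus_commutator :: "nat \<Rightarrow> (nat \<Rightarrow> 'a) \<Rightarrow> 'a::real_algebra_1" where
  "magnus_commutator k X =
    (\<Sum>\<sigma> | \<sigma> permutes {1..k}.
      ((-1) ^ des k \<sigma> * (fact (asc k \<sigma>) * fact (des k \<sigma>) / fact k)) *\<^sub>R
        prod_list (map (\<lambda>i. X (\<sigma> i)) [1..<Suc k]))"

definition magnus_term :: "nat \<Rightarrow> real set \<Rightarrow> (real \<Rightarrow> 'a) \<Rightarrow> 'a::real_normed_algebra_1" where
  "magnus_term k I h = time_ordered_integral k I (magnus_commutator k) h"


section \<open>Spectrum and logarithm\<close>

definition is_inverse_of :: "'a::ring_1 \<Rightarrow> 'a \<Rightarrow> bool" where
  "is_inverse_of y x \<longleftrightarrow> x * y = 1 \<and> y * x = 1"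

definition spectrum :: "'a::complex_banach_algebra \<Rightarrow> complex set" where
  "spectrum A = {z. \<nexists>y. is_inverse_of y (A - z *\<^sub>C 1)}"

definition log_exists :: "'a::complex_banach_algebra \<Rightarrow> bool" where
  "log_exists A \<longleftrightarrow> spectrum A \<inter> complex_of_real ` {..0} = {}"

text \<open>The formula involves only real scalars, so for \<open>A\<close> in a real Banach algebra it is evaluated
  in that algebra; whether the logarithm exists is decided by \<open>log_exists (complexify A)\<close>.\<close>

definition log_alg :: "'a::{real_normed_algebra_1, banach} \<Rightarrow> 'a" where
  "log_alg A = integral {0..1}
    (\<lambda>l. (A - 1) * (THE y. is_inverse_of y (l *\<^sub>R 1 + (1 - l) *\<^sub>R A)))"

definition M_controlled :: "real set \<Rightarrow> (real \<Rightarrow> 'a::complex_banach_algebra) \<Rightarrow> bool" where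
  "M_controlled I h \<longleftrightarrow> (\<forall>t. cmod t \<le> 1 \<longrightarrow> log_exists (exp_R I (\<lambda>s. t *\<^sub>C h s)))"

end

theory Submission
  imports Defs "HOL-Probability.Distribution_Functions"
begin

text \<open>Write \<open>X\<^sub>\<lambda> = (A - 1) (\<lambda> + (1 - \<lambda>) A)\<^sup>-\<^sup>1\<close> for the resolvent transform of the time-ordered exponential
  \<open>A(t) = exp\<^sub>R(t \<phi>)\<close>, considered as a formal power series in \<open>t\<close>. Its \<open>k\<close>-th coefficient is the integral of
  \<open>(-1)\<^sup>d\<^sup>e\<^sup>s \<lambda>\<^sup>a\<^sup>s\<^sup>c (1 - \<lambda>)\<^sup>d\<^sup>e\<^sup>s \<phi>(t\<^sub>1) \<dots> \<phi>(t\<^sub>k)\<close> over the whole cube, and averaging over \<open>\<lambda>\<close> gives the \<open>k\<close>-th Magnus term.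
  So everything follows once the coefficients of \<open>X\<^sub>\<lambda>\<close> decay geometrically, uniformly in \<open>\<lambda>\<close>.

  Concatenation of intervals turns into the law
  \<open>X\<^sub>A\<^sub>B = X\<^sub>B + (1 - m X\<^sub>B) (1 + \<lambda> m X\<^sub>A X\<^sub>B)\<^sup>-\<^sup>1 X\<^sub>A (1 + \<lambda> X\<^sub>B)\<close>, \<open>m = 1 - \<lambda>\<close>, and \<open>\<lambda> m \<le> 1/4\<close>. Cutting \<open>\<phi>\<close> into many small
  pieces bounds \<open>X\<^sub>\<lambda>\<close> by \<open>2 T / (2 - T)\<close> where \<open>T = \<integral>|\<phi>|\<close>, which settles \<open>T < 2\<close>. If \<open>T = 2\<close>, the density is nearly
  constant on a short interval around a Lebesgue point; there the second-order commutator term almost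
  vanishes, so this interval contributes strictly less than its variation, and the total stays below the
  critical value 2. For \<open>\<lambda>\<close> away from \<open>1/2\<close> the factor \<open>\<lambda> m\<close> is already bounded away from \<open>1/4\<close>.\<close>

section \<open>Formal power series with weighted absolute sums\<close>

text \<open>The series in t stay formal and are measured by the weighted l^1 norm of their
  coefficients. This norm is submultiplicative, so the concatenation law turns into a scalar
  inequality. Replacing t by z t with |z| <= 1 does not increase it, so one bound at a radius above
  1 serves the whole closed disc. No logarithm has to be constructed: 1 - m X_\<lambda> is an
  explicit inverse of \<lambda> + m A, and up to positive factors these elements, for \<lambda> in
  [0,1), are all the A + s with s >= 0. Bounding X_\<lambda> therefore keeps the spectrum off the
  negative half-line. The obstacle is the endpoint, where 2 T / (2 - T) is infinite: a definite loss
  must be found on some piece and must survive the larger radius. It sits in the second coefficient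
  A_2 - m A_1^2 = (A_2 - A_1^2 / 2) + (1/2 - m) A_1^2, which for m near 1/2 and a nearly constant
  density is well below the \<epsilon>^2 / 2 granted by the majorant. The algebra may be
  nonseparable, so integrals are built from simple functions and only norms are asked to be
  measurable.\<close>

definition fps_wsum :: "real \<Rightarrow> 'a::real_normed_algebra_1 fps \<Rightarrow> nat \<Rightarrow> real" where
  "fps_wsum r F n = (\<Sum>k\<le>n. norm (fps_nth F k) * r ^ k)"

text \<open>The weighted l^1 norm is at most \<open>c\<close>, said through all partial sums: no
  summability has to be carried along, and the statement passes to limits in
  \<open>c\<close>.\<close>

definition fps_bound :: "real \<Rightarrow> 'a::real_normed_algebra_1 fps \<Rightarrow> real \<Rightarrow> bool" where
  "fps_bound r F c \<longleftrightarrow> (\<forall>n. fps_wsum r F n \<le> c)"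

lemma fps_boundI: "(\<And>n. fps_wsum r F n \<le> c) \<Longrightarrow> fps_bound r F c"
  by (simp add: fps_bound_def)

lemma fps_boundD: "fps_bound r F c \<Longrightarrow> fps_wsum r F n \<le> c"
  by (simp add: fps_bound_def)

lemma fps_wsum_nonneg: "0 \<le> r \<Longrightarrow> 0 \<le> fps_wsum r F n"
  unfolding fps_wsum_def by (intro sum_nonneg) simp

lemma fps_bound_nonneg: "0 \<le> r \<Longrightarrow> fps_bound r F c \<Longrightarrow> 0 \<le> c"
  using fps_wsum_nonneg[of r F 0] fps_boundD[of r F c 0] by linarith

lemma fps_bound_mono: "fps_bound r F c \<Longrightarrow> c \<le> d \<Longrightarrow> fps_bound r F d"
  by (meson fps_bound_def order_trans)

lemma fps_bound_nth:
  assumes "0 \<le> r" "fps_bound r F c"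
  shows "norm (fps_nth F k) * r ^ k \<le> c"
proof -
  have "norm (fps_nth F k) * r ^ k \<le> fps_wsum r F k"
    unfolding fps_wsum_def using assms(1)
    by (intro member_le_sum) auto
  then show ?thesis using fps_boundD[OF assms(2), of k] by linarith
qed

lemma fps_wsum_add: "0 \<le> r \<Longrightarrow> fps_wsum r (F + G) n \<le> fps_wsum r F n + fps_wsum r G n"
  unfolding fps_wsum_def sum.distrib[symmetric]
  by (intro sum_mono) (simp add: ring_distribs(2)[symmetric] mult_right_mono norm_triangle_ineq)

text \<open>The pairs i + j <= n of the Cauchy product lie in the square of pairs with i <= n and j
  <= n, so already the truncated sums are submultiplicative.\<close>

lemma fps_wsum_mult:
  assumes r: "0 \<le> r"
  shows "fps_wsum r (F * G) n \<le> fps_wsum r F n * fps_wsum r G n"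
proof -
  let ?f = "\<lambda>i. norm (fps_nth F i) * r ^ i" and ?g = "\<lambda>i. norm (fps_nth G i) * r ^ i"
  have "norm (fps_nth (F * G) k) * r ^ k \<le> (\<Sum>i\<le>k. ?f i * ?g (k - i))" for k
  proof -
    have "norm (fps_nth (F * G) k) \<le> (\<Sum>i\<le>k. norm (fps_nth F i) * norm (fps_nth G (k - i)))"
      unfolding fps_mult_nth atLeast0AtMost
      by (intro sum_norm_le norm_mult_ineq)
    then have "norm (fps_nth (F * G) k) * r ^ k
        \<le> (\<Sum>i\<le>k. norm (fps_nth F i) * norm (fps_nth G (k - i))) * r ^ k"
      using r by (intro mult_right_mono) auto
    also have "\<dots> = (\<Sum>i\<le>k. ?f i * ?g (k - i))"
      unfolding sum_distrib_right
    proof (intro sum.cong refl)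
      fix i assume "i \<in> {..k}"
      then have "r ^ k = r ^ i * r ^ (k - i)" by (simp add: power_add[symmetric])
      then show "norm (fps_nth F i) * norm (fps_nth G (k - i)) * r ^ k = ?f i * ?g (k - i)"
        by simp
    qed
    finally show ?thesis .
  qed
  then have "fps_wsum r (F * G) n \<le> (\<Sum>k\<le>n. \<Sum>i\<le>k. ?f i * ?g (k - i))"
    unfolding fps_wsum_def by (intro sum_mono)
  also have "\<dots> = (\<Sum>(i, j)\<in>{(i, j). i + j \<le> n}. ?f i * ?g j)"
    by (rule sum.triangle_reindex_eq[symmetric])
  also have "\<dots> \<le> (\<Sum>(i, j)\<in>{..n} \<times> {..n}. ?f i * ?g j)"
    using r by (intro sum_mono2) auto
  also have "\<dots> = fps_wsum r F n * fps_wsum r G n"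
    unfolding fps_wsum_def sum_product sum.cartesian_product ..
  finally show ?thesis .
qed

lemma fps_bound_add:
  "0 \<le> r \<Longrightarrow> fps_bound r F c \<Longrightarrow> fps_bound r G d \<Longrightarrow> fps_bound r (F + G) (c + d)"
  by (rule fps_boundI) (meson add_mono fps_boundD fps_wsum_add order_trans)

lemma fps_bound_uminus: "fps_bound r F c \<Longrightarrow> fps_bound r (- F) c"
  by (simp add: fps_bound_def fps_wsum_def)

lemma fps_bound_diff:
  "0 \<le> r \<Longrightarrow> fps_bound r F c \<Longrightarrow> fps_bound r G d \<Longrightarrow> fps_bound r (F - G) (c + d)"
  using fps_bound_add[of r F c "- G" d] fps_bound_uminus[of r G d] by simp

lemma fps_bound_mult:
  assumes "0 \<le> r" "fps_bound r F c" "fps_bound r G d"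
  shows "fps_bound r (F * G) (c * d)"
proof (rule fps_boundI)
  fix n
  have "fps_wsum r F n * fps_wsum r G n \<le> c * d"
    by (rule mult_mono[OF fps_boundD[OF assms(2)] fps_boundD[OF assms(3)]
        fps_bound_nonneg[OF assms(1,2)] fps_wsum_nonneg[OF assms(1)]])
  then show "fps_wsum r (F * G) n \<le> c * d"
    using fps_wsum_mult[OF assms(1), of F G n] by linarith
qed

lemma fps_bound_const: "norm c \<le> d \<Longrightarrow> fps_bound r (fps_const c) d"
proof (rule fps_boundI)
  fix n assume "norm c \<le> d"
  have "fps_wsum r (fps_const c) n = (\<Sum>k\<le>n. if k = 0 then norm c else 0)"
    unfolding fps_wsum_def by (intro sum.cong) auto
  then show "fps_wsum r (fps_const c) n \<le> d" using \<open>norm c \<le> d\<close> by simp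
qed

lemma fps_bound_1: "fps_bound r (1 :: 'a::real_normed_algebra_1 fps) 1"
  using fps_bound_const[of "1::'a" 1 r] by simp

text \<open>Taking norms in \<open>Q = 1 - Q * F\<close> gives q <= 1 + q c for each truncated sum
  q. Since q is a finite number, this can be solved for q without a Neumann series.\<close>

lemma fps_bound_left_inverse:
  assumes r: "0 \<le> r" and F: "fps_bound r F c" and c: "c < 1" and Q: "Q * (1 + F) = 1"
  shows "fps_bound r Q (1 / (1 - c))"
proof (rule fps_boundI)
  fix n
  have "Q = 1 - Q * F" using Q by (simp add: algebra_simps)
  then have Q': "Q = 1 + - (Q * F)" by (simp only: diff_conv_add_uminus)
  have "fps_wsum r Q n \<le> fps_wsum r (1 :: 'a fps) n + fps_wsum r (- (Q * F)) n"
    by (subst Q') (rule fps_wsum_add[OF r])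
  moreover have "fps_wsum r (- (Q * F)) n = fps_wsum r (Q * F) n" by (simp add: fps_wsum_def)
  moreover have "fps_wsum r (1 :: 'a fps) n \<le> 1" by (rule fps_boundD[OF fps_bound_1])
  moreover have "fps_wsum r (Q * F) n \<le> fps_wsum r Q n * fps_wsum r F n" by (rule fps_wsum_mult[OF r])
  moreover have "fps_wsum r Q n * fps_wsum r F n \<le> fps_wsum r Q n * c"
    using fps_boundD[OF F] fps_wsum_nonneg[OF r] by (intro mult_left_mono) auto
  ultimately have "fps_wsum r Q n * (1 - c) \<le> 1" by (simp add: algebra_simps)
  then show "fps_wsum r Q n \<le> 1 / (1 - c)" using c by (simp add: field_simps)
qed

text \<open>The coefficients do not commute, so left and right inverse are constructed separately;
  associativity makes them equal.\<close>

lemma fps_has_inverse: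
  fixes F :: "'a::ring_1 fps"
  assumes "fps_nth F 0 = 1"
  obtains G where "G * F = 1" "F * G = 1"
proof -
  have L: "fps_left_inverse F 1 * F = 1" and R: "F * fps_right_inverse F 1 = 1"
    by (rule fps_left_inverse fps_right_inverse, simp add: assms)+
  have "fps_left_inverse F 1 = fps_left_inverse F 1 * (F * fps_right_inverse F 1)"
    unfolding R by simp
  also have "\<dots> = fps_right_inverse F 1"
    unfolding mult.assoc[symmetric] L by simp
  finally have "fps_left_inverse F 1 = fps_right_inverse F 1" .
  with L R have "F * fps_left_inverse F 1 = 1" by simp
  with L show ?thesis by (intro that) auto
qed


section \<open>The resolvent transform of a power series\<close>

abbreviation fps_real :: "real \<Rightarrow> 'a::real_algebra_1 fps" where
  "fps_real c \<equiv> fps_const (of_real c)"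

lemma fps_real_commute: "F * fps_real c = fps_real c * (F :: 'a::real_algebra_1 fps)"
  by (rule fps_ext) (simp add: of_real_def)

text \<open>The parameter \<open>m\<close> is \<open>1 - \<lambda>\<close>, so that \<open>\<lambda> + (1 - \<lambda>) A = 1 + m (A - 1)\<close>; the left inverse is meaningful
  because the series has constant coefficient 1 whenever \<open>A\<close> has.\<close>

definition fps_resolvent :: "real \<Rightarrow> 'a::real_algebra_1 fps \<Rightarrow> 'a fps" where
  "fps_resolvent m A = (A - 1) * fps_left_inverse (1 + fps_real m * (A - 1)) 1"

lemma fps_resolvent_eq:
  fixes A :: "'a::real_algebra_1 fps"
  assumes "fps_nth A 0 = 1"
  shows "fps_resolvent m A * (1 + fps_real m * (A - 1)) = A - 1"
proof -
  have "fps_left_inverse (1 + fps_real m * (A - 1)) 1 * (1 + fps_real m * (A - 1)) = 1"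
    by (rule fps_left_inverse) (simp add: assms)
  then show ?thesis by (simp add: fps_resolvent_def mult.assoc)
qed

lemma fps_resolvent_unique:
  fixes A :: "'a::real_algebra_1 fps"
  assumes "fps_nth A 0 = 1" and X: "X * (1 + fps_real m * (A - 1)) = A - 1"
  shows "X = fps_resolvent m A"
proof -
  obtain G where "(1 + fps_real m * (A - 1)) * G = 1"
    using fps_has_inverse[of "1 + fps_real m * (A - 1)"] assms(1) by auto
  moreover have "X * (1 + fps_real m * (A - 1)) * G
      = fps_resolvent m A * (1 + fps_real m * (A - 1)) * G"
    unfolding X fps_resolvent_eq[OF assms(1)] ..
  ultimately show ?thesis by (simp only: mult.assoc mult_1_right)
qed

lemma fps_resolvent_nth_0: "fps_nth A 0 = 1 \<Longrightarrow> fps_nth (fps_resolvent m A) 0 = 0"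
  by (simp add: fps_resolvent_def)

text \<open>The right-hand equation is the Moebius form A = (1 - m X)^-1 (1 + \<lambda> X), which is
  suited to products. In both equations the difference of the two sides is the same up to sign,
  because the scalar m is central.\<close>

lemma fps_resolvent_iff:
  fixes A X :: "'a::real_algebra_1 fps"
  shows "X * (1 + fps_real m * (A - 1)) = A - 1
    \<longleftrightarrow> (1 - fps_real m * X) * A = 1 + fps_real (1 - m) * X"
proof -
  have 1: "fps_real (1 - m) = (1 :: 'a fps) - fps_real m"
    by (rule fps_ext) simp
  have 2: "X * fps_real m = fps_real m * X" by (rule fps_real_commute)
  have 3: "X * (fps_real m * A) = fps_real m * (X * A)"
    by (simp only: mult.assoc[symmetric] 2)
  have "(1 - fps_real m * X) * A - (1 + (1 - fps_real m) * X)
      = A - 1 - X * (1 + fps_real m * (A - 1))"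
    using 2 3 by (simp add: algebra_simps)
  then have "(1 - fps_real m * X) * A - (1 + fps_real (1 - m) * X)
      = A - 1 - X * (1 + fps_real m * (A - 1))"
    unfolding 1 .
  then show ?thesis by (metis eq_iff_diff_eq_0)
qed

text \<open>The concatenation law as ring algebra over central scalars. The key is the factorization
  1 - m Z = (1 - m Y) Q (1 - m X): its last factor meets \<open>A\<close> and turns it into 1 + l
  X.\<close>

lemma ring_resolvent_mult:
  fixes l m X Y Q A B :: "'a::ring_1"
  assumes central: "\<And>x. x * l = l * x" "\<And>x. x * m = m * x" and lm: "l + m = 1"
    and A: "(1 - m * X) * A = 1 + l * X" and B: "(1 - m * Y) * B = 1 + l * Y"
    and Q: "Q * (1 + l * m * X * Y) = 1"
    and Z: "Z = Y + (1 - m * Y) * (Q * X) * (1 + l * Y)"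
  shows "(1 - m * Z) * (A * B) = 1 + l * Z"
proof -
  note cl = central(1)[of X] central(1)[of Y] central(1)[of Q] central(1)[of m]
    and cm = central(2)[of X] central(2)[of Y] central(2)[of Q]
  have cl': "X * (l * y) = l * (X * y)" "Y * (l * y) = l * (Y * y)" "Q * (l * y) = l * (Q * y)"
      "m * (l * y) = l * (m * y)"
    and cm': "X * (m * y) = m * (X * y)" "Y * (m * y) = m * (Y * y)" "Q * (m * y) = m * (Q * y)"
    for y
    by (simp_all only: mult.assoc[symmetric] cl cm)
  note c = cl cm cl' cm'
  have q: "Q = 1 - l * (m * (Q * (X * Y)))"
    using Q by (simp add: algebra_simps c)
  have "1 - m * Z = (1 - m * Y) * (1 - m * (Q * X) - l * (m * (Q * (X * Y))))"
    unfolding Z by (simp add: algebra_simps c)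
  also have "1 - m * (Q * X) - l * (m * (Q * (X * Y))) = Q * (1 - m * X)"
    using q by (simp add: algebra_simps c)
  finally have "(1 - m * Z) * (A * B) = (1 - m * Y) * (Q * (1 + l * X)) * B"
    by (simp add: mult.assoc flip: A)
  also have "Q * (1 + l * X) = (1 - l * (m * (Q * (X * Y)))) + l * (Q * X)"
    using q by (simp add: algebra_simps c)
  \<comment> \<open>Both sides equal (1 - m Y) (1 + l Q X (1 - m Y)); moving 1 - m Y to the right
    end brings it next to \<open>B\<close>.\<close>
  also have "(1 - m * Y) * \<dots> = (1 + l * ((1 - m * Y) * (Q * X))) * (1 - m * Y)"
    by (simp add: algebra_simps c)
  also have "\<dots> * B = (1 + l * ((1 - m * Y) * (Q * X))) * (1 + l * Y)"
    by (simp add: mult.assoc flip: B)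
  also have "\<dots> = 1 + l * Z"
    unfolding Z by (simp add: algebra_simps c)
  finally show ?thesis .
qed

section \<open>Norm estimates for the concatenation law\<close>

lemma fps_resolvent_mult_bound:
  fixes A B :: "'a::real_normed_algebra_1 fps"
  assumes r: "0 \<le> r" and m: "0 \<le> m" "m \<le> 1" and A: "fps_nth A 0 = 1" and B: "fps_nth B 0 = 1"
    and x: "fps_bound r (fps_resolvent m A) x" and y: "fps_bound r (fps_resolvent m B) y"
    and xy: "(1 - m) * m * x * y < 1"
  shows "fps_bound r (fps_resolvent m (A * B))
    (y + (1 + m * y) * (1 / (1 - (1 - m) * m * x * y) * x) * (1 + (1 - m) * y))"
proof -
  define X Y where "X = fps_resolvent m A" and "Y = fps_resolvent m B"
  define P where "P = fps_real (1 - m) * fps_real m * X * Y"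
  have "fps_nth (1 + P) 0 = 1"
    by (simp add: P_def X_def fps_resolvent_nth_0[OF A] del: fps_const_mult)
  then obtain Q where Q: "Q * (1 + P) = 1" by (rule fps_has_inverse)
  have const: "fps_bound r (fps_real c :: 'a fps) c" if "0 \<le> c" for c
    using that by (intro fps_bound_const) simp
  have P: "fps_bound r P ((1 - m) * m * x * y)"
    unfolding P_def X_def Y_def using m r x y by (intro fps_bound_mult const) auto
  define Z where "Z = Y + (1 - fps_real m * Y) * (Q * X) * (1 + fps_real (1 - m) * Y)"
  have "(1 - fps_real m * Z) * (A * B) = 1 + fps_real (1 - m) * Z"
  proof (rule ring_resolvent_mult[where X = X and Y = Y and Q = Q])
    show "fps_real (1 - m) + fps_real m = (1 :: 'a fps)" by (rule fps_ext) simp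
    show "(1 - fps_real m * X) * A = 1 + fps_real (1 - m) * X"
      unfolding X_def by (rule fps_resolvent_iff[THEN iffD1, OF fps_resolvent_eq[OF A]])
    show "(1 - fps_real m * Y) * B = 1 + fps_real (1 - m) * Y"
      unfolding Y_def by (rule fps_resolvent_iff[THEN iffD1, OF fps_resolvent_eq[OF B]])
    show "Q * (1 + fps_real (1 - m) * fps_real m * X * Y) = 1"
      using Q unfolding P_def .
  qed (rule fps_real_commute Z_def)+
  then have "Z = fps_resolvent m (A * B)"
    by (intro fps_resolvent_unique fps_resolvent_iff[THEN iffD2]) (simp_all add: A B)
  moreover have "fps_bound r Z (y + (1 + m * y) * (1 / (1 - (1 - m) * m * x * y) * x) * (1 + (1 - m) * y))"
    unfolding Z_def using m r x y
    by (intro fps_bound_add fps_bound_mult fps_bound_diff fps_bound_1 const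
        fps_bound_left_inverse[OF r P xy Q]) (auto simp: X_def Y_def)
  ultimately show ?thesis by simp
qed

text \<open>A crude Neumann estimate, uniform in \<open>m\<close> because m a <= a. In the
  subdivision argument only its first order in \<open>a\<close> matters.\<close>

lemma fps_resolvent_bound_small:
  fixes A :: "'a::real_normed_algebra_1 fps"
  assumes r: "0 \<le> r" and m: "0 \<le> m" "m \<le> 1" and A: "fps_nth A 0 = 1"
    and a: "fps_bound r (A - 1) a" and a1: "a < 1"
  shows "fps_bound r (fps_resolvent m A) (a / (1 - a))"
proof -
  define U where "U = fps_real m * (A - 1)"
  have a0: "0 \<le> a" using r a by (rule fps_bound_nonneg)
  have "fps_bound r U (m * a)"
    unfolding U_def using m by (intro fps_bound_mult r fps_bound_const a) simp
  moreover have "m * a \<le> 1 * a" using m a0 by (intro mult_right_mono) auto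
  ultimately have U: "fps_bound r U a" by (auto intro: fps_bound_mono)
  have "fps_left_inverse (1 + U) 1 * (1 + U) = 1"
    by (rule fps_left_inverse) (simp add: A U_def)
  then have "fps_bound r (fps_left_inverse (1 + U) 1) (1 / (1 - a))"
    by (rule fps_bound_left_inverse[OF r U a1])
  then have "fps_bound r (fps_resolvent m A) (a * (1 / (1 - a)))"
    unfolding fps_resolvent_def U_def by (intro fps_bound_mult r a)
  then show ?thesis by simp
qed

text \<open>\<open>majorant\<close> solves \<open>x' = (1 + x / 2)\<^sup>2\<close>, \<open>x 0 = 0\<close>, the equation dominating
  \<open>X' = (1 + \<lambda> X) \<phi> (1 - (1 - \<lambda>) X)\<close> for the resolvent transform of the time-ordered
  exponential; it blows up at 2.\<close>

definition majorant :: "real \<Rightarrow> real" where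
  "majorant a = 2 * a / (2 - a)"

lemma majorant_nonneg: "0 \<le> a \<Longrightarrow> a < 2 \<Longrightarrow> 0 \<le> majorant a"
  by (simp add: majorant_def)

text \<open>The gap is (2 - a) (2 - b) - a b = 2 (2 - (a + b)), so the denominator in the
  concatenation law stays positive as long as a + b is below 2.\<close>

lemma majorant_mult:
  assumes "0 \<le> a" "0 \<le> b" "a + b < 2"
  shows "majorant a * majorant b / 4 < 1"
proof -
  have pos: "0 < (2 - a) * (2 - b)" using assms by simp
  have "(2 - a) * (2 - b) = 2 * (2 - (a + b)) + a * b" by (simp add: algebra_simps)
  then have "a * b < (2 - a) * (2 - b)" using assms by simp
  then have "a * b / ((2 - a) * (2 - b)) < 1" using pos by simp
  then show ?thesis by (simp add: majorant_def)
qed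

text \<open>This is the flow property of x' = (1 + x / 2)^2, in the shape of the concatenation law
  with \<lambda> = m = 1/2. Because it is an equality, cutting into many pieces loses
  nothing.\<close>

lemma majorant_add:
  assumes "0 \<le> a" "0 \<le> b" "a + b < 2"
  shows "majorant b + (1 + majorant b / 2)\<^sup>2 * (1 / (1 - majorant a * majorant b / 4) * majorant a)
    = majorant (a + b)"
proof -
  have ne: "2 - a \<noteq> 0" "2 - b \<noteq> 0" "2 - (a + b) \<noteq> 0" using assms by auto
  have gen: "(2 / v)\<^sup>2 * (1 / (2 * c / (u * v)) * (2 * a / u)) = 4 * a / (v * c)"
    if "u \<noteq> 0" "v \<noteq> 0" "c \<noteq> 0" for u v c :: real
    using that by (simp add: divide_simps power2_eq_square)
  have "1 - majorant a * majorant b / 4 = 2 * (2 - (a + b)) / ((2 - a) * (2 - b))"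
    unfolding majorant_def using ne by (simp add: divide_simps) (simp add: algebra_simps)
  moreover have "1 + majorant b / 2 = 2 / (2 - b)"
    unfolding majorant_def using ne by (simp add: divide_simps)
  ultimately have "majorant b + (1 + majorant b / 2)\<^sup>2 * (1 / (1 - majorant a * majorant b / 4) * majorant a)
    = 2 * b / (2 - b) + (2 / (2 - b))\<^sup>2 * (1 / (2 * (2 - (a + b)) / ((2 - a) * (2 - b))) * (2 * a / (2 - a)))"
    by (simp add: majorant_def)
  also have "\<dots> = 2 * b / (2 - b) + 4 * a / ((2 - b) * (2 - (a + b)))"
    by (simp only: gen[OF ne])
  also have "\<dots> = (2 * b * (2 - (a + b)) + 4 * a) / ((2 - b) * (2 - (a + b)))"
    using ne(2,3) by (metis add_divide_distrib mult_divide_mult_cancel_right)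
  also have "2 * b * (2 - (a + b)) + 4 * a = (2 - b) * (2 * (a + b))"
    by (simp add: algebra_simps)
  also have "\<dots> / ((2 - b) * (2 - (a + b))) = majorant (a + b)"
    using ne(2) unfolding majorant_def by (rule nonzero_mult_divide_mult_cancel_left)
  finally show ?thesis .
qed

lemma quarter_bound: "m * (1 - m) \<le> 1 / (4::real)"
  using zero_le_power2[of "m - 1/2"] by (simp add: power2_eq_square algebra_simps)

text \<open>The value m = 1/2 is the worst: m (1 - m) <= 1/4 controls the denominator, and also the
  outer factors, since (1 + m y) (1 + (1 - m) y) = 1 + y + m (1 - m) y^2. What remains is the
  addition law of the majorant.\<close>

lemma fps_resolvent_mult_majorant:
  fixes A B :: "'a::real_normed_algebra_1 fps"
  assumes r: "0 \<le> r" and m: "0 \<le> m" "m \<le> 1" and A: "fps_nth A 0 = 1" and B: "fps_nth B 0 = 1"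
    and ab: "0 \<le> a" "0 \<le> b" "a + b < 2"
    and x: "fps_bound r (fps_resolvent m A) (majorant a)"
    and y: "fps_bound r (fps_resolvent m B) (majorant b)"
  shows "fps_bound r (fps_resolvent m (A * B)) (majorant (a + b))"
proof -
  let ?x = "majorant a" and ?y = "majorant b"
  have x0: "0 \<le> ?x" and y0: "0 \<le> ?y" using ab by (auto intro!: majorant_nonneg)
  have q: "(1 - m) * m \<le> 1 / 4" using quarter_bound[of m] by (simp add: mult.commute)
  have "(1 - m) * m * (?x * ?y) \<le> 1 / 4 * (?x * ?y)"
    using q x0 y0 by (intro mult_right_mono) auto
  then have le: "(1 - m) * m * ?x * ?y \<le> ?x * ?y / 4" by simp
  have lt: "?x * ?y / 4 < 1" using ab by (rule majorant_mult)
  have y2: "(1 + m * ?y) * (1 + (1 - m) * ?y) \<le> (1 + ?y / 2)\<^sup>2"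
  proof -
    have "(1 + m * ?y) * (1 + (1 - m) * ?y) = 1 + ?y + (1 - m) * m * ?y\<^sup>2"
      by (simp add: algebra_simps power2_eq_square)
    also have "\<dots> \<le> 1 + ?y + 1 / 4 * ?y\<^sup>2" using q by (intro add_left_mono mult_right_mono) auto
    also have "\<dots> = (1 + ?y / 2)\<^sup>2" by (simp add: power2_eq_square algebra_simps)
    finally show ?thesis .
  qed
  have "fps_bound r (fps_resolvent m (A * B))
      (?y + (1 + m * ?y) * (1 / (1 - (1 - m) * m * ?x * ?y) * ?x) * (1 + (1 - m) * ?y))"
    using le lt by (intro fps_resolvent_mult_bound r m A B x y) auto
  then have *: "fps_bound r (fps_resolvent m (A * B))
      (?y + ((1 + m * ?y) * (1 + (1 - m) * ?y)) * (1 / (1 - (1 - m) * m * ?x * ?y) * ?x))"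
    by (simp only: ac_simps)
  have "1 / (1 - (1 - m) * m * ?x * ?y) \<le> 1 / (1 - ?x * ?y / 4)"
    using le lt by (intro divide_left_mono) auto
  then have "1 / (1 - (1 - m) * m * ?x * ?y) * ?x \<le> 1 / (1 - ?x * ?y / 4) * ?x"
    using x0 by (rule mult_right_mono)
  moreover have "0 \<le> 1 / (1 - (1 - m) * m * ?x * ?y) * ?x"
    using le lt x0 by (intro mult_nonneg_nonneg) auto
  ultimately have "((1 + m * ?y) * (1 + (1 - m) * ?y)) * (1 / (1 - (1 - m) * m * ?x * ?y) * ?x)
      \<le> (1 + ?y / 2)\<^sup>2 * (1 / (1 - ?x * ?y / 4) * ?x)"
    by (intro mult_mono[OF y2 _ zero_le_power2])
  then show ?thesis
    unfolding majorant_add[OF ab, symmetric]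
    by (intro fps_bound_mono[OF *] add_left_mono)
qed

section \<open>Products over ordered decompositions\<close>

text \<open>The left side consists of the first two Taylor terms of 2 x / (2 - x), and the other
  terms are nonnegative. It serves to express a bound on coefficients as an effective
  length.\<close>

lemma majorant_ge: "0 \<le> x \<Longrightarrow> x < 2 \<Longrightarrow> x + x\<^sup>2 / 2 \<le> majorant x"
proof -
  assume x: "0 \<le> x" "x < 2"
  have "(x + x\<^sup>2 / 2) * (2 - x) = 2 * x - x ^ 3 / 2"
    by (simp add: field_simps power2_eq_square power3_eq_cube)
  also have "\<dots> \<le> 2 * x" using x by simp
  finally show ?thesis using x by (simp add: majorant_def pos_le_divide_eq)
qed

section \<open>Low-order coefficients of products and of the resolvent transform\<close>

lemma fps_mult_nth_2: "fps_nth (F * G) 2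
  = fps_nth F 0 * fps_nth G 2 + fps_nth F 1 * fps_nth G 1 + fps_nth F 2 * fps_nth G 0"
  by (simp add: fps_mult_nth numeral_2_eq_2)

lemma fps_resolvent_nth_1:
  assumes "fps_nth A 0 = 1"
  shows "fps_nth (fps_resolvent m A) 1 = fps_nth A 1"
  using arg_cong[OF fps_resolvent_eq[OF assms, of m], of "\<lambda>F. fps_nth F 1"]
  by (simp add: fps_mult_nth assms fps_resolvent_nth_0)

lemma fps_resolvent_nth_2:
  assumes "fps_nth A 0 = 1"
  shows "fps_nth (fps_resolvent m A) 2 = fps_nth A 2 - m *\<^sub>R (fps_nth A 1 * fps_nth A 1)"
  using arg_cong[OF fps_resolvent_eq[OF assms, of m], of "\<lambda>F. fps_nth F 2"]
  by (simp add: fps_mult_nth_2 assms fps_resolvent_nth_0 fps_resolvent_nth_1 of_real_def algebra_simps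
      del: One_nat_def)

locale ordered_products =
  fixes A :: "real set \<Rightarrow> 'a::real_normed_algebra_1 fps" and \<tau> :: "real set \<Rightarrow> real"
  assumes A_0: "E \<in> sets borel \<Longrightarrow> fps_nth (A E) 0 = 1"
    and A_le: "E \<in> sets borel \<Longrightarrow> norm (fps_nth (A E) k) \<le> \<tau> E ^ k"
    and A_split: "E \<in> sets borel \<Longrightarrow> A E = A (E \<inter> {..s}) * A (E \<inter> {s<..})"
    and \<tau>_nonneg: "0 \<le> \<tau> E"
    and \<tau>_split: "E \<in> sets borel \<Longrightarrow> \<tau> E = \<tau> (E \<inter> {..s}) + \<tau> (E \<inter> {s<..})"
    and \<tau>_half: "E \<in> sets borel \<Longrightarrow> \<exists>s. \<tau> (E \<inter> {..s}) = \<tau> E / 2"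
begin

section \<open>Bounds by repeated halving\<close>

lemma halve:
  assumes E: "E \<in> sets borel"
  obtains E1 E2 s where "E1 = E \<inter> {..s}" "E2 = E \<inter> {s<..}" "E1 \<in> sets borel" "E2 \<in> sets borel"
    "\<tau> E1 = \<tau> E / 2" "\<tau> E2 = \<tau> E / 2" "A E = A E1 * A E2"
proof -
  obtain s where s: "\<tau> (E \<inter> {..s}) = \<tau> E / 2" using \<tau>_half[OF E] by blast
  then have "\<tau> (E \<inter> {s<..}) = \<tau> E / 2" using \<tau>_split[OF E, of s] by simp
  then show ?thesis
    using s E by (intro that[OF refl refl _ _ _ _ A_split[of E s]]) auto
qed

text \<open>\<open>A_le\<close> does not carry the factor 1/k! of ordered integrals, so a geometric
  series appears in place of exp(a) - 1. The two agree to first order, which suffices for short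
  pieces.\<close>

lemma A_minus_1_bound:
  assumes E: "E \<in> sets borel" and r: "0 \<le> r" and a: "r * \<tau> E < 1"
  shows "fps_bound r (A E - 1) (r * \<tau> E / (1 - r * \<tau> E))"
proof (rule fps_boundI)
  fix n
  let ?a = "r * \<tau> E"
  have a0: "0 \<le> ?a" using r \<tau>_nonneg by simp
  have "fps_wsum r (A E - 1) n \<le> (\<Sum>k\<le>n. ?a ^ k - (if k = 0 then 1 else 0))"
    unfolding fps_wsum_def
  proof (intro sum_mono)
    fix k
    have "norm (fps_nth (A E) k) * r ^ k \<le> \<tau> E ^ k * r ^ k"
      using A_le[OF E, of k] r by (simp add: mult_right_mono)
    also have "\<dots> = ?a ^ k" by (simp only: power_mult_distrib mult.commute)
    finally show "norm (fps_nth (A E - 1) k) * r ^ k \<le> ?a ^ k - (if k = 0 then 1 else 0)"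
      using A_0[OF E] by (cases "k = 0") simp_all
  qed
  also have "\<dots> = (\<Sum>k\<le>n. ?a ^ k) - 1" by (simp add: sum_subtractf)
  also have "(\<Sum>k\<le>n. ?a ^ k) = (1 - ?a ^ Suc n) / (1 - ?a)"
    using a by (subst sum_gp0) simp
  also have "\<dots> \<le> 1 / (1 - ?a)" using a a0 by (intro divide_right_mono) auto
  also have "1 / (1 - ?a) - 1 = ?a / (1 - ?a)" using a by (simp add: field_simps)
  finally show "fps_wsum r (A E - 1) n \<le> ?a / (1 - ?a)" by simp
qed

lemma resolvent_bound_small:
  assumes E: "E \<in> sets borel" and r: "0 \<le> r" and m: "0 \<le> m" "m \<le> 1" and a: "r * \<tau> E < 1 / 2"
  shows "fps_bound r (fps_resolvent m (A E)) (r * \<tau> E / (1 - 2 * (r * \<tau> E)))"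
proof -
  let ?a = "r * \<tau> E"
  have "fps_bound r (fps_resolvent m (A E)) (?a / (1 - ?a) / (1 - ?a / (1 - ?a)))"
    using a by (intro fps_resolvent_bound_small r m A_0 A_minus_1_bound E) (auto simp: field_simps)
  also have "?a / (1 - ?a) / (1 - ?a / (1 - ?a)) = ?a / (1 - 2 * ?a)"
  proof -
    have "1 - b / (1 - b) = (1 - 2 * b) / (1 - b)" if "b < 1 / 2" for b :: real
      using that by (simp add: divide_simps)
    from this[OF a] show ?thesis using a by simp
  qed
  finally show ?thesis .
qed

text \<open>The bound b / (1 - 2 b) for a small piece is exactly \<open>majorant\<close> of the
  inflated length b / (1 - 3 b / 2). All 2^n pieces b = a / 2^n share the same inflation factor, and
  inflated lengths add up under \<open>majorant\<close>.\<close>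

lemma resolvent_bound_halving:
  assumes r: "0 \<le> r" and m: "0 \<le> m" "m \<le> 1"
  shows "E \<in> sets borel \<Longrightarrow> r * \<tau> E / 2 ^ n < 1 / 2 \<Longrightarrow>
    r * \<tau> E / (1 - 3 * (r * \<tau> E) / 2 ^ Suc n) < 2 \<Longrightarrow>
    fps_bound r (fps_resolvent m (A E)) (majorant (r * \<tau> E / (1 - 3 * (r * \<tau> E) / 2 ^ Suc n)))"
proof (induction n arbitrary: E)
  case 0
  let ?a = "r * \<tau> E"
  have gen: "majorant (a / (1 - 3 * a / 2)) = a / (1 - 2 * a)" if "a < 1 / 2" for a
  proof -
    have ne: "1 - 3 * a / 2 \<noteq> 0" using that by simp
    have "2 - a / (1 - 3 * a / 2) = 2 * (1 - 2 * a) / (1 - 3 * a / 2)"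
      using ne by (simp add: divide_simps)
    moreover have "2 * (a / u) / (2 * w / u) = a / w" if "u \<noteq> 0" for u w :: real
      using that by simp
    ultimately show ?thesis using ne by (simp only: majorant_def)
  qed
  show ?case using resolvent_bound_small[OF 0(1) r m] 0(2) by (simp add: gen)
next
  case (Suc n)
  obtain E1 E2 s where E12: "E1 \<in> sets borel" "E2 \<in> sets borel" "\<tau> E1 = \<tau> E / 2" "\<tau> E2 = \<tau> E / 2"
    "A E = A E1 * A E2"
    using Suc.prems(1) by (rule halve)
  define b where "b = r * \<tau> E / (1 - 3 * (r * \<tau> E) / 2 ^ Suc (Suc n))"
  have a0: "0 \<le> r * \<tau> E" using r \<tau>_nonneg by simp
  have pos: "0 < 1 - 3 * (r * \<tau> E) / 2 ^ Suc (Suc n)"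
  proof -
    have "r * \<tau> E < 2 ^ n" using Suc.prems(2) by (simp add: field_simps)
    moreover have "0 < (2::real) ^ n" by simp
    ultimately have "3 * (r * \<tau> E) < 4 * 2 ^ n" by linarith
    then show ?thesis by (simp add: field_simps)
  qed
  have b0: "0 \<le> b" using a0 pos by (simp add: b_def)
  have half: "r * (\<tau> E / 2) / (1 - 3 * (r * (\<tau> E / 2)) / 2 ^ Suc n) = b / 2" by (simp add: b_def)
  have b2: "b < 2" using Suc.prems(3) by (simp only: b_def)
  have "fps_bound r (fps_resolvent m (A F)) (majorant (b / 2))"
    if "F \<in> sets borel" "\<tau> F = \<tau> E / 2" for F
  proof -
    have "r * \<tau> F / 2 ^ n < 1 / 2" using Suc.prems(2) by (simp add: that(2))
    moreover have eq: "r * \<tau> F / (1 - 3 * (r * \<tau> F) / 2 ^ Suc n) = b / 2"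
      unfolding that(2) by (rule half)
    moreover have "b / 2 < 2" using b2 b0 by simp
    ultimately show ?thesis using Suc.IH[OF that(1)] by (simp only:)
  qed
  then have "fps_bound r (fps_resolvent m (A E1 * A E2)) (majorant (b / 2 + b / 2))"
    using b2 b0 E12 by (intro fps_resolvent_mult_majorant r m A_0) auto
  then have "fps_bound r (fps_resolvent m (A E)) (majorant b)" by (simp add: E12(5))
  then show ?case unfolding b_def .
qed

text \<open>The inflation factor tends to 1 as the pieces shrink. The limit is taken at a fixed
  truncation \<open>N\<close>, where the bound is an inequality between real numbers.\<close>

lemma resolvent_bound:
  assumes E: "E \<in> sets borel" and r: "0 \<le> r" and m: "0 \<le> m" "m \<le> 1" and a: "r * \<tau> E < 2"
  shows "fps_bound r (fps_resolvent m (A E)) (majorant (r * \<tau> E))"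
proof (rule fps_boundI)
  fix N
  let ?a = "r * \<tau> E"
  define b where "b n = ?a / (1 - 3 * ?a / 2 ^ Suc n)" for n :: nat
  have p: "(\<lambda>n. x / 2 ^ n) \<longlonglongrightarrow> 0" for x :: real
    using tendsto_mult[OF tendsto_const[of x] LIMSEQ_inverse_realpow_zero[of 2]]
    by (simp add: divide_inverse)
  have "(\<lambda>n. 3 * ?a / 2 ^ Suc n) \<longlonglongrightarrow> 0"
    using p[of "3 * ?a", THEN LIMSEQ_Suc] .
  then have "b \<longlonglongrightarrow> ?a / (1 - 0)"
    unfolding b_def by (intro tendsto_intros) auto
  then have b: "b \<longlonglongrightarrow> ?a" by simp
  have lim: "(\<lambda>n. majorant (b n)) \<longlonglongrightarrow> majorant ?a"
    unfolding majorant_def using a by (intro tendsto_intros b) auto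
  have "eventually (\<lambda>n. ?a / 2 ^ n < 1 / 2) sequentially"
    using p by (rule order_tendstoD) simp
  moreover have "eventually (\<lambda>n. b n < 2) sequentially"
    using b a by (rule order_tendstoD)
  ultimately have "eventually (\<lambda>n. fps_wsum r (fps_resolvent m (A E)) N \<le> majorant (b n)) sequentially"
  proof eventually_elim
    case (elim n)
    show ?case
      unfolding b_def
      by (rule fps_boundD[OF resolvent_bound_halving[OF r m E elim(1) elim(2)[unfolded b_def]]])
  qed
  then show "fps_wsum r (fps_resolvent m (A E)) N \<le> majorant ?a"
    by (intro tendsto_lowerbound[OF lim]) auto
qed

text \<open>Cutting \<open>J\<close> in two, the right-hand side grows by exactly the bound for the commutator of the two parts,
  so repeated halving leaves only the error \<open>2 (\<tau> J)\<^sup>2 / 2\<^sup>n\<close>.\<close>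

lemma second_order_bound:
  fixes L D :: "real set \<Rightarrow> real"
  assumes approx: "\<And>E. E \<in> sets borel \<Longrightarrow> E \<subseteq> J \<Longrightarrow> norm (fps_nth (A E) 1 - L E *\<^sub>R c) \<le> D E"
    and L_nonneg: "\<And>E. 0 \<le> L E"
    and L_split: "\<And>E s. E \<in> sets borel \<Longrightarrow> E \<subseteq> J \<Longrightarrow> L E = L (E \<inter> {..s}) + L (E \<inter> {s<..})"
    and D_split: "\<And>E s. E \<in> sets borel \<Longrightarrow> E \<subseteq> J \<Longrightarrow> D E = D (E \<inter> {..s}) + D (E \<inter> {s<..})"
    and J: "J \<in> sets borel"
  shows "norm (fps_nth (A J) 2 - (1/2) *\<^sub>R (fps_nth (A J) 1 * fps_nth (A J) 1))
    \<le> norm c * L J * D J + (D J)\<^sup>2 / 2"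
proof -
  define M where "M E = fps_nth (A E) 2 - (1/2) *\<^sub>R (fps_nth (A E) 1 * fps_nth (A E) 1)" for E
  define B where "B E = norm c * L E * D E + (D E)\<^sup>2 / 2" for E
  \<comment> \<open>The coarse term 2 (\<tau> E)^2 halves with each subdivision, since two pieces of
    half the variation contribute a quarter each.\<close>
  have bound: "norm (M E) \<le> B E + 2 * (\<tau> E)\<^sup>2 / 2 ^ n" if "E \<in> sets borel" "E \<subseteq> J" for E n
    using that
  proof (induction n arbitrary: E)
    case 0
    have "norm (M E) \<le> norm (fps_nth (A E) 2) + norm ((1/2) *\<^sub>R (fps_nth (A E) 1 * fps_nth (A E) 1))"
      unfolding M_def by (rule norm_triangle_ineq4)
    also have "norm (fps_nth (A E) 2) \<le> (\<tau> E)\<^sup>2" by (rule A_le[OF 0(1)])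
    also have "norm ((1/2) *\<^sub>R (fps_nth (A E) 1 * fps_nth (A E) 1)) \<le> (\<tau> E)\<^sup>2"
    proof -
      have n1: "norm (fps_nth (A E) 1) \<le> \<tau> E" using A_le[OF 0(1), of 1] by simp
      have "norm (fps_nth (A E) 1 * fps_nth (A E) 1) \<le> norm (fps_nth (A E) 1) * norm (fps_nth (A E) 1)"
        by (rule norm_mult_ineq)
      also have "\<dots> \<le> \<tau> E * \<tau> E" using n1 by (intro mult_mono \<tau>_nonneg) auto
      finally have "norm (fps_nth (A E) 1 * fps_nth (A E) 1) \<le> (\<tau> E)\<^sup>2"
        by (simp only: power2_eq_square)
      moreover have "0 \<le> (\<tau> E)\<^sup>2" by simp
      moreover have "norm ((1/2) *\<^sub>R x) = norm x / 2" for x :: 'a by simp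
      ultimately show ?thesis by (smt (verit) field_sum_of_halves)
    qed
    also have "(\<tau> E)\<^sup>2 + (\<tau> E)\<^sup>2 \<le> 2 * (\<tau> E)\<^sup>2 / 2 ^ 0" by simp
    finally have "norm (M E) \<le> 2 * (\<tau> E)\<^sup>2 / 2 ^ 0" by simp
    moreover have "0 \<le> B E"
      unfolding B_def using order_trans[OF norm_ge_zero approx[OF 0]] L_nonneg
      by (intro add_nonneg_nonneg mult_nonneg_nonneg) auto
    ultimately show ?case by linarith
  next
    case (Suc n)
    obtain E1 E2 s where s: "E1 = E \<inter> {..s}" "E2 = E \<inter> {s<..}" and E12: "E1 \<in> sets borel" "E2 \<in> sets borel"
      "\<tau> E1 = \<tau> E / 2" "\<tau> E2 = \<tau> E / 2" "A E = A E1 * A E2"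
      using Suc.prems(1) by (rule halve)
    have sub: "E1 \<subseteq> J" "E2 \<subseteq> J" using Suc.prems(2) s by auto
    define a1 a2 where "a1 = fps_nth (A E1) 1" and "a2 = fps_nth (A E2) 1"
    define e1 e2 where "e1 = a1 - L E1 *\<^sub>R c" and "e2 = a2 - L E2 *\<^sub>R c"
    have e: "norm e1 \<le> D E1" "norm e2 \<le> D E2"
      unfolding e1_def e2_def a1_def a2_def by (intro approx E12 sub)+
    then have D0: "0 \<le> D E1" "0 \<le> D E2" using norm_ge_zero order_trans by blast+
    have half: "x = (1/2) *\<^sub>R x + (1/2) *\<^sub>R x" for x :: 'a
      by (simp flip: scaleR_add_left)
    have nth1: "fps_nth (A E) 1 = a1 + a2"
      unfolding E12(5) a1_def a2_def by (simp add: fps_mult_nth A_0 E12 add.commute)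
    have nth2: "fps_nth (A E) 2 = fps_nth (A E1) 2 + fps_nth (A E2) 2 + a1 * a2"
      unfolding E12(5) a1_def a2_def by (simp add: fps_mult_nth_2 A_0 E12 del: One_nat_def)
    have "M E = M E1 + M E2 + (1/2) *\<^sub>R (a1 * a2 - a2 * a1)"
      unfolding M_def nth1 nth2 a1_def[symmetric] a2_def[symmetric]
      using half[of "a1 * a2"] by (simp add: algebra_simps)
    \<comment> \<open>The commutator of \<open>L E1 *\<^sub>R c\<close> and
      \<open>L E2 *\<^sub>R c\<close> vanishes, so every remaining term carries an error
      \<open>e1\<close> or \<open>e2\<close>.\<close>
    also have "a1 * a2 - a2 * a1 = L E1 *\<^sub>R (c * e2 - e2 * c) + L E2 *\<^sub>R (e1 * c - c * e1) + (e1 * e2 - e2 * e1)"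
      unfolding e1_def e2_def by (simp add: algebra_simps)
    finally have M: "M E = M E1 + M E2 + (1/2) *\<^sub>R (L E1 *\<^sub>R (c * e2 - e2 * c) + L E2 *\<^sub>R (e1 * c - c * e1) + (e1 * e2 - e2 * e1))" .
    have comm: "norm (x * y - y * x) \<le> 2 * (p * q)" if "norm x \<le> p" "norm y \<le> q" for x y :: 'a and p q
    proof -
      have "norm x * norm y \<le> p * q" using that order_trans[OF norm_ge_zero that(1)] by (intro mult_mono) auto
      then show ?thesis
        using norm_triangle_ineq4[of "x * y" "y * x"] norm_mult_ineq[of x y] norm_mult_ineq[of y x]
        by (simp add: mult.commute[of "norm y"])
    qed
    have 1: "norm (L E1 *\<^sub>R (c * e2 - e2 * c)) \<le> L E1 * (2 * (norm c * D E2))"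
      using L_nonneg comm[OF order_refl e(2)] by (simp add: mult_left_mono)
    have 2: "norm (L E2 *\<^sub>R (e1 * c - c * e1)) \<le> L E2 * (2 * (D E1 * norm c))"
      using L_nonneg comm[OF e(1) order_refl] by (simp add: mult_left_mono)
    have 3: "norm (e1 * e2 - e2 * e1) \<le> 2 * (D E1 * D E2)" by (rule comm[OF e])
    have 4: "norm ((1/2) *\<^sub>R (L E1 *\<^sub>R (c * e2 - e2 * c) + L E2 *\<^sub>R (e1 * c - c * e1) + (e1 * e2 - e2 * e1)))
       \<le> norm c * L E1 * D E2 + norm c * L E2 * D E1 + D E1 * D E2"
    proof -
      have "norm (L E1 *\<^sub>R (c * e2 - e2 * c) + L E2 *\<^sub>R (e1 * c - c * e1) + (e1 * e2 - e2 * e1))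
        \<le> L E1 * (2 * (norm c * D E2)) + L E2 * (2 * (D E1 * norm c)) + 2 * (D E1 * D E2)"
        by (intro norm_triangle_le add_mono 1 2 3)
      moreover have "norm ((1/2) *\<^sub>R x) = norm x / 2" for x :: 'a by simp
      ultimately show ?thesis by (simp only:) (simp add: algebra_simps)
    qed
    have "norm (M E) \<le> norm (M E1) + norm (M E2)
        + (norm c * L E1 * D E2 + norm c * L E2 * D E1 + D E1 * D E2)"
      unfolding M by (intro norm_triangle_le add_mono order_refl 4)
    also have "\<dots> \<le> (B E1 + 2 * (\<tau> E1)\<^sup>2 / 2 ^ n) + (B E2 + 2 * (\<tau> E2)\<^sup>2 / 2 ^ n)
        + (norm c * L E1 * D E2 + norm c * L E2 * D E1 + D E1 * D E2)"
      using Suc.IH E12 sub by (intro add_mono order_refl) auto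
    also have "\<dots> = (B E1 + B E2 + (norm c * L E1 * D E2 + norm c * L E2 * D E1 + D E1 * D E2))
        + 2 * (\<tau> E)\<^sup>2 / 2 ^ Suc n"
      unfolding E12(3,4) by (simp add: power2_eq_square field_simps)
    also have "B E1 + B E2 + (norm c * L E1 * D E2 + norm c * L E2 * D E1 + D E1 * D E2) = B E"
      unfolding B_def L_split[OF Suc.prems, of s] D_split[OF Suc.prems, of s] s[symmetric]
      by (simp add: power2_eq_square algebra_simps)
    finally show ?case .
  qed
  have p: "(\<lambda>n. x / 2 ^ n) \<longlonglongrightarrow> 0" for x :: real
    using tendsto_mult[OF tendsto_const[of x] LIMSEQ_inverse_realpow_zero[of 2]]
    by (simp add: divide_inverse)
  have "(\<lambda>n. B J + 2 * (\<tau> J)\<^sup>2 / 2 ^ n) \<longlonglongrightarrow> B J + 0"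
    by (intro tendsto_intros p)
  then have "norm (M J) \<le> B J + 0"
    by (rule tendsto_lowerbound) (use bound[OF J order_refl] in simp_all)
  then show ?thesis by (simp add: M_def B_def)
qed

text \<open>In second order the majorant allows \<epsilon>^2 / 2, but |1/2 - m| <= 1/4 and the
  hypothesis \<open>M\<close> leave only 17/64 \<epsilon>^2. The difference is worth a shortening of
  the effective length by \<epsilon>^2 / 8; the larger radius and the coefficients from order 3 on
  cost only order \<epsilon>^3.\<close>

lemma resolvent_bound_gain:
  assumes E: "E \<in> sets borel" and \<epsilon>: "\<epsilon> = \<tau> E" "0 < \<epsilon>" "\<epsilon> \<le> 1 / 1000" and \<rho>: "\<rho> = 1 + \<epsilon>\<^sup>2 / 100"
    and m: "1 / 4 \<le> m" "m \<le> 3 / 4"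
    and M: "norm (fps_nth (A E) 2 - (1/2) *\<^sub>R (fps_nth (A E) 1 * fps_nth (A E) 1)) \<le> \<epsilon>\<^sup>2 / 64"
  shows "fps_bound \<rho> (fps_resolvent m (A E)) (majorant (\<epsilon> - \<epsilon>\<^sup>2 / 8))"
proof (rule fps_boundI)
  fix n
  let ?Y = "fps_resolvent m (A E)"
  \<comment> \<open>At this much larger radius the length is 1/4 and the small-piece bound is 1/2.
    Coefficients of order k >= 3 are then compared through (\<rho> / \<sigma>)^k <= (\<rho> /
    \<sigma>)^3, which is of order \<epsilon>^3.\<close>
  define \<sigma> where "\<sigma> = 1 / (4 * \<epsilon>)"
  have \<sigma>: "0 < \<sigma>" "\<sigma> * \<tau> E = 1 / 4" using \<epsilon> by (auto simp: \<sigma>_def)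
  have e2: "\<epsilon>\<^sup>2 \<le> \<epsilon> / 1000" using \<epsilon> by (simp add: power2_eq_square mult_left_mono)
  have e3: "\<epsilon> ^ 3 \<le> \<epsilon>\<^sup>2 / 1000"
    using mult_left_mono[OF \<epsilon>(3), of "\<epsilon>\<^sup>2"] by (simp add: power2_eq_square power3_eq_cube)
  have \<rho>1: "1 \<le> \<rho>" "\<rho> \<le> 1 + 1 / 100000" using \<epsilon> e2 by (auto simp: \<rho>)
  have "fps_bound \<sigma> ?Y (1 / 2)"
    using resolvent_bound_small[OF E, of \<sigma> m] \<sigma> m by simp
  then have tail: "fps_wsum \<sigma> ?Y n \<le> 1 / 2" by (rule fps_boundD)
  let ?q = "\<rho> * (4 * \<epsilon>)"
  have q: "0 \<le> ?q" "?q \<le> 1" using \<epsilon> \<rho>1 mult_mono[of \<rho> 2 "4 * \<epsilon>" "4 / 1000"] by auto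
  have large: "norm (fps_nth ?Y k) * \<rho> ^ k \<le> ?q ^ 3 * (norm (fps_nth ?Y k) * \<sigma> ^ k)" if "3 \<le> k" for k
  proof -
    have "\<rho> ^ k = ?q ^ k * \<sigma> ^ k"
      using \<epsilon> by (simp add: \<sigma>_def power_mult_distrib[symmetric])
    also have "\<dots> \<le> ?q ^ 3 * \<sigma> ^ k"
      using q \<sigma> that by (intro mult_right_mono power_decreasing) auto
    finally show ?thesis
      by (metis mult.left_commute mult_left_mono norm_ge_zero)
  qed
  have n1: "norm (fps_nth (A E) 1) \<le> \<epsilon>" using A_le[OF E, of 1] \<epsilon> by simp
  have Y0: "fps_nth ?Y 0 = 0" and Y1: "norm (fps_nth ?Y 1) \<le> \<epsilon>"
    using n1 by (simp_all add: fps_resolvent_nth_0 fps_resolvent_nth_1 A_0 E del: One_nat_def)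
  have Y2: "norm (fps_nth ?Y 2) \<le> 17 / 64 * \<epsilon>\<^sup>2"
  proof -
    let ?a = "fps_nth (A E) 1"
    \<comment> \<open>Centering at m = 1/2 separates the part bounded by \<open>M\<close> from a
      multiple of the square with factor 1/2 - m.\<close>
    have "fps_nth ?Y 2 = (fps_nth (A E) 2 - (1/2) *\<^sub>R (?a * ?a)) + (1/2 - m) *\<^sub>R (?a * ?a)"
      by (simp add: fps_resolvent_nth_2 A_0 E scaleR_left_diff_distrib del: One_nat_def)
    also have "norm \<dots> \<le> \<epsilon>\<^sup>2 / 64 + \<bar>1/2 - m\<bar> * norm (?a * ?a)"
      by (intro norm_triangle_le add_mono M) simp
    also have "\<bar>1/2 - m\<bar> * norm (?a * ?a) \<le> 1 / 4 * \<epsilon>\<^sup>2"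
    proof (intro mult_mono)
      show "norm (?a * ?a) \<le> \<epsilon>\<^sup>2"
        using norm_mult_ineq[of ?a ?a] mult_mono[OF n1 n1] \<epsilon> by (simp add: power2_eq_square)
      show "\<bar>1/2 - m\<bar> \<le> 1 / 4" using m by linarith
    qed auto
    finally show ?thesis by simp
  qed
  have "fps_wsum \<rho> ?Y n \<le> (\<Sum>k\<le>n. (if k \<le> 2 then norm (fps_nth ?Y k) * \<rho> ^ k else 0)
      + ?q ^ 3 * (norm (fps_nth ?Y k) * \<sigma> ^ k))"
    unfolding fps_wsum_def
  proof (intro sum_mono)
    fix k
    show "norm (fps_nth ?Y k) * \<rho> ^ k \<le> (if k \<le> 2 then norm (fps_nth ?Y k) * \<rho> ^ k else 0)
      + ?q ^ 3 * (norm (fps_nth ?Y k) * \<sigma> ^ k)"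
      using large[of k] q \<sigma> by (cases "k \<le> 2") auto
  qed
  also have "\<dots> = (\<Sum>k\<le>n. if k \<le> 2 then norm (fps_nth ?Y k) * \<rho> ^ k else 0) + ?q ^ 3 * fps_wsum \<sigma> ?Y n"
    by (simp add: sum.distrib sum_distrib_left fps_wsum_def)
  also have "(\<Sum>k\<le>n. if k \<le> 2 then norm (fps_nth ?Y k) * \<rho> ^ k else 0) \<le> (\<Sum>k\<le>2. norm (fps_nth ?Y k) * \<rho> ^ k)"
  proof -
    have "(\<Sum>k\<le>n. if k \<le> 2 then norm (fps_nth ?Y k) * \<rho> ^ k else 0)
        = (\<Sum>k\<in>{..n} \<inter> {..2}. norm (fps_nth ?Y k) * \<rho> ^ k)"
      by (simp add: sum.inter_restrict del: Int_atMost)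
    also have "\<dots> \<le> (\<Sum>k\<le>2. norm (fps_nth ?Y k) * \<rho> ^ k)"
      using \<rho>1 by (intro sum_mono2) auto
    finally show ?thesis .
  qed
  also have "(\<Sum>k\<le>2. norm (fps_nth ?Y k) * \<rho> ^ k) = norm (fps_nth ?Y 1) * \<rho> + norm (fps_nth ?Y 2) * \<rho>\<^sup>2"
    using Y0 by (simp add: numeral_2_eq_2)
  also have "\<dots> \<le> \<epsilon> * \<rho> + 17 / 64 * \<epsilon>\<^sup>2 * \<rho>\<^sup>2"
    using Y1 Y2 \<rho>1 by (intro add_mono mult_right_mono) auto
  also have "?q ^ 3 * fps_wsum \<sigma> ?Y n \<le> ?q ^ 3 * (1 / 2)"
    using tail q by (intro mult_left_mono) auto
  also have "?q ^ 3 * (1 / 2) = 32 * \<epsilon> ^ 3 * \<rho> ^ 3" by (simp add: power_mult_distrib)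
  also have "\<epsilon> * \<rho> = \<epsilon> + \<epsilon> ^ 3 / 100" by (simp add: \<rho> algebra_simps power2_eq_square power3_eq_cube)
  finally have le: "fps_wsum \<rho> ?Y n
      \<le> \<epsilon> + \<epsilon> ^ 3 / 100 + 17 / 64 * \<epsilon>\<^sup>2 * \<rho>\<^sup>2 + 32 * \<epsilon> ^ 3 * \<rho> ^ 3" by simp
  have r2: "\<rho>\<^sup>2 \<le> (1 + 1 / 100000)\<^sup>2" and r3: "\<rho> ^ 3 \<le> (1 + 1 / 100000) ^ 3"
    using \<rho>1 by (intro power_mono; simp)+
  have "17 / 64 * \<epsilon>\<^sup>2 * \<rho>\<^sup>2 \<le> 17 / 64 * \<epsilon>\<^sup>2 * (1 + 1 / 100000)\<^sup>2"
    using r2 by (intro mult_left_mono) auto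
  then have "17 / 64 * \<epsilon>\<^sup>2 * \<rho>\<^sup>2 \<le> 266 / 1000 * \<epsilon>\<^sup>2 - 1 / 10000 * \<epsilon>\<^sup>2"
    by (rule order_trans) (simp add: power2_eq_square)
  moreover have "32 * \<epsilon> ^ 3 * \<rho> ^ 3 \<le> 32 * (\<epsilon>\<^sup>2 / 1000) * (1 + 1 / 100000) ^ 3"
    using r3 e3 \<epsilon> \<rho>1 by (intro mult_mono) auto
  then have "32 * \<epsilon> ^ 3 * \<rho> ^ 3 \<le> 33 / 1000 * \<epsilon>\<^sup>2"
    by (rule order_trans) (simp add: power3_eq_cube)
  moreover have "0 \<le> \<epsilon>\<^sup>2" by simp
  \<comment> \<open>The second coefficient takes about 0.266 \<epsilon>^2 and the tail at most 0.033
    \<epsilon>^2; the term \<epsilon>^3 / 100 from the radius fits into what is left up to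
    3/10.\<close>
  ultimately have "fps_wsum \<rho> ?Y n \<le> \<epsilon> + 3 / 10 * \<epsilon>\<^sup>2"
    using le e3 by linarith
  \<comment> \<open>Up to third order the right side is \<epsilon> + 3/8 \<epsilon>^2, so the
    coefficient 3/10 leaves room.\<close>
  also have "\<dots> \<le> (\<epsilon> - \<epsilon>\<^sup>2 / 8) + (\<epsilon> - \<epsilon>\<^sup>2 / 8)\<^sup>2 / 2"
  proof -
    have "(\<epsilon> - \<epsilon>\<^sup>2 / 8)\<^sup>2 = \<epsilon>\<^sup>2 - \<epsilon> ^ 3 / 4 + (\<epsilon>\<^sup>2)\<^sup>2 / 64"
      by (simp add: power2_eq_square power3_eq_cube algebra_simps)
    moreover have "0 \<le> (\<epsilon>\<^sup>2)\<^sup>2 / 64" "0 \<le> \<epsilon>\<^sup>2" by simp_all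
    ultimately show ?thesis using e3 by linarith
  qed
  also have "\<dots> \<le> majorant (\<epsilon> - \<epsilon>\<^sup>2 / 8)"
  proof (rule majorant_ge)
    show "0 \<le> \<epsilon> - \<epsilon>\<^sup>2 / 8" using \<epsilon>(2) e2 by linarith
    have "0 \<le> \<epsilon>\<^sup>2" by simp
    then show "\<epsilon> - \<epsilon>\<^sup>2 / 8 < 2" using \<epsilon>(3) by linarith
  qed
  finally show "fps_wsum \<rho> ?Y n \<le> majorant (\<epsilon> - \<epsilon>\<^sup>2 / 8)" .
qed

text \<open>The gain on a single short interval only covers \<open>m\<close> near \<open>1/2\<close>; for the other \<open>m\<close> the factor
  \<open>m (1 - m)\<close> stays away from its critical value \<open>1/4\<close>.\<close>

lemma resolvent_bound_critical:
  assumes E: "E \<in> sets borel" and \<tau>2: "\<tau> E = 2"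
    and J: "J = E \<inter> {s<..} \<inter> {..s'}" and \<epsilon>: "0 < \<tau> J" "\<tau> J \<le> 1 / 1000"
    and M: "norm (fps_nth (A J) 2 - (1/2) *\<^sub>R (fps_nth (A J) 1 * fps_nth (A J) 1)) \<le> (\<tau> J)\<^sup>2 / 64"
  shows "\<exists>\<rho> C. 1 < \<rho> \<and> (\<forall>m\<in>{0..1}. fps_bound \<rho> (fps_resolvent m (A E)) C)"
proof -
  define \<epsilon> where "\<epsilon> = \<tau> J"
  \<comment> \<open>Over a remaining length below 2 this radius costs at most \<epsilon>^2 / 50,
    less than the gain \<epsilon>^2 / 8 on \<open>J\<close>.\<close>
  define \<rho> where "\<rho> = 1 + \<epsilon>\<^sup>2 / 100"
  have e: "0 < \<epsilon>" "\<epsilon> \<le> 1 / 1000" using \<epsilon> by (simp_all add: \<epsilon>_def)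
  have e2: "0 < \<epsilon>\<^sup>2" "\<epsilon>\<^sup>2 \<le> \<epsilon> / 1000" using e by (simp_all add: power2_eq_square mult_left_mono)
  then have e4: "0 \<le> \<epsilon> - \<epsilon>\<^sup>2 / 8" using e by linarith
  have \<rho>: "1 < \<rho>" "0 \<le> \<rho>" "\<rho> \<le> 1 + 1 / 1000" using e e2 by (auto simp: \<rho>_def)
  define E1 E2 E3 where "E1 = E \<inter> {..s}" and "E2 = E \<inter> {s<..}" and "E3 = E2 \<inter> {s'<..}"
  have meas: "E1 \<in> sets borel" "E2 \<in> sets borel" "E3 \<in> sets borel" "J \<in> sets borel"
    using E by (auto simp: E1_def E2_def E3_def J)
  have AE: "A E = A E1 * (A J * A E3)"
    using A_split[OF E, of s] A_split[OF meas(2), of s'] by (simp add: E1_def E2_def E3_def J)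
  have sum: "\<tau> E1 + \<epsilon> + \<tau> E3 = 2"
    using \<tau>_split[OF E, of s] \<tau>_split[OF meas(2), of s'] by (simp add: E1_def E2_def E3_def J \<tau>2 \<epsilon>_def)
  define d where "d = \<rho> * \<tau> E1 + ((\<epsilon> - \<epsilon>\<^sup>2 / 8) + \<rho> * \<tau> E3)"
  have d: "0 \<le> \<rho> * \<tau> E1" "0 \<le> \<rho> * \<tau> E3" "d < 2"
  proof -
    have "\<rho> * \<tau> E1 + \<rho> * \<tau> E3 = \<rho> * (2 - \<epsilon>)"
      using sum by (simp add: distrib_left[symmetric])
    also have "\<dots> \<le> (2 - \<epsilon>) + \<epsilon>\<^sup>2 / 50" using e by (simp add: \<rho>_def algebra_simps)
    finally show "d < 2" using e2 unfolding d_def by linarith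
  qed (use \<rho> \<tau>_nonneg in auto)
  \<comment> \<open>Slightly above 2 = \<open>majorant 1\<close>, the value for one half of
    \<open>E\<close>; the excess accommodates the factor \<rho>.\<close>
  define x :: real where "x = 21 / 10"
  define C where "C = majorant d + 200"
  have md: "0 \<le> majorant d"
    using d e4 by (intro majorant_nonneg) (auto simp: d_def)
  have "fps_bound \<rho> (fps_resolvent m (A E)) C" if m: "m \<in> {0..1}" for m
  proof (cases "1 / 4 \<le> m \<and> m \<le> 3 / 4")
    case True
    then have m: "0 \<le> m" "m \<le> 1" by auto
    have Jb: "fps_bound \<rho> (fps_resolvent m (A J)) (majorant (\<epsilon> - \<epsilon>\<^sup>2 / 8))"
      using resolvent_bound_gain[OF meas(4) \<epsilon>_def e \<rho>_def] True M by (simp add: \<epsilon>_def)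
    have b3: "fps_bound \<rho> (fps_resolvent m (A E3)) (majorant (\<rho> * \<tau> E3))"
      using d e e4 by (intro resolvent_bound meas \<rho> m) (auto simp: d_def)
    have b1: "fps_bound \<rho> (fps_resolvent m (A E1)) (majorant (\<rho> * \<tau> E1))"
      using d e e4 by (intro resolvent_bound meas \<rho> m) (auto simp: d_def)
    have J3: "fps_bound \<rho> (fps_resolvent m (A J * A E3)) (majorant ((\<epsilon> - \<epsilon>\<^sup>2 / 8) + \<rho> * \<tau> E3))"
      using d e e4 by (intro fps_resolvent_mult_majorant \<rho> m A_0 meas Jb b3) (auto simp: d_def)
    have "fps_bound \<rho> (fps_resolvent m (A E)) (majorant d)"
      unfolding AE d_def using d e4
      by (intro fps_resolvent_mult_majorant[OF \<rho>(2) m A_0[OF meas(1)] _ _ _ _ b1 J3])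
        (auto simp: d_def A_0 meas)
    then show ?thesis by (rule fps_bound_mono) (simp add: C_def)
  next
    case False
    with m have m: "0 \<le> m" "m \<le> 1" by auto
    \<comment> \<open>3/16 is the value of m (1 - m) at 1/4 and at 3/4.\<close>
    have mm: "(1 - m) * m \<le> 3 / 16"
    proof (cases "m \<le> 1 / 4")
      case True
      then have "0 \<le> (1 / 4 - m) * (3 / 4 - m)" by (intro mult_nonneg_nonneg) auto
      then show ?thesis by (simp add: field_simps)
    next
      case False
      then have "0 \<le> (m - 1 / 4) * (m - 3 / 4)"
        using \<open>\<not> (1 / 4 \<le> m \<and> m \<le> 3 / 4)\<close> by (intro mult_nonneg_nonneg) auto
      then show ?thesis by (simp add: field_simps)
    qed
    obtain H1 H2 s where H: "H1 \<in> sets borel" "H2 \<in> sets borel" "\<tau> H1 = \<tau> E / 2" "\<tau> H2 = \<tau> E / 2"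
      "A E = A H1 * A H2"
      using E by (rule halve)
    have mr: "majorant \<rho> \<le> x"
      using \<rho> by (simp add: majorant_def x_def pos_divide_le_eq)
    have hb: "fps_bound \<rho> (fps_resolvent m (A H)) x" if "H \<in> sets borel" "\<tau> H = \<tau> E / 2" for H
      using resolvent_bound[OF that(1) \<rho>(2) m] \<rho> mr that(2) \<tau>2 by (auto intro: fps_bound_mono)
    \<comment> \<open>3/16 times (21/10)^2 is about 0.827, so a single concatenation of two halves
      already closes.\<close>
    have xx: "(1 - m) * m * x * x \<le> 83 / 100"
      using mult_right_mono[OF mm, of "x * x"] by (simp add: x_def)
    have "fps_bound \<rho> (fps_resolvent m (A H1 * A H2))
        (x + (1 + m * x) * (1 / (1 - (1 - m) * m * x * x) * x) * (1 + (1 - m) * x))"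
      using xx by (intro fps_resolvent_mult_bound \<rho> m A_0 H hb) auto
    moreover have "x + (1 + m * x) * (1 / (1 - (1 - m) * m * x * x) * x) * (1 + (1 - m) * x)
        \<le> x + (1 + x) * (1 / (17 / 100) * x) * (1 + x)"
    proof (intro add_left_mono mult_mono)
      show "1 / (1 - (1 - m) * m * x * x) \<le> 1 / (17 / 100)"
        using xx by (intro divide_left_mono) auto
    qed (use m xx in \<open>auto simp: x_def\<close>)
    \<comment> \<open>The left side is about 121, covered by the summand 200 in
      \<open>C\<close>.\<close>
    moreover have "\<dots> \<le> C" using md by (simp add: x_def C_def)
    ultimately show ?thesis unfolding H(5) by (meson fps_bound_mono order_trans)
  qed
  then show ?thesis using \<rho>(1) by blast
qed

lemma resolvent_bound_subcritical:
  assumes E: "E \<in> sets borel" and \<tau>2: "\<tau> E < 2"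
  shows "\<exists>\<rho> C. 1 < \<rho> \<and> (\<forall>m\<in>{0..1}. fps_bound \<rho> (fps_resolvent m (A E)) C)"
proof -
  \<comment> \<open>Both demands, \<rho> > 1 and \<open>\<rho> * \<tau> E < 2\<close>, reduce to
    \<open>\<tau> E < 2\<close>.\<close>
  define \<rho> where "\<rho> = 4 / (2 + \<tau> E)"
  have "1 < \<rho>" "\<rho> * \<tau> E < 2"
    using \<tau>2 \<tau>_nonneg[of E] by (auto simp: \<rho>_def divide_simps)
  then have "1 < \<rho> \<and> (\<forall>m\<in>{0..1}. fps_bound \<rho> (fps_resolvent m (A E)) (majorant (\<rho> * \<tau> E)))"
    using resolvent_bound[OF E, of \<rho>] by simp
  then show ?thesis by blast
qed

end

section \<open>Strongly measurable integrable functions\<close>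

abbreviation "simple_integrable \<equiv> Bochner_Integration.simple_bochner_integrable"
abbreviation "integral_simple \<equiv> Bochner_Integration.simple_bochner_integral"

text \<open>The everywhere-convergent version of \<open>has_bochner_integral_normed\<close>: here
  \<open>norm (f z - s i z)\<close> is measurable for \<open>M\<close> itself, so that no completion is needed.\<close>

definition has_strong_integral :: "'a measure \<Rightarrow> ('a \<Rightarrow> 'b::real_normed_vector) \<Rightarrow> 'b \<Rightarrow> bool" where
  "has_strong_integral M f x \<longleftrightarrow>
    (\<exists>s. (\<forall>i. simple_integrable M (s i)) \<and>
         (\<forall>z\<in>space M. (\<lambda>i. s i z) \<longlonglongrightarrow> f z) \<and>
         (\<lambda>i. \<integral>\<^sup>+z. ennreal (norm (f z - s i z)) \<partial>M) \<longlonglongrightarrow> 0 \<and>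
         (\<lambda>i. integral_simple M (s i)) \<longlonglongrightarrow> x)"

section \<open>Measurability and uniqueness of strong integrals\<close>

lemmas simple_integrable_compose2 = simple_bochner_integrable_compose2

lemma simple_integrable_simple_function:
  "simple_integrable M s \<Longrightarrow> simple_function M s"
  by (auto elim: simple_bochner_integrable.cases)

lemma simple_integrable_norm_diff_measurable:
  assumes "simple_integrable M s" "simple_integrable M t"
  shows "(\<lambda>z. norm (s z - t z)) \<in> borel_measurable M"
  using simple_integrable_simple_function[OF simple_integrable_compose2[of "\<lambda>x y. norm (x - y)", OF _ assms]]
  by (auto intro: borel_measurable_simple_function)

text \<open>In a possibly nonseparable space the limit is handled through its distances to simple
  functions, which are limits of measurable real functions. Measurability of \<open>f\<close> itself
  is not claimed.\<close>

lemma simple_limit_norm_measurable: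
  fixes f :: "'a \<Rightarrow> 'b::real_normed_vector"
  assumes s: "\<And>i. simple_integrable M (s i)"
    and lim: "\<And>z. z \<in> space M \<Longrightarrow> (\<lambda>i. s i z) \<longlonglongrightarrow> f z"
    and t: "simple_integrable M t"
  shows "(\<lambda>z. norm (f z - t z)) \<in> borel_measurable M"
proof (rule borel_measurable_LIMSEQ_real)
  show "(\<lambda>z. norm (s i z - t z)) \<in> borel_measurable M" for i
    by (rule simple_integrable_norm_diff_measurable[OF s t])
  show "(\<lambda>i. norm (s i z - t z)) \<longlonglongrightarrow> norm (f z - t z)" if "z \<in> space M" for z
    by (intro tendsto_intros lim that)
qed

lemma simple_bochner_integral_dist:
  assumes s: "simple_integrable M s"
    and t: "simple_integrable M t"
  shows "ennreal (norm (integral_simple M s - integral_simple M t))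
    \<le> (\<integral>\<^sup>+z. norm (s z - t z) \<partial>M)"
proof -
  have d: "simple_integrable M (\<lambda>z. s z - t z)"
    by (rule simple_integrable_compose2[OF _ s t]) simp
  have n: "simple_integrable M (\<lambda>z. norm (s z - t z))"
    by (rule simple_integrable_compose2[OF _ s t]) simp
  have "norm (integral_simple M s - integral_simple M t)
      \<le> integral_simple M (\<lambda>z. norm (s z - t z))"
    unfolding simple_bochner_integral_diff[OF s t, symmetric]
    by (rule simple_bochner_integral_norm_bound[OF d])
  then show ?thesis
    unfolding simple_bochner_integral_eq_nn_integral[OF n norm_ge_zero, symmetric]
    by (rule ennreal_leI)
qed

lemma simple_integrable_zero: "simple_integrable M (\<lambda>_. 0)"
  by (auto intro!: simple_bochner_integrable.intros)

lemma simple_bochner_integral_zero: "integral_simple M (\<lambda>_. 0) = 0"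
  by (auto simp: simple_bochner_integral_def intro!: sum.neutral)

lemma has_strong_integral_measurable_norm:
  assumes "has_strong_integral M f x"
  shows "(\<lambda>z. norm (f z)) \<in> borel_measurable M"
proof -
  obtain s where s: "\<And>i. simple_integrable M (s i)"
    "\<And>z. z \<in> space M \<Longrightarrow> (\<lambda>i. s i z) \<longlonglongrightarrow> f z"
    using assms unfolding has_strong_integral_def by blast
  show ?thesis using simple_limit_norm_measurable[OF s simple_integrable_zero] by simp
qed

lemma tendsto_ennreal_zero_le:
  fixes f g :: "nat \<Rightarrow> ennreal"
  assumes "\<And>i. f i \<le> g i" "g \<longlonglongrightarrow> 0"
  shows "f \<longlonglongrightarrow> 0"
  by (rule tendsto_sandwich[OF _ _ tendsto_const assms(2)]) (use assms(1) in auto)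

text \<open>The simple integrals of the two approximating sequences differ by at most the sum of
  their L^1 errors, which tends to 0.\<close>

lemma has_strong_integral_AE_unique:
  fixes f g :: "'a \<Rightarrow> 'b::real_normed_vector"
  assumes f: "has_strong_integral M f x" and g: "has_strong_integral M g y"
    and eq: "AE z in M. f z = g z"
  shows "x = y"
proof -
  obtain s where s: "\<And>i. simple_integrable M (s i)"
    "\<And>z. z \<in> space M \<Longrightarrow> (\<lambda>i. s i z) \<longlonglongrightarrow> f z"
    "(\<lambda>i. \<integral>\<^sup>+z. ennreal (norm (f z - s i z)) \<partial>M) \<longlonglongrightarrow> 0"
    "(\<lambda>i. integral_simple M (s i)) \<longlonglongrightarrow> x"
    using f unfolding has_strong_integral_def by blast
  obtain t where t: "\<And>i. simple_integrable M (t i)"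
    "\<And>z. z \<in> space M \<Longrightarrow> (\<lambda>i. t i z) \<longlonglongrightarrow> g z"
    "(\<lambda>i. \<integral>\<^sup>+z. ennreal (norm (g z - t i z)) \<partial>M) \<longlonglongrightarrow> 0"
    "(\<lambda>i. integral_simple M (t i)) \<longlonglongrightarrow> y"
    using g unfolding has_strong_integral_def by blast
  let ?d = "\<lambda>i. integral_simple M (s i) - integral_simple M (t i)"
  let ?e = "\<lambda>i. (\<integral>\<^sup>+z. ennreal (norm (f z - s i z)) \<partial>M) + (\<integral>\<^sup>+z. ennreal (norm (g z - t i z)) \<partial>M)"
  have le: "ennreal (norm (?d i)) \<le> ?e i" for i
  proof -
    have "ennreal (norm (?d i)) \<le> (\<integral>\<^sup>+z. norm (s i z - t i z) \<partial>M)"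
      by (rule simple_bochner_integral_dist[OF s(1) t(1)])
    also have "\<dots> \<le> (\<integral>\<^sup>+z. ennreal (norm (f z - s i z)) + ennreal (norm (g z - t i z)) \<partial>M)"
      using eq
    proof (intro nn_integral_mono_AE, eventually_elim)
      case (elim z)
      have "s i z - t i z = (g z - t i z) - (f z - s i z)" using elim by simp
      then have "norm (s i z - t i z) \<le> norm (f z - s i z) + norm (g z - t i z)"
        using norm_triangle_ineq4[of "g z - t i z" "f z - s i z"] by simp
      then show ?case by (simp add: ennreal_leI flip: ennreal_plus)
    qed
    also have "\<dots> = ?e i"
      by (intro nn_integral_add measurable_compose[OF _ measurable_ennreal]
          simple_limit_norm_measurable[OF s(1,2) s(1)] simple_limit_norm_measurable[OF t(1,2) t(1)])
    finally show ?thesis .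
  qed
  have "?e \<longlonglongrightarrow> 0" using tendsto_add[OF s(3) t(3)] by simp
  with le have "(\<lambda>i. ennreal (norm (?d i))) \<longlonglongrightarrow> 0"
    by (rule tendsto_ennreal_zero_le)
  then have "(\<lambda>i. norm (?d i)) \<longlonglongrightarrow> 0"
    using tendsto_ennreal_iff[of "\<lambda>i. norm (?d i)" sequentially 0] by simp
  then have "?d \<longlonglongrightarrow> 0" by (rule tendsto_norm_zero_cancel)
  moreover have "?d \<longlonglongrightarrow> x - y" by (intro tendsto_intros s t)
  ultimately have "x - y = 0" by (rule LIMSEQ_unique[rotated])
  then show ?thesis by simp
qed

lemma has_strong_integral_imp_normed:
  assumes f: "has_strong_integral M f x" and eq: "AE z in M. f z = g z"
  shows "has_bochner_integral_normed M g x"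
proof -
  obtain s where s: "\<And>i. simple_integrable M (s i)"
    "\<And>z. z \<in> space M \<Longrightarrow> (\<lambda>i. s i z) \<longlonglongrightarrow> f z"
    "(\<lambda>i. \<integral>\<^sup>+z. ennreal (norm (f z - s i z)) \<partial>M) \<longlonglongrightarrow> 0"
    "(\<lambda>i. integral_simple M (s i)) \<longlonglongrightarrow> x"
    using f unfolding has_strong_integral_def by blast
  have "AE z in M. (\<lambda>i. s i z) \<longlonglongrightarrow> g z"
    using eq AE_space by eventually_elim (use s(2) in metis)
  moreover have "(\<integral>\<^sup>+z. ennreal (norm (g z - s i z)) \<partial>completion M)
      = (\<integral>\<^sup>+z. ennreal (norm (f z - s i z)) \<partial>M)" for i
    unfolding nn_integral_completion
    by (rule nn_integral_cong_AE) (use eq in eventually_elim, simp)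
  ultimately show ?thesis
    unfolding has_bochner_integral_normed_def using s by (intro exI[of _ s]) auto
qed

text \<open>The approximants are set to 0 on a measurable null set containing all points of
  nonconvergence, after which they converge everywhere. Keeping the zeros of \<open>f\<close> lets a
  modified density still vanish off the interval.\<close>

lemma has_bochner_integral_normed_imp_strong:
  fixes f :: "'a \<Rightarrow> 'b::real_normed_vector"
  assumes "has_bochner_integral_normed M f x"
  obtains f' where "has_strong_integral M f' x" "AE z in M. f z = f' z" "\<And>z. f z = 0 \<Longrightarrow> f' z = 0"
proof -
  obtain s where s: "\<And>i. simple_integrable M (s i)"
    "AE z in M. (\<lambda>i. s i z) \<longlonglongrightarrow> f z"
    "(\<lambda>i. \<integral>\<^sup>+z. ennreal (norm (f z - s i z)) \<partial>M) \<longlonglongrightarrow> 0"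
    "(\<lambda>i. integral_simple M (s i)) \<longlonglongrightarrow> x"
    using assms unfolding has_bochner_integral_normed_def nn_integral_completion by blast
  obtain N where N: "{z \<in> space M. \<not> (\<lambda>i. s i z) \<longlonglongrightarrow> f z} \<subseteq> N" "emeasure M N = 0" "N \<in> sets M"
    using s(2) by (rule AE_E)
  have AEN: "AE z in M. z \<notin> N"
    by (rule AE_not_in) (use N in auto)
  define t f' where "t i z = indicat_real (space M - N) z *\<^sub>R s i z" and "f' z = indicat_real (space M - N) z *\<^sub>R f z" for i z
  have ind: "simple_function M (indicat_real (space M - N))"
    using N by (intro simple_function_indicator) auto
  have t: "simple_integrable M (t i)" for i
  proof
    show "simple_function M (t i)"
      unfolding t_def by (rule simple_function_compose2[OF ind simple_integrable_simple_function[OF s(1)]])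
    have "emeasure M {y \<in> space M. t i y \<noteq> 0} \<le> emeasure M {y \<in> space M. s i y \<noteq> 0}"
      using simple_functionD(2)[OF simple_integrable_simple_function[OF s(1)[of i]], of "- {0}"]
      by (intro emeasure_mono) (auto simp: t_def vimage_def Int_def conj_commute)
    also have "\<dots> < \<infinity>"
      using s(1)[of i] by (auto elim!: simple_bochner_integrable.cases simp: less_top)
    finally show "emeasure M {y \<in> space M. t i y \<noteq> 0} \<noteq> \<infinity>" by simp
  qed
  have eq: "AE z in M. t i z = s i z" for i
    using AEN AE_space by eventually_elim (simp add: t_def)
  have eqf: "AE z in M. f z = f' z"
    using AEN AE_space by eventually_elim (simp add: f'_def)
  have "integral_simple M (t i) = integral_simple M (s i)" for i
  proof -
    have "(\<integral>\<^sup>+z. norm (t i z - s i z) \<partial>M) = (\<integral>\<^sup>+z. 0 \<partial>M)"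
      by (rule nn_integral_cong_AE) (use eq in eventually_elim, simp)
    then show ?thesis
      using simple_bochner_integral_dist[OF t s(1), of i i] by simp
  qed
  moreover have "(\<integral>\<^sup>+z. ennreal (norm (f' z - t i z)) \<partial>M) = (\<integral>\<^sup>+z. ennreal (norm (f z - s i z)) \<partial>M)" for i
    by (rule nn_integral_cong_AE) (use eq[of i] eqf in eventually_elim, simp)
  moreover have "(\<lambda>i. t i z) \<longlonglongrightarrow> f' z" if "z \<in> space M" for z
  proof (cases "z \<in> N")
    case False
    then have "(\<lambda>i. s i z) \<longlonglongrightarrow> f z" using N that by auto
    then show ?thesis unfolding t_def f'_def by (intro tendsto_intros)
  qed (simp add: t_def f'_def)
  ultimately have "has_strong_integral M f' x"
    unfolding has_strong_integral_def using s t by (intro exI[of _ t]) auto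
  then show ?thesis by (rule that) (use eqf in \<open>auto simp: f'_def\<close>)
qed

lemma has_bochner_integral_normed_unique:
  assumes "has_bochner_integral_normed M f x" "has_bochner_integral_normed M f y"
  shows "x = y"
proof -
  obtain g where g: "has_strong_integral M g x" "AE z in M. f z = g z"
    using assms(1) by (rule has_bochner_integral_normed_imp_strong)
  obtain h where h: "has_strong_integral M h y" "AE z in M. f z = h z"
    using assms(2) by (rule has_bochner_integral_normed_imp_strong)
  have "AE z in M. g z = h z" using g(2) h(2) by eventually_elim simp
  with g(1) h(1) show ?thesis by (rule has_strong_integral_AE_unique)
qed

lemma bochner_integral_normed_eq:
  assumes "has_strong_integral M f x" "AE z in M. f z = g z"
  shows "bochner_integral_normed M g = x"
proof -
  have "has_bochner_integral_normed M g x" using assms by (rule has_strong_integral_imp_normed)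
  moreover from this have "(THE y. has_bochner_integral_normed M g y) = x"
    by (intro the_equality has_bochner_integral_normed_unique)
  ultimately show ?thesis
    unfolding bochner_integral_normed_def bochner_integrable_normed_def by auto
qed

lemma has_strong_integral_norm_le:
  fixes f :: "'a \<Rightarrow> 'b::real_normed_vector"
  assumes "has_strong_integral M f x"
  shows "ennreal (norm x) \<le> (\<integral>\<^sup>+z. norm (f z) \<partial>M)" and "(\<integral>\<^sup>+z. norm (f z) \<partial>M) < \<infinity>"
proof -
  obtain s where s: "\<And>i. simple_integrable M (s i)"
    "\<And>z. z \<in> space M \<Longrightarrow> (\<lambda>i. s i z) \<longlonglongrightarrow> f z"
    "(\<lambda>i. \<integral>\<^sup>+z. ennreal (norm (f z - s i z)) \<partial>M) \<longlonglongrightarrow> 0"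
    "(\<lambda>i. integral_simple M (s i)) \<longlonglongrightarrow> x"
    using assms unfolding has_strong_integral_def by blast
  note meas = measurable_compose[OF simple_limit_norm_measurable[OF s(1,2) s(1)] measurable_ennreal]
    measurable_compose[OF has_strong_integral_measurable_norm[OF assms] measurable_ennreal]
  have measn: "(\<lambda>z. ennreal (norm (s i z))) \<in> borel_measurable M" for i
    using simple_integrable_norm_diff_measurable[OF s(1)[of i] simple_integrable_zero] by simp
  have le: "ennreal (norm (integral_simple M (s i)))
      \<le> (\<integral>\<^sup>+z. norm (f z) \<partial>M) + (\<integral>\<^sup>+z. norm (f z - s i z) \<partial>M)" for i
  proof -
    have "ennreal (norm (integral_simple M (s i))) \<le> (\<integral>\<^sup>+z. norm (s i z) \<partial>M)"
      using simple_bochner_integral_dist[OF s(1)[of i] simple_integrable_zero]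
      by (simp add: simple_bochner_integral_zero)
    also have "\<dots> \<le> (\<integral>\<^sup>+z. ennreal (norm (f z)) + ennreal (norm (f z - s i z)) \<partial>M)"
    proof (intro nn_integral_mono)
      fix z
      have "norm (s i z) \<le> norm (f z) + norm (f z - s i z)"
        using norm_triangle_ineq4[of "f z" "f z - s i z"] by simp
      then show "ennreal (norm (s i z)) \<le> ennreal (norm (f z)) + ennreal (norm (f z - s i z))"
        by (simp add: ennreal_leI flip: ennreal_plus)
    qed
    also have "\<dots> = (\<integral>\<^sup>+z. norm (f z) \<partial>M) + (\<integral>\<^sup>+z. norm (f z - s i z) \<partial>M)"
      by (intro nn_integral_add meas)
    finally show ?thesis .
  qed
  have lim1: "(\<lambda>i. (\<integral>\<^sup>+z. norm (f z) \<partial>M) + (\<integral>\<^sup>+z. norm (f z - s i z) \<partial>M)) \<longlonglongrightarrow> (\<integral>\<^sup>+z. norm (f z) \<partial>M)"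
    using tendsto_add[OF tendsto_const s(3), of "\<integral>\<^sup>+z. norm (f z) \<partial>M"] by simp
  have lim2: "(\<lambda>i. ennreal (norm (integral_simple M (s i)))) \<longlonglongrightarrow> ennreal (norm x)"
    by (intro tendsto_ennrealI tendsto_norm s)
  show "ennreal (norm x) \<le> (\<integral>\<^sup>+z. norm (f z) \<partial>M)"
    by (rule LIMSEQ_le[OF lim2 lim1]) (use le in blast)
  \<comment> \<open>For finiteness, one simple function within L^1 distance 1 is enough.\<close>
  have "eventually (\<lambda>i. (\<integral>\<^sup>+z. norm (f z - s i z) \<partial>M) < 1) sequentially"
    using s(3) by (rule order_tendstoD) simp
  then obtain i where i: "(\<integral>\<^sup>+z. norm (f z - s i z) \<partial>M) < 1"
    using eventually_happens'[OF sequentially_bot] by auto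
  have "(\<integral>\<^sup>+z. norm (f z) \<partial>M) \<le> (\<integral>\<^sup>+z. ennreal (norm (s i z)) + ennreal (norm (f z - s i z)) \<partial>M)"
  proof (intro nn_integral_mono)
    fix z
    have "norm (f z) \<le> norm (s i z) + norm (f z - s i z)"
      using norm_triangle_ineq[of "s i z" "f z - s i z"] by simp
    then show "ennreal (norm (f z)) \<le> ennreal (norm (s i z)) + ennreal (norm (f z - s i z))"
      by (simp add: ennreal_leI flip: ennreal_plus)
  qed
  also have "\<dots> = (\<integral>\<^sup>+z. norm (s i z) \<partial>M) + (\<integral>\<^sup>+z. norm (f z - s i z) \<partial>M)"
    by (intro nn_integral_add meas measn)
  also have "\<dots> < \<infinity>"
  proof -
    have sn: "simple_integrable M (\<lambda>z. norm (s i z))"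
      by (rule simple_integrable_compose2[where p="\<lambda>x y. norm x", OF _ s(1) s(1)]) simp
    have "(\<integral>\<^sup>+z. norm (s i z) \<partial>M) < \<infinity>"
      unfolding simple_bochner_integral_eq_nn_integral[OF sn norm_ge_zero, symmetric]
      by simp
    moreover have "(\<integral>\<^sup>+z. norm (f z - s i z) \<partial>M) < \<infinity>"
      using i by (rule less_trans) simp
    ultimately show ?thesis by simp
  qed
  finally show "(\<integral>\<^sup>+z. norm (f z) \<partial>M) < \<infinity>" .
qed

section \<open>Linearity, existence and transport of strong integrals\<close>

lemma has_strong_integral_add:
  assumes f: "has_strong_integral M f x" and g: "has_strong_integral M g y"
  shows "has_strong_integral M (\<lambda>z. f z + g z) (x + y)"
proof -
  obtain s where s: "\<And>i. simple_integrable M (s i)"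
    "\<And>z. z \<in> space M \<Longrightarrow> (\<lambda>i. s i z) \<longlonglongrightarrow> f z"
    "(\<lambda>i. \<integral>\<^sup>+z. ennreal (norm (f z - s i z)) \<partial>M) \<longlonglongrightarrow> 0"
    "(\<lambda>i. integral_simple M (s i)) \<longlonglongrightarrow> x"
    using f unfolding has_strong_integral_def by blast
  obtain t where t: "\<And>i. simple_integrable M (t i)"
    "\<And>z. z \<in> space M \<Longrightarrow> (\<lambda>i. t i z) \<longlonglongrightarrow> g z"
    "(\<lambda>i. \<integral>\<^sup>+z. ennreal (norm (g z - t i z)) \<partial>M) \<longlonglongrightarrow> 0"
    "(\<lambda>i. integral_simple M (t i)) \<longlonglongrightarrow> y"
    using g unfolding has_strong_integral_def by blast
  let ?e = "\<lambda>i. (\<integral>\<^sup>+z. ennreal (norm (f z - s i z)) \<partial>M) + (\<integral>\<^sup>+z. ennreal (norm (g z - t i z)) \<partial>M)"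
  have "(\<integral>\<^sup>+z. ennreal (norm (f z + g z - (s i z + t i z))) \<partial>M) \<le> ?e i" for i
  proof -
    have "(\<integral>\<^sup>+z. ennreal (norm (f z + g z - (s i z + t i z))) \<partial>M)
      \<le> (\<integral>\<^sup>+z. ennreal (norm (f z - s i z)) + ennreal (norm (g z - t i z)) \<partial>M)"
      by (intro nn_integral_mono) (simp add: ennreal_leI norm_diff_triangle_ineq flip: ennreal_plus)
    also have "\<dots> = ?e i"
      by (intro nn_integral_add measurable_compose[OF _ measurable_ennreal]
          simple_limit_norm_measurable[OF s(1,2) s(1)] simple_limit_norm_measurable[OF t(1,2) t(1)])
    finally show ?thesis .
  qed
  moreover have "?e \<longlonglongrightarrow> 0" using tendsto_add[OF s(3) t(3)] by simp
  ultimately have "(\<lambda>i. \<integral>\<^sup>+z. ennreal (norm (f z + g z - (s i z + t i z))) \<partial>M) \<longlonglongrightarrow> 0"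
    by (rule tendsto_ennreal_zero_le)
  then show ?thesis
    unfolding has_strong_integral_def using s t
    by (intro exI[of _ "\<lambda>i z. s i z + t i z"])
      (auto intro!: tendsto_add simple_integrable_compose2[where p="(+)"] simp: simple_bochner_integral_add)
qed

lemma has_strong_integral_bounded_linear:
  assumes T: "bounded_linear T" and f: "has_strong_integral M f x"
  shows "has_strong_integral M (\<lambda>z. T (f z)) (T x)"
proof -
  interpret T: bounded_linear T by fact
  obtain s where s: "\<And>i. simple_integrable M (s i)"
    "\<And>z. z \<in> space M \<Longrightarrow> (\<lambda>i. s i z) \<longlonglongrightarrow> f z"
    "(\<lambda>i. \<integral>\<^sup>+z. ennreal (norm (f z - s i z)) \<partial>M) \<longlonglongrightarrow> 0"
    "(\<lambda>i. integral_simple M (s i)) \<longlonglongrightarrow> x"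
    using f unfolding has_strong_integral_def by blast
  obtain K where K: "\<And>x. norm (T x) \<le> norm x * K" "0 \<le> K" using T.nonneg_bounded by blast
  let ?e = "\<lambda>i. ennreal K * (\<integral>\<^sup>+z. ennreal (norm (f z - s i z)) \<partial>M)"
  have "(\<integral>\<^sup>+z. ennreal (norm (T (f z) - T (s i z))) \<partial>M) \<le> ?e i" for i
  proof -
    have "(\<integral>\<^sup>+z. ennreal (norm (T (f z) - T (s i z))) \<partial>M)
      \<le> (\<integral>\<^sup>+z. ennreal K * ennreal (norm (f z - s i z)) \<partial>M)"
      using K by (intro nn_integral_mono)
        (simp add: ennreal_leI mult.commute flip: ennreal_mult T.diff)
    also have "\<dots> = ?e i"
      by (intro nn_integral_cmult measurable_compose[OF _ measurable_ennreal]
          simple_limit_norm_measurable[OF s(1,2) s(1)])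
    finally show ?thesis .
  qed
  moreover have "?e \<longlonglongrightarrow> 0" using ennreal_tendsto_cmult[OF _ s(3), of "ennreal K"] by simp
  ultimately have "(\<lambda>i. \<integral>\<^sup>+z. ennreal (norm (T (f z) - T (s i z))) \<partial>M) \<longlonglongrightarrow> 0"
    by (rule tendsto_ennreal_zero_le)
  then show ?thesis
    unfolding has_strong_integral_def using s
    by (intro exI[of _ "\<lambda>i z. T (s i z)"])
      (auto intro!: T.tendsto simple_integrable_compose2[where p="\<lambda>x y. T x"]
        simp: simple_bochner_integral_linear[OF T.linear] T.zero)
qed

lemma has_strong_integral_simple:
  "simple_integrable M s \<Longrightarrow>
    has_strong_integral M s (integral_simple M s)"
  unfolding has_strong_integral_def by (intro exI[of _ "\<lambda>_. s"]) auto

lemma has_strong_integral_zero: "has_strong_integral M (\<lambda>_. 0) 0"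
  using has_strong_integral_simple[OF simple_integrable_zero] by (simp add: simple_bochner_integral_zero)

lemma has_strong_integral_sum:
  "finite I \<Longrightarrow> (\<And>i. i \<in> I \<Longrightarrow> has_strong_integral M (f i) (x i)) \<Longrightarrow>
    has_strong_integral M (\<lambda>z. \<Sum>i\<in>I. f i z) (\<Sum>i\<in>I. x i)"
  by (induction I rule: finite_induct) (simp_all add: has_strong_integral_zero has_strong_integral_add)

lemma has_strong_integral_scaleR:
  "has_strong_integral M f x \<Longrightarrow> has_strong_integral M (\<lambda>z. r *\<^sub>R f z) (r *\<^sub>R x)"
  using has_strong_integral_bounded_linear[OF bounded_linear_scaleR_right] .

lemma has_strong_integral_diff:
  assumes "has_strong_integral M f x" "has_strong_integral M g y"
  shows "has_strong_integral M (\<lambda>z. f z - g z) (x - y)"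
  using has_strong_integral_add[OF assms(1) has_strong_integral_scaleR[OF assms(2), of "-1"]] by simp

lemma has_strong_integral_cong:
  "(\<And>z. z \<in> space M \<Longrightarrow> f z = g z) \<Longrightarrow> has_strong_integral M f x \<Longrightarrow> has_strong_integral M g x"
  unfolding has_strong_integral_def by (simp cong: nn_integral_cong)

text \<open>Completeness provides the value: L^1 convergence makes the simple integrals a Cauchy
  sequence.\<close>

lemma has_strong_integralI:
  fixes f :: "'a \<Rightarrow> 'b::banach"
  assumes s: "\<And>i. simple_integrable M (s i)"
    "\<And>z. z \<in> space M \<Longrightarrow> (\<lambda>i. s i z) \<longlonglongrightarrow> f z"
    "(\<lambda>i. \<integral>\<^sup>+z. ennreal (norm (f z - s i z)) \<partial>M) \<longlonglongrightarrow> 0"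
  shows "\<exists>x. has_strong_integral M f x"
proof -
  let ?I = "\<lambda>i. integral_simple M (s i)"
  let ?e = "\<lambda>i. \<integral>\<^sup>+z. ennreal (norm (f z - s i z)) \<partial>M"
  have le: "ennreal (norm (?I i - ?I j)) \<le> ?e i + ?e j" for i j
  proof -
    have "ennreal (norm (?I i - ?I j)) \<le> (\<integral>\<^sup>+z. norm (s i z - s j z) \<partial>M)"
      by (rule simple_bochner_integral_dist[OF s(1) s(1)])
    also have "\<dots> \<le> (\<integral>\<^sup>+z. ennreal (norm (f z - s i z)) + ennreal (norm (f z - s j z)) \<partial>M)"
    proof (intro nn_integral_mono)
      fix z
      have "norm (s i z - s j z) \<le> norm (f z - s i z) + norm (f z - s j z)"
        using norm_triangle_ineq4[of "f z - s j z" "f z - s i z"] by simp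
      then show "ennreal (norm (s i z - s j z)) \<le> ennreal (norm (f z - s i z)) + ennreal (norm (f z - s j z))"
        by (simp add: ennreal_leI flip: ennreal_plus)
    qed
    also have "\<dots> = ?e i + ?e j"
      by (intro nn_integral_add measurable_compose[OF _ measurable_ennreal]
          simple_limit_norm_measurable[OF s(1,2) s(1)])
    finally show ?thesis .
  qed
  have "Cauchy ?I"
  proof (rule CauchyI)
    fix e :: real assume e: "0 < e"
    have "eventually (\<lambda>i. ?e i < ennreal (e / 2)) sequentially"
      using s(3) by (rule order_tendstoD) (use e in simp)
    then obtain N where N: "\<And>i. i \<ge> N \<Longrightarrow> ?e i < ennreal (e / 2)"
      by (auto simp: eventually_sequentially)
    show "\<exists>M. \<forall>m\<ge>M. \<forall>n\<ge>M. norm (?I m - ?I n) < e"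
    proof (intro exI allI impI)
      fix m n assume "m \<ge> N" "n \<ge> N"
      then have "ennreal (norm (?I m - ?I n)) < ennreal (e / 2) + ennreal (e / 2)"
        by (intro le_less_trans[OF le] add_strict_mono N)
      then show "norm (?I m - ?I n) < e"
        using e by (simp add: ennreal_less_iff flip: ennreal_plus)
    qed
  qed
  then obtain x where "?I \<longlonglongrightarrow> x" using Cauchy_convergent convergent_def by blast
  then show ?thesis unfolding has_strong_integral_def using s by blast
qed

text \<open>The weights in view take finitely many values, since they record order patterns or
  membership in a set. Such a weight is bounded and keeps simple functions simple.\<close>

lemma has_strong_integral_simple_weight:
  fixes f :: "'a \<Rightarrow> 'b::banach" and w :: "'a \<Rightarrow> real"
  assumes f: "has_strong_integral M f x" and w: "simple_function M w"
  shows "\<exists>y. has_strong_integral M (\<lambda>z. w z *\<^sub>R f z) y"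
proof -
  obtain s where s: "\<And>i. simple_integrable M (s i)"
    "\<And>z. z \<in> space M \<Longrightarrow> (\<lambda>i. s i z) \<longlonglongrightarrow> f z"
    "(\<lambda>i. \<integral>\<^sup>+z. ennreal (norm (f z - s i z)) \<partial>M) \<longlonglongrightarrow> 0"
    "(\<lambda>i. integral_simple M (s i)) \<longlonglongrightarrow> x"
    using f unfolding has_strong_integral_def by blast
  have fin: "finite ((\<lambda>z. \<bar>w z\<bar>) ` space M)"
    using simple_functionD(1)[OF simple_function_compose1[OF w]] .
  define K where "K = Max (insert 0 ((\<lambda>z. \<bar>w z\<bar>) ` space M))"
  have K: "\<bar>w z\<bar> \<le> K" if "z \<in> space M" for z
    unfolding K_def using fin that by (intro Max_ge) auto
  have K0: "0 \<le> K"
    unfolding K_def using fin by (intro Max_ge) auto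
  have t: "simple_integrable M (\<lambda>z. w z *\<^sub>R s i z)" for i
  proof
    show "simple_function M (\<lambda>z. w z *\<^sub>R s i z)"
      by (rule simple_function_compose2[OF w simple_integrable_simple_function[OF s(1)]])
    have "emeasure M {y \<in> space M. w y *\<^sub>R s i y \<noteq> 0} \<le> emeasure M {y \<in> space M. s i y \<noteq> 0}"
      using simple_functionD(2)[OF simple_integrable_simple_function[OF s(1)[of i]], of "- {0}"]
      by (intro emeasure_mono) (auto simp: vimage_def Int_def conj_commute)
    also have "\<dots> < \<infinity>"
      using s(1)[of i] by (auto elim!: simple_bochner_integrable.cases simp: less_top)
    finally show "emeasure M {y \<in> space M. w y *\<^sub>R s i y \<noteq> 0} \<noteq> \<infinity>" by simp
  qed
  let ?e = "\<lambda>i. ennreal K * (\<integral>\<^sup>+z. ennreal (norm (f z - s i z)) \<partial>M)"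
  have "(\<integral>\<^sup>+z. ennreal (norm (w z *\<^sub>R f z - w z *\<^sub>R s i z)) \<partial>M) \<le> ?e i" for i
  proof -
    have "(\<integral>\<^sup>+z. ennreal (norm (w z *\<^sub>R f z - w z *\<^sub>R s i z)) \<partial>M)
      \<le> (\<integral>\<^sup>+z. ennreal K * ennreal (norm (f z - s i z)) \<partial>M)"
      using K K0 by (intro nn_integral_mono)
        (simp add: ennreal_leI mult_right_mono flip: ennreal_mult scaleR_diff_right)
    also have "\<dots> = ?e i"
      by (intro nn_integral_cmult measurable_compose[OF _ measurable_ennreal]
          simple_limit_norm_measurable[OF s(1,2) s(1)])
    finally show ?thesis .
  qed
  moreover have "?e \<longlonglongrightarrow> 0" using ennreal_tendsto_cmult[OF _ s(3), of "ennreal K"] by simp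
  ultimately have "(\<lambda>i. \<integral>\<^sup>+z. ennreal (norm (w z *\<^sub>R f z - w z *\<^sub>R s i z)) \<partial>M) \<longlonglongrightarrow> 0"
    by (rule tendsto_ennreal_zero_le)
  then show ?thesis
    by (intro has_strong_integralI[OF t]) (auto intro!: tendsto_intros s)
qed

lemma has_strong_integral_distr:
  assumes T: "T \<in> measurable M N" and N: "distr M N T = N" and f: "has_strong_integral N f x"
  shows "has_strong_integral M (\<lambda>z. f (T z)) x"
proof -
  obtain s where s: "\<And>i. simple_integrable N (s i)"
    "\<And>z. z \<in> space N \<Longrightarrow> (\<lambda>i. s i z) \<longlonglongrightarrow> f z"
    "(\<lambda>i. \<integral>\<^sup>+z. ennreal (norm (f z - s i z)) \<partial>N) \<longlonglongrightarrow> 0"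
    "(\<lambda>i. integral_simple N (s i)) \<longlonglongrightarrow> x"
    using f unfolding has_strong_integral_def by blast
  have Tsp: "T z \<in> space N" if "z \<in> space M" for z using T that by (rule measurable_space)
  have em: "emeasure M {z \<in> space M. P (T z)} = emeasure N {z \<in> space N. P z}"
    if "{z \<in> space N. P z} \<in> sets N" for P
    using emeasure_distr[OF T that, unfolded N] Tsp
    by (auto intro!: arg_cong[where f="emeasure M"])
  have sets: "{z \<in> space N. s i z \<in> Y} \<in> sets N" for i Y
    using simple_functionD(2)[OF simple_integrable_simple_function[OF s(1)[of i]], of Y]
    by (simp add: vimage_def Int_def conj_commute)
  have t: "simple_integrable M (\<lambda>z. s i (T z))" for i
  proof
    show "simple_function M (\<lambda>z. s i (T z))"
      by (rule simple_function_comp[OF T simple_integrable_simple_function[OF s(1)]])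
    show "emeasure M {z \<in> space M. s i (T z) \<noteq> 0} \<noteq> \<infinity>"
      using em[OF sets[of i "- {0}"]] s(1)[of i]
      by (auto elim!: simple_bochner_integrable.cases)
  qed
  have "integral_simple M (\<lambda>z. s i (T z)) = integral_simple N (s i)" for i
  proof -
    have "finite (s i ` space N)" using simple_functionD(1)[OF simple_integrable_simple_function[OF s(1)]] .
    have meq: "measure M {z \<in> space M. s i (T z) = y} = measure N {z \<in> space N. s i z = y}" for y
      using em[OF sets[of i "{y}"]] by (simp add: measure_def)
    have "integral_simple M (\<lambda>z. s i (T z))
      = (\<Sum>y\<in>(\<lambda>z. s i (T z)) ` space M. measure N {z \<in> space N. s i z = y} *\<^sub>R y)"
      by (simp add: simple_bochner_integral_def meq)
    \<comment> \<open>\<open>T\<close> need not be onto: a value attained only off its range has a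
      level set of measure zero.\<close>
    also have "\<dots> = (\<Sum>y\<in>s i ` space N. measure N {z \<in> space N. s i z = y} *\<^sub>R y)"
    proof (rule sum.mono_neutral_left)
      show "\<forall>y\<in>s i ` space N - (\<lambda>z. s i (T z)) ` space M. measure N {z \<in> space N. s i z = y} *\<^sub>R y = 0"
      proof
        fix y assume "y \<in> s i ` space N - (\<lambda>z. s i (T z)) ` space M"
        then have "y \<notin> (\<lambda>z. s i (T z)) ` space M" by simp
        then have "{z \<in> space M. s i (T z) = y} = {}" by blast
        then show "measure N {z \<in> space N. s i z = y} *\<^sub>R y = 0"
          unfolding meq[symmetric] by (simp only: measure_empty scaleR_zero_left)
      qed
    qed (use Tsp \<open>finite (s i ` space N)\<close> in auto)
    finally show ?thesis by (simp add: simple_bochner_integral_def)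
  qed
  moreover have "(\<integral>\<^sup>+z. ennreal (norm (f (T z) - s i (T z))) \<partial>M) = (\<integral>\<^sup>+z. ennreal (norm (f z - s i z)) \<partial>N)" for i
    using nn_integral_distr[OF T, of "\<lambda>z. ennreal (norm (f z - s i z))", unfolded N]
      simple_limit_norm_measurable[OF s(1,2) s(1)] by simp
  ultimately show ?thesis
    unfolding has_strong_integral_def using s t Tsp by (intro exI[of _ "\<lambda>i z. s i (T z)"]) auto
qed

section \<open>Products of functions of separate variables\<close>

lemma nn_integral_pair_mult:
  assumes "sigma_finite_measure N" and F: "F \<in> borel_measurable M" and G: "G \<in> borel_measurable N"
  shows "(\<integral>\<^sup>+z. F (fst z) * G (snd z) \<partial>(M \<Otimes>\<^sub>M N)) = (\<integral>\<^sup>+u. F u \<partial>M) * (\<integral>\<^sup>+v. G v \<partial>N)"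
proof -
  interpret sigma_finite_measure N by fact
  have "(\<lambda>z. F (fst z) * G (snd z)) \<in> borel_measurable (M \<Otimes>\<^sub>M N)"
    using F G by measurable
  from nn_integral_fst[OF this]
  have "(\<integral>\<^sup>+z. F (fst z) * G (snd z) \<partial>(M \<Otimes>\<^sub>M N)) = (\<integral>\<^sup>+u. \<integral>\<^sup>+v. F u * G v \<partial>N \<partial>M)" by simp
  also have "\<dots> = (\<integral>\<^sup>+u. F u * (\<integral>\<^sup>+v. G v \<partial>N) \<partial>M)"
    using G by (intro nn_integral_cong nn_integral_cmult)
  also have "\<dots> = (\<integral>\<^sup>+u. F u \<partial>M) * (\<integral>\<^sup>+v. G v \<partial>N)"
    using F by (intro nn_integral_multc)
  finally show ?thesis .
qed

text \<open>Both factors are constant on the products of a level set of \<open>s\<close> with one of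
  \<open>t\<close>, and the sum over pairs of values factors.\<close>

lemma simple_bochner_integral_pair_mult:
  fixes s :: "'a \<Rightarrow> 'c::real_normed_algebra" and t :: "'b \<Rightarrow> 'c"
  assumes N: "sigma_finite_measure N" and s: "simple_integrable M s"
    and t: "simple_integrable N t"
  shows "simple_integrable (M \<Otimes>\<^sub>M N) (\<lambda>z. s (fst z) * t (snd z))" (is ?i)
    and "integral_simple (M \<Otimes>\<^sub>M N) (\<lambda>z. s (fst z) * t (snd z))
      = integral_simple M s * integral_simple N t"
proof -
  interpret sigma_finite_measure N by fact
  have sf: "simple_function (M \<Otimes>\<^sub>M N) (\<lambda>z. s (fst z))" "simple_function (M \<Otimes>\<^sub>M N) (\<lambda>z. t (snd z))"
    by (rule simple_function_comp[OF measurable_fst simple_integrable_simple_function[OF s]],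
        rule simple_function_comp[OF measurable_snd simple_integrable_simple_function[OF t]])
  have sets: "{u \<in> space M. s u \<in> Y} \<in> sets M" "{v \<in> space N. t v \<in> Y} \<in> sets N" for Y
    using simple_functionD(2)[OF simple_integrable_simple_function[OF s], of Y]
      simple_functionD(2)[OF simple_integrable_simple_function[OF t], of Y]
    by (simp_all add: vimage_def Int_def conj_commute)
  show i: ?i
  proof
    show "simple_function (M \<Otimes>\<^sub>M N) (\<lambda>z. s (fst z) * t (snd z))"
      by (rule simple_function_compose2[OF sf])
    have "emeasure (M \<Otimes>\<^sub>M N) {z \<in> space (M \<Otimes>\<^sub>M N). s (fst z) * t (snd z) \<noteq> 0}
      \<le> emeasure (M \<Otimes>\<^sub>M N) ({u \<in> space M. s u \<noteq> 0} \<times> {v \<in> space N. t v \<noteq> 0})"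
      using sets[of "- {0}"] by (intro emeasure_mono) (auto simp: space_pair_measure)
    also have "\<dots> = emeasure M {u \<in> space M. s u \<noteq> 0} * emeasure N {v \<in> space N. t v \<noteq> 0}"
      using sets[of "- {0}"] by (intro emeasure_pair_measure_Times) auto
    also have "\<dots> < \<infinity>"
      using s t by (auto elim!: simple_bochner_integrable.cases
          simp: less_top ennreal_mult_less_top)
    finally show "emeasure (M \<Otimes>\<^sub>M N) {z \<in> space (M \<Otimes>\<^sub>M N). s (fst z) * t (snd z) \<noteq> 0} \<noteq> \<infinity>" by simp
  qed
  let ?g = "\<lambda>z. (s (fst z), t (snd z))"
  have "integral_simple (M \<Otimes>\<^sub>M N) (\<lambda>z. s (fst z) * t (snd z))
    = (\<Sum>y\<in>?g ` space (M \<Otimes>\<^sub>M N). measure (M \<Otimes>\<^sub>M N) {z \<in> space (M \<Otimes>\<^sub>M N). ?g z = y} *\<^sub>R (fst y * snd y))"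
    by (rule simple_bochner_integral_partition[OF i simple_function_Pair[OF sf]]) auto
  also have "?g ` space (M \<Otimes>\<^sub>M N) = s ` space M \<times> t ` space N"
    by (force simp: space_pair_measure)
  also have "(\<Sum>y\<in>s ` space M \<times> t ` space N.
      measure (M \<Otimes>\<^sub>M N) {z \<in> space (M \<Otimes>\<^sub>M N). ?g z = y} *\<^sub>R (fst y * snd y))
    = (\<Sum>y\<in>s ` space M \<times> t ` space N. (measure M {u \<in> space M. s u = fst y} *\<^sub>R fst y)
         * (measure N {v \<in> space N. t v = snd y} *\<^sub>R snd y))"
  proof (rule sum.cong[OF refl])
    fix y
    have "{z \<in> space (M \<Otimes>\<^sub>M N). ?g z = y} = {u \<in> space M. s u = fst y} \<times> {v \<in> space N. t v = snd y}"
      by (auto simp: space_pair_measure)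
    then have "measure (M \<Otimes>\<^sub>M N) {z \<in> space (M \<Otimes>\<^sub>M N). ?g z = y}
      = measure M {u \<in> space M. s u = fst y} * measure N {v \<in> space N. t v = snd y}"
      using sets(1)[of "{fst y}"] sets(2)[of "{snd y}"]
      by (simp add: measure_def emeasure_pair_measure_Times enn2real_mult)
    then show "measure (M \<Otimes>\<^sub>M N) {z \<in> space (M \<Otimes>\<^sub>M N). ?g z = y} *\<^sub>R (fst y * snd y)
      = (measure M {u \<in> space M. s u = fst y} *\<^sub>R fst y) * (measure N {v \<in> space N. t v = snd y} *\<^sub>R snd y)"
      by simp
  qed
  also have "\<dots> = integral_simple M s * integral_simple N t"
    unfolding simple_bochner_integral_def sum_product sum.cartesian_product
    by (simp add: case_prod_unfold)
  finally show "integral_simple (M \<Otimes>\<^sub>M N) (\<lambda>z. s (fst z) * t (snd z))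
      = integral_simple M s * integral_simple N t" .
qed

text \<open>Fubini for functions f(u) g(v), the form that iterated integrals require; the order of
  the factors in the algebra is preserved.\<close>

lemma has_strong_integral_pair_mult:
  fixes f :: "'a \<Rightarrow> 'c::real_normed_algebra" and g :: "'b \<Rightarrow> 'c"
  assumes N: "sigma_finite_measure N" and f: "has_strong_integral M f x" and g: "has_strong_integral N g y"
  shows "has_strong_integral (M \<Otimes>\<^sub>M N) (\<lambda>z. f (fst z) * g (snd z)) (x * y)"
proof -
  obtain s where s: "\<And>i. simple_integrable M (s i)"
    "\<And>z. z \<in> space M \<Longrightarrow> (\<lambda>i. s i z) \<longlonglongrightarrow> f z"
    "(\<lambda>i. \<integral>\<^sup>+z. ennreal (norm (f z - s i z)) \<partial>M) \<longlonglongrightarrow> 0"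
    "(\<lambda>i. integral_simple M (s i)) \<longlonglongrightarrow> x"
    using f unfolding has_strong_integral_def by blast
  obtain t where t: "\<And>i. simple_integrable N (t i)"
    "\<And>z. z \<in> space N \<Longrightarrow> (\<lambda>i. t i z) \<longlonglongrightarrow> g z"
    "(\<lambda>i. \<integral>\<^sup>+z. ennreal (norm (g z - t i z)) \<partial>N) \<longlonglongrightarrow> 0"
    "(\<lambda>i. integral_simple N (t i)) \<longlonglongrightarrow> y"
    using g unfolding has_strong_integral_def by blast
  let ?e = "\<lambda>i. \<integral>\<^sup>+z. ennreal (norm (f z - s i z)) \<partial>M"
  let ?d = "\<lambda>i. \<integral>\<^sup>+z. ennreal (norm (g z - t i z)) \<partial>N"
  let ?F = "\<integral>\<^sup>+z. ennreal (norm (f z)) \<partial>M" and ?G = "\<integral>\<^sup>+z. ennreal (norm (g z)) \<partial>N"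
  have mf: "(\<lambda>z. ennreal (norm (f z))) \<in> borel_measurable M"
      "\<And>i. (\<lambda>z. ennreal (norm (f z - s i z))) \<in> borel_measurable M"
    and mg: "(\<lambda>z. ennreal (norm (g z))) \<in> borel_measurable N"
      "\<And>i. (\<lambda>z. ennreal (norm (g z - t i z))) \<in> borel_measurable N"
    using has_strong_integral_measurable_norm[OF f] has_strong_integral_measurable_norm[OF g]
      simple_limit_norm_measurable[OF s(1,2) s(1)] simple_limit_norm_measurable[OF t(1,2) t(1)]
    by auto
  have le: "(\<integral>\<^sup>+z. ennreal (norm (f (fst z) * g (snd z) - s i (fst z) * t i (snd z))) \<partial>(M \<Otimes>\<^sub>M N))
      \<le> ?F * ?d i + ?e i * (?G + ?d i)" for i
  proof -
    \<comment> \<open>Replacing the norm of \<open>b'\<close> by those of \<open>b\<close> and b -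
      b' leaves only the limit functions and the two errors, whose integrals factor.\<close>
    have pt: "norm (a * b - a' * b') \<le> norm a * norm (b - b') + norm (a - a') * (norm b + norm (b - b'))"
      for a b a' b' :: 'c
    proof -
      have "a * b - a' * b' = a * (b - b') + (a - a') * b'" by (simp add: algebra_simps)
      also have "norm \<dots> \<le> norm a * norm (b - b') + norm (a - a') * norm b'"
        by (intro norm_triangle_le add_mono norm_mult_ineq)
      also have "norm b' \<le> norm b + norm (b - b')"
        using norm_triangle_ineq4[of b "b - b'"] by simp
      finally show ?thesis by (simp add: mult_left_mono)
    qed
    have "(\<integral>\<^sup>+z. ennreal (norm (f (fst z) * g (snd z) - s i (fst z) * t i (snd z))) \<partial>(M \<Otimes>\<^sub>M N))
      \<le> (\<integral>\<^sup>+z. ennreal (norm (f (fst z))) * ennreal (norm (g (snd z) - t i (snd z)))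
          + ennreal (norm (f (fst z) - s i (fst z))) * (ennreal (norm (g (snd z))) + ennreal (norm (g (snd z) - t i (snd z)))) \<partial>(M \<Otimes>\<^sub>M N))"
      by (intro nn_integral_mono) (simp add: ennreal_leI pt flip: ennreal_plus ennreal_mult)
    also have "\<dots> = (\<integral>\<^sup>+z. ennreal (norm (f (fst z))) * ennreal (norm (g (snd z) - t i (snd z))) \<partial>(M \<Otimes>\<^sub>M N))
          + (\<integral>\<^sup>+z. ennreal (norm (f (fst z) - s i (fst z))) * (ennreal (norm (g (snd z))) + ennreal (norm (g (snd z) - t i (snd z)))) \<partial>(M \<Otimes>\<^sub>M N))"
      by (intro nn_integral_add borel_measurable_times_ennreal borel_measurable_add
          measurable_compose[OF measurable_fst mf(1)] measurable_compose[OF measurable_fst mf(2)]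
          measurable_compose[OF measurable_snd mg(1)] measurable_compose[OF measurable_snd mg(2)])
    also have "\<dots> = ?F * ?d i + ?e i * (\<integral>\<^sup>+v. ennreal (norm (g v)) + ennreal (norm (g v - t i v)) \<partial>N)"
      using mf mg
        nn_integral_pair_mult[OF N, of "\<lambda>u. ennreal (norm (f u))" M "\<lambda>v. ennreal (norm (g v - t i v))"]
        nn_integral_pair_mult[OF N, of "\<lambda>u. ennreal (norm (f u - s i u))" M
          "\<lambda>v. ennreal (norm (g v)) + ennreal (norm (g v - t i v))"]
      by simp
    also have "(\<integral>\<^sup>+v. ennreal (norm (g v)) + ennreal (norm (g v - t i v)) \<partial>N) = ?G + ?d i"
      using mg by (intro nn_integral_add)
    finally show ?thesis .
  qed
  have fin: "?F < \<infinity>" "?G < \<infinity>" by (intro has_strong_integral_norm_le(2)[OF f] has_strong_integral_norm_le(2)[OF g])+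
  have Gd: "(\<lambda>i. ?G + ?d i) \<longlonglongrightarrow> ?G"
    using tendsto_add[OF tendsto_const t(3), of ?G] by simp
  have "(\<lambda>i. ?e i * (?G + ?d i)) \<longlonglongrightarrow> 0 * ?G"
    using fin by (intro tendsto_mult_ennreal s Gd) auto
  moreover have "(\<lambda>i. ?F * ?d i) \<longlonglongrightarrow> ?F * 0"
    using fin by (intro ennreal_tendsto_cmult t) auto
  ultimately have "(\<lambda>i. ?F * ?d i + ?e i * (?G + ?d i)) \<longlonglongrightarrow> 0"
    using tendsto_add by fastforce
  with le have "(\<lambda>i. \<integral>\<^sup>+z. ennreal (norm (f (fst z) * g (snd z) - s i (fst z) * t i (snd z))) \<partial>(M \<Otimes>\<^sub>M N)) \<longlonglongrightarrow> 0"
    by (rule tendsto_ennreal_zero_le)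
  then show ?thesis
    unfolding has_strong_integral_def
    by (intro exI[of _ "\<lambda>i z. s i (fst z) * t i (snd z)"])
      (auto intro!: tendsto_mult s t simp: simple_bochner_integral_pair_mult[OF N s(1) t(1)] space_pair_measure)
qed

section \<open>Cubes and their coordinate maps\<close>

abbreviation cube :: "nat \<Rightarrow> (nat \<Rightarrow> real) measure" where
  "cube k \<equiv> (\<Pi>\<^sub>M i\<in>{1..k}. lborel)"

interpretation lborel_product: product_sigma_finite "\<lambda>_::nat. lborel :: real measure"
  by standard

lemma space_cube: "space (cube k) = {1..k} \<rightarrow>\<^sub>E UNIV"
  by (simp add: space_PiM)

lemma space_cube' [simp]: "space (Pi\<^sub>M {Suc 0..k} (\<lambda>_. lborel)) = {Suc 0..k} \<rightarrow>\<^sub>E (UNIV :: real set)"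
  by (simp add: space_PiM)

lemma sigma_finite_cube: "sigma_finite_measure (cube k)"
  by (rule lborel_product.sigma_finite) simp

definition tail_coords :: "nat \<Rightarrow> nat \<Rightarrow> (nat \<Rightarrow> real) \<Rightarrow> nat \<Rightarrow> real" where
  "tail_coords a b t = (\<lambda>i\<in>{1..b}. t (a + i))"

definition split_coords :: "nat \<Rightarrow> nat \<Rightarrow> (nat \<Rightarrow> real) \<Rightarrow> (nat \<Rightarrow> real) \<times> (nat \<Rightarrow> real)" where
  "split_coords a b t = (restrict t {1..a}, tail_coords a b t)"

definition join_coords :: "nat \<Rightarrow> nat \<Rightarrow> (nat \<Rightarrow> real) \<times> (nat \<Rightarrow> real) \<Rightarrow> nat \<Rightarrow> real" where
  "join_coords a b = (\<lambda>(u, v). \<lambda>i\<in>{1..a + b}. if i \<le> a then u i else v (i - a))"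

lemma measurable_split_coords: "split_coords a b \<in> measurable (cube (a + b)) (cube a \<Otimes>\<^sub>M cube b)"
  unfolding split_coords_def tail_coords_def
  by (intro measurable_Pair measurable_restrict measurable_component_singleton) auto

lemma measurable_join_coords: "join_coords a b \<in> measurable (cube a \<Otimes>\<^sub>M cube b) (cube (a + b))"
  unfolding join_coords_def case_prod_unfold
proof (intro measurable_restrict)
  fix i assume i: "i \<in> {1..a + b}"
  show "(\<lambda>x. if i \<le> a then fst x i else snd x (i - a)) \<in> measurable (cube a \<Otimes>\<^sub>M cube b) lborel"
  proof (cases "i \<le> a")
    case True
    then show ?thesis
      using i measurable_compose[OF measurable_fst measurable_component_singleton[of i "{1..a}" "\<lambda>_. lborel"]]
      by simp
  next
    case False
    then have "i - a \<in> {1..b}" using i by auto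
    then show ?thesis
      using False measurable_compose[OF measurable_snd measurable_component_singleton[of "i - a" "{1..b}" "\<lambda>_. lborel"]]
      by simp
  qed
qed

lemma prod_split_nat:
  fixes f :: "nat \<Rightarrow> 'a::comm_monoid_mult"
  shows "(\<Prod>i\<in>{1..a + b}. f i) = (\<Prod>i\<in>{1..a}. f i) * (\<Prod>i\<in>{1..b}. f (a + i))"
  by (induction b) (simp_all add: mult.assoc)

text \<open>The product measure is determined by its values on boxes, and joining pulls a box back
  to a product of two boxes.\<close>

lemma distr_join_coords: "distr (cube a \<Otimes>\<^sub>M cube b) (cube (a + b)) (join_coords a b) = cube (a + b)"
proof (rule lborel_product.PiM_eqI)
  fix A :: "nat \<Rightarrow> real set" assume A: "\<And>i. i \<in> {1..a + b} \<Longrightarrow> A i \<in> sets lborel"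
  interpret b: sigma_finite_measure "cube b" by (rule sigma_finite_cube)
  have A1: "\<And>i. i \<in> {1..a} \<Longrightarrow> A i \<in> sets lborel" and A2: "\<And>i. i \<in> {1..b} \<Longrightarrow> A (a + i) \<in> sets lborel"
    using A by auto
  have eq: "join_coords a b -` (Pi\<^sub>E {1..a + b} A) \<inter> space (cube a \<Otimes>\<^sub>M cube b)
    = Pi\<^sub>E {1..a} A \<times> Pi\<^sub>E {1..b} (\<lambda>i. A (a + i))"
  proof (intro set_eqI iffI)
    fix z assume z: "z \<in> join_coords a b -` (Pi\<^sub>E {1..a + b} A) \<inter> space (cube a \<Otimes>\<^sub>M cube b)"
    obtain u v where uv: "z = (u, v)" by force
    have sp: "u \<in> {1..a} \<rightarrow>\<^sub>E UNIV" "v \<in> {1..b} \<rightarrow>\<^sub>E UNIV" using z uv by (auto simp: space_pair_measure space_cube)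
    have m: "join_coords a b (u, v) i \<in> A i" if "i \<in> {1..a + b}" for i using z uv that by (auto simp: PiE_iff)
    have "u i \<in> A i" if "i \<in> {1..a}" for i using m[of i] that by (simp add: join_coords_def)
    moreover have "v i \<in> A (a + i)" if "i \<in> {1..b}" for i using m[of "a + i"] that by (simp add: join_coords_def)
    ultimately show "z \<in> Pi\<^sub>E {1..a} A \<times> Pi\<^sub>E {1..b} (\<lambda>i. A (a + i))"
      using sp uv by (auto simp: PiE_iff)
  next
    fix z assume z: "z \<in> Pi\<^sub>E {1..a} A \<times> Pi\<^sub>E {1..b} (\<lambda>i. A (a + i))"
    obtain u v where uv: "z = (u, v)" by force
    have u: "\<And>i. i \<in> {1..a} \<Longrightarrow> u i \<in> A i" and v: "\<And>i. i \<in> {1..b} \<Longrightarrow> v i \<in> A (a + i)"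
      using z uv by (auto simp: PiE_iff)
    have "join_coords a b z i \<in> A i" if "i \<in> {1..a + b}" for i
    proof (cases "i \<le> a")
      case False
      then have "i - a \<in> {1..b}" using that by auto
      from v[OF this] show ?thesis using False that uv by (simp add: join_coords_def)
    qed (use u[of i] that uv in \<open>auto simp: join_coords_def\<close>)
    then show "z \<in> join_coords a b -` (Pi\<^sub>E {1..a + b} A) \<inter> space (cube a \<Otimes>\<^sub>M cube b)"
      using z by (auto simp: PiE_iff space_pair_measure space_cube join_coords_def extensional_def split: prod.splits)
  qed
  have "emeasure (distr (cube a \<Otimes>\<^sub>M cube b) (cube (a + b)) (join_coords a b)) (Pi\<^sub>E {1..a + b} A)
    = emeasure (cube a \<Otimes>\<^sub>M cube b) (Pi\<^sub>E {1..a} A \<times> Pi\<^sub>E {1..b} (\<lambda>i. A (a + i)))"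
    unfolding eq[symmetric] by (intro emeasure_distr measurable_join_coords sets_PiM_I_finite) (use A in auto)
  also have "\<dots> = emeasure (cube a) (Pi\<^sub>E {1..a} A) * emeasure (cube b) (Pi\<^sub>E {1..b} (\<lambda>i. A (a + i)))"
    by (intro b.emeasure_pair_measure_Times sets_PiM_I_finite) (use A1 A2 in auto)
  also have "\<dots> = (\<Prod>i\<in>{1..a}. emeasure lborel (A i)) * (\<Prod>i\<in>{1..b}. emeasure lborel (A (a + i)))"
    by (intro arg_cong2[where f = "(*)"] lborel_product.emeasure_PiM) (use A1 A2 in auto)
  finally show "emeasure (distr (cube a \<Otimes>\<^sub>M cube b) (cube (a + b)) (join_coords a b)) (Pi\<^sub>E {1..a + b} A)
    = (\<Prod>i\<in>{1..a + b}. emeasure lborel (A i))"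
    by (simp only: prod_split_nat)
qed simp_all

text \<open>Splitting undoes joining on the product space, so the claim follows by pushing forward
  the measure obtained by joining.\<close>

lemma distr_split_coords: "distr (cube (a + b)) (cube a \<Otimes>\<^sub>M cube b) (split_coords a b) = cube a \<Otimes>\<^sub>M cube b"
proof -
  have id: "(split_coords a b \<circ> join_coords a b) z = z" if "z \<in> space (cube a \<Otimes>\<^sub>M cube b)" for z
  proof -
    obtain u v where uv: "z = (u, v)" by force
    have sp: "u \<in> {1..a} \<rightarrow>\<^sub>E UNIV" "v \<in> {1..b} \<rightarrow>\<^sub>E UNIV"
      using that uv by (auto simp: space_pair_measure space_cube)
    have "restrict (join_coords a b (u, v)) {1..a} = u"
      by (rule extensionalityI[of _ "{1..a}"]) (use sp in \<open>auto simp: join_coords_def PiE_iff\<close>)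
    moreover have "tail_coords a b (join_coords a b (u, v)) = v"
      by (rule extensionalityI[of _ "{1..b}"]) (use sp in \<open>auto simp: join_coords_def tail_coords_def PiE_iff\<close>)
    ultimately show ?thesis by (simp add: split_coords_def uv)
  qed
  have "distr (cube (a + b)) (cube a \<Otimes>\<^sub>M cube b) (split_coords a b)
    = distr (distr (cube a \<Otimes>\<^sub>M cube b) (cube (a + b)) (join_coords a b)) (cube a \<Otimes>\<^sub>M cube b) (split_coords a b)"
    by (simp only: distr_join_coords)
  also have "\<dots> = distr (cube a \<Otimes>\<^sub>M cube b) (cube a \<Otimes>\<^sub>M cube b) (split_coords a b \<circ> join_coords a b)"
    by (rule distr_distr[OF measurable_split_coords measurable_join_coords])
  also have "\<dots> = distr (cube a \<Otimes>\<^sub>M cube b) (cube a \<Otimes>\<^sub>M cube b) (\<lambda>z. z)"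
    by (rule distr_cong) (use id in auto)
  finally show ?thesis by simp
qed

definition permute_coords :: "nat \<Rightarrow> (nat \<Rightarrow> nat) \<Rightarrow> (nat \<Rightarrow> real) \<Rightarrow> nat \<Rightarrow> real" where
  "permute_coords k \<sigma> t = (\<lambda>i\<in>{1..k}. t (\<sigma> i))"

lemma measurable_permute_coords:
  "\<sigma> permutes {1..k} \<Longrightarrow> permute_coords k \<sigma> \<in> measurable (cube k) (cube k)"
  unfolding permute_coords_def
  by (intro measurable_restrict measurable_component_singleton) (metis permutes_in_image)

text \<open>The preimage of a box is the box with permuted sides, which has the same volume.\<close>

lemma distr_permute_coords:
  assumes \<sigma>: "\<sigma> permutes {1..k}"
  shows "distr (cube k) (cube k) (permute_coords k \<sigma>) = cube k"
proof (rule lborel_product.PiM_eqI)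
  fix A :: "nat \<Rightarrow> real set" assume A: "\<And>i. i \<in> {1..k} \<Longrightarrow> A i \<in> sets lborel"
  let ?B = "\<lambda>i. A (inv \<sigma> i)"
  have \<sigma>': "inv \<sigma> permutes {1..k}" using \<sigma> by (rule permutes_inv)
  have in1: "\<sigma> i \<in> {1..k} \<longleftrightarrow> i \<in> {1..k}" and in2: "inv \<sigma> i \<in> {1..k} \<longleftrightarrow> i \<in> {1..k}" for i
    by (rule permutes_in_image[OF \<sigma>], rule permutes_in_image[OF \<sigma>'])
  have inv: "\<sigma> (inv \<sigma> i) = i" "inv \<sigma> (\<sigma> i) = i" for i
    by (rule permutes_inverses[OF \<sigma>])+
  have B: "?B i \<in> sets lborel" if "i \<in> {1..k}" for i using A in2 that by blast
  have eq: "permute_coords k \<sigma> -` (Pi\<^sub>E {1..k} A) \<inter> space (cube k) = Pi\<^sub>E {1..k} ?B"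
  proof (intro set_eqI iffI)
    fix t assume t: "t \<in> permute_coords k \<sigma> -` (Pi\<^sub>E {1..k} A) \<inter> space (cube k)"
    have "t i \<in> ?B i" if "i \<in> {1..k}" for i
    proof -
      have j: "inv \<sigma> i \<in> {1..k}" using in2 that by blast
      then have "permute_coords k \<sigma> t (inv \<sigma> i) \<in> A (inv \<sigma> i)" using t by (auto simp: PiE_iff)
      then show ?thesis using j by (simp add: permute_coords_def inv)
    qed
    then show "t \<in> Pi\<^sub>E {1..k} ?B" using t by (simp add: PiE_iff space_cube)
  next
    fix t assume t: "t \<in> Pi\<^sub>E {1..k} ?B"
    have "t (\<sigma> i) \<in> A i" if "i \<in> {1..k}" for i
      using PiE_mem[OF t, of "\<sigma> i"] in1 that by (simp add: inv)
    then show "t \<in> permute_coords k \<sigma> -` (Pi\<^sub>E {1..k} A) \<inter> space (cube k)"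
      using t by (simp add: PiE_iff space_cube permute_coords_def)
  qed
  have "emeasure (distr (cube k) (cube k) (permute_coords k \<sigma>)) (Pi\<^sub>E {1..k} A) = emeasure (cube k) (Pi\<^sub>E {1..k} ?B)"
    unfolding eq[symmetric] by (intro emeasure_distr measurable_permute_coords \<sigma> sets_PiM_I_finite) (use A in auto)
  also have "\<dots> = (\<Prod>i\<in>{1..k}. emeasure lborel (?B i))"
    by (intro lborel_product.emeasure_PiM) (use B in auto)
  also have "\<dots> = (\<Prod>i\<in>{1..k}. emeasure lborel (A i))"
    using prod.permute[OF \<sigma>', of "\<lambda>i. emeasure lborel (A i)"] by (simp add: comp_def)
  finally show "emeasure (distr (cube k) (cube k) (permute_coords k \<sigma>)) (Pi\<^sub>E {1..k} A)
    = (\<Prod>i\<in>{1..k}. emeasure lborel (A i))" .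
qed simp_all

section \<open>Null sets of the cube: exceptional coordinates and ties\<close>

lemma AE_cube_component:
  assumes P: "AE x in lborel. P x" and i: "i \<in> {1..k}"
  shows "AE t in cube k. P (t i)"
proof -
  obtain N where N: "{x \<in> space lborel. \<not> P x} \<subseteq> N" "emeasure lborel N = 0" "N \<in> sets lborel"
    using P by (rule AE_E)
  let ?B = "Pi\<^sub>E {1..k} (\<lambda>j. if j = i then N else UNIV)"
  have "emeasure (cube k) ?B = (\<Prod>j\<in>{1..k}. emeasure lborel (if j = i then N else UNIV))"
    using N by (intro lborel_product.emeasure_PiM) auto
  also have "\<dots> = 0" using i N by (intro prod_zero) auto
  finally have "emeasure (cube k) ?B = 0" .
  moreover have "?B \<in> sets (cube k)" using N by (intro sets_PiM_I_finite) auto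
  moreover have "{t \<in> space (cube k). \<not> P (t i)} \<subseteq> ?B"
    using N i by (auto simp: space_cube PiE_iff extensional_def)
  ultimately show ?thesis by (intro AE_I)
qed

lemma AE_cube_all:
  assumes "AE x in lborel. P x"
  shows "AE t in cube k. \<forall>i\<in>{1..k}. P (t i)"
  using AE_cube_component[OF assms] by (intro AE_finite_allI) auto

text \<open>With the other coordinates fixed, the slice in direction \<open>i\<close> is at most one
  point. As ties are negligible, almost every point determines a unique ordering of its
  coordinates.\<close>

lemma AE_cube_neq:
  assumes ij: "i \<in> {1..k}" "j \<in> {1..k}" "i \<noteq> j"
  shows "AE t in cube k. t i \<noteq> t j"
proof -
  let ?I = "{1..k} - {i}" and ?S = "{t \<in> space (cube k). t i = t j}"
  have ins: "insert i ?I = {1..k}" using ij by auto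
  have S: "?S \<in> sets (cube k)"
    using ij measurable_component_singleton[of i "{1..k}" "\<lambda>_. lborel :: real measure"]
      measurable_component_singleton[of j "{1..k}" "\<lambda>_. lborel :: real measure"] by measurable
  have "emeasure (cube k) ?S = (\<integral>\<^sup>+t. indicator ?S t \<partial>Pi\<^sub>M (insert i ?I) (\<lambda>_. lborel :: real measure))"
    unfolding ins using S by simp
  also have "\<dots> = (\<integral>\<^sup>+x. (\<integral>\<^sup>+y. indicator ?S (x(i := y)) \<partial>lborel) \<partial>Pi\<^sub>M ?I (\<lambda>_. lborel :: real measure))"
    by (intro lborel_product.product_nn_integral_insert) (use S ins in auto)
  also have "\<dots> = (\<integral>\<^sup>+x. 0 \<partial>Pi\<^sub>M ?I (\<lambda>_. lborel :: real measure))"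
  proof (intro nn_integral_cong)
    fix x :: "nat \<Rightarrow> real"
    have "(\<integral>\<^sup>+y. indicator ?S (x(i := y)) \<partial>lborel) \<le> (\<integral>\<^sup>+y. indicator {x j} y \<partial>lborel)"
      using ij by (intro nn_integral_mono) (auto split: split_indicator)
    then show "(\<integral>\<^sup>+y. indicator ?S (x(i := y)) \<partial>lborel) = 0" by simp
  qed
  finally have "emeasure (cube k) ?S = 0" by simp
  then show ?thesis using S by (intro AE_I[of _ _ ?S]) auto
qed

lemma AE_cube_inj: "AE t in cube k. inj_on t {1..k}"
proof -
  have "AE t in cube k. \<forall>i\<in>{1..k}. \<forall>j\<in>{1..k}. i \<noteq> j \<longrightarrow> t i \<noteq> t j"
    using AE_cube_neq by (intro AE_finite_allI) (auto intro!: AE_impI)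
  then show ?thesis by eventually_elim (auto simp: inj_on_def)
qed


section \<open>Weighted iterated integrals\<close>

definition path_product :: "(real \<Rightarrow> 'a::monoid_mult) \<Rightarrow> nat \<Rightarrow> (nat \<Rightarrow> real) \<Rightarrow> 'a" where
  "path_product h k t = prod_list (map (\<lambda>i. h (t i)) [1..<Suc k])"

lemma path_product_0 [simp]: "path_product h 0 t = 1"
  by (simp add: path_product_def)

lemma path_product_Suc: "path_product h (Suc k) t = path_product h k t * h (t (Suc k))"
  by (simp add: path_product_def)

lemma path_product_cong: "(\<And>i. i \<in> {1..k} \<Longrightarrow> h (t i) = g (u i)) \<Longrightarrow> path_product h k t = path_product g k u"
  unfolding path_product_def by (intro arg_cong[where f = prod_list] map_cong) auto

lemma path_product_split:
  "path_product h (a + b) t = path_product h a (fst (split_coords a b t)) * path_product h b (snd (split_coords a b t))"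
proof -
  have "[1..<Suc (a + b)] = [1..<Suc a] @ map (\<lambda>i. i + a) [1..<Suc b]"
    by (induction b) (simp_all add: add.commute)
  then have "path_product h (a + b) t = path_product h a t * path_product h b (\<lambda>i. t (i + a))"
    by (simp only: path_product_def map_append prod_list.append map_map comp_def)
  also have "path_product h a t = path_product h a (fst (split_coords a b t))"
    by (rule path_product_cong) (simp add: split_coords_def)
  also have "path_product h b (\<lambda>i. t (i + a)) = path_product h b (snd (split_coords a b t))"
    by (rule path_product_cong) (simp add: split_coords_def tail_coords_def add.commute)
  finally show ?thesis .
qed

lemma norm_path_product_le:
  fixes h :: "real \<Rightarrow> 'a::real_normed_algebra_1"
  shows "norm (path_product h k t) \<le> (\<Prod>i\<in>{1..k}. norm (h (t i)))"
proof (induction k)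
  case (Suc k)
  have "norm (path_product h (Suc k) t) \<le> norm (path_product h k t) * norm (h (t (Suc k)))"
    unfolding path_product_Suc by (rule norm_mult_ineq)
  also have "\<dots> \<le> (\<Prod>i\<in>{1..k}. norm (h (t i))) * norm (h (t (Suc k)))"
    using Suc by (intro mult_right_mono) auto
  finally show ?case by simp
qed simp

text \<open>Induction on \<open>k\<close>, splitting off the last coordinate. \<open>cube 0\<close>
  is a point of mass 1, and \<open>cube 1\<close> is identified with the line.\<close>

lemma has_strong_integral_path_product:
  fixes h :: "real \<Rightarrow> 'a::{real_normed_algebra_1, banach}"
  assumes h: "has_strong_integral lborel h H"
  shows "\<exists>y. has_strong_integral (cube k) (path_product h k) y"
proof (induction k)
  case 0
  have "emeasure (cube 0) (space (cube 0)) = 1"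
    by (simp add: PiM_empty)
  then have "simple_integrable (cube 0) (path_product h 0)"
    by (intro simple_bochner_integrable.intros) (auto simp: path_product_0[abs_def])
  then show ?case using has_strong_integral_simple by blast
next
  case (Suc k)
  then obtain y where y: "has_strong_integral (cube k) (path_product h k) y" by blast
  have "distr (cube 1) lborel (\<lambda>x. x 1) = lborel"
    using lborel_product.distr_singleton[of 1] by simp
  then have "has_strong_integral (cube 1) (\<lambda>t. h (t 1)) H"
    using measurable_component_singleton[of 1 "{1..1}" "\<lambda>_. lborel"]
    by (intro has_strong_integral_distr[OF _ _ h]) auto
  then have "has_strong_integral (cube 1) (path_product h 1) H"
    by (rule has_strong_integral_cong[rotated]) (simp add: path_product_def)
  from has_strong_integral_pair_mult[OF sigma_finite_cube y this]
  have "has_strong_integral (cube (k + 1)) (\<lambda>t. path_product h k (fst (split_coords k 1 t)) * path_product h 1 (snd (split_coords k 1 t))) (y * H)"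
    by (rule has_strong_integral_distr[OF measurable_split_coords distr_split_coords])
  then have "has_strong_integral (cube (k + 1)) (path_product h (k + 1)) (y * H)"
    by (rule has_strong_integral_cong[rotated]) (simp only: path_product_split)
  then show ?case by auto
qed

text \<open>The weight \<open>w\<close> stands for the ordered simplex, for a descent pattern, or
  for the weight of the resolvent transform. Identities between integrals thus become identities
  between weights.\<close>

definition iterated_integral :: "(real \<Rightarrow> 'a::real_normed_algebra_1) \<Rightarrow> nat \<Rightarrow> ((nat \<Rightarrow> real) \<Rightarrow> real) \<Rightarrow> 'a" where
  "iterated_integral h k w = bochner_integral_normed (cube k) (\<lambda>t. w t *\<^sub>R path_product h k t)"

lemma time_ordered_integral_prod_list:
  "time_ordered_integral k E (\<lambda>X. prod_list (map X [1..<Suc k])) h = iterated_integral h k (indicat_real (time_simplex k E))"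
  by (simp add: time_ordered_integral_def iterated_integral_def path_product_def)

lemma time_simplex_sets:
  assumes "E \<in> sets borel"
  shows "time_simplex k E \<in> sets (cube k)"
proof -
  have comp: "(\<lambda>t. t i) \<in> borel_measurable (cube k)" if "i \<in> {1..k}" for i
    using measurable_component_singleton[OF that, of "\<lambda>_. lborel :: real measure"] by simp
  have "time_simplex k E = {t \<in> space (cube k). (\<forall>i\<in>{1..k}. t i \<in> E) \<and> (\<forall>i\<in>{1..<k}. t i \<le> t (Suc i))}"
    by (auto simp: time_simplex_def space_cube PiE_iff)
  also have "\<dots> \<in> sets (cube k)"
  proof (intro sets.sets_Collect sets.sets_Collect_finite_All)
    fix i assume i: "i \<in> {1..k}"
    show "{t \<in> space (cube k). t i \<in> E} \<in> sets (cube k)"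
      using measurable_sets[OF comp[OF i] assms] by (simp add: vimage_def Int_def conj_commute)
  next
    fix i assume i: "i \<in> {1..<k}"
    show "{t \<in> space (cube k). t i \<le> t (Suc i)} \<in> sets (cube k)"
      using i by (intro borel_measurable_le comp) auto
  qed auto
  finally show ?thesis .
qed

section \<open>Cutting the ordered simplex at a time\<close>

lemma down_closed_interval:
  fixes S :: "nat set"
  assumes S: "S \<subseteq> {1..k}" and down: "\<And>i j. j \<in> S \<Longrightarrow> 1 \<le> i \<Longrightarrow> i \<le> j \<Longrightarrow> i \<in> S"
  shows "S = {1..card S}"
proof (cases "S = {}")
  case False
  have fin: "finite S" using S finite_subset by blast
  have "S = {1..Max S}"
    using down[OF Max_in[OF fin False]] S fin by (auto intro: Max_ge)
  then show ?thesis by (metis card_atLeastAtMost diff_Suc_1)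
qed simp

lemma chain_mono:
  fixes t :: "nat \<Rightarrow> 'a::order"
  assumes "\<forall>i\<in>{1..<k}. t i \<le> t (Suc i)" "1 \<le> i" "i \<le> j" "j \<le> k"
  shows "t i \<le> t j"
  using assms(3,4)
proof (induction j rule: dec_induct)
  case (step n)
  then have "t n \<le> t (Suc n)" using assms(1,2) by auto
  with step show ?case by simp
qed simp

lemma restrict_in_time_simplex:
  "restrict t {1..k} \<in> time_simplex k E \<longleftrightarrow> (\<forall>j\<in>{1..k}. t j \<in> E) \<and> (\<forall>j\<in>{1..<k}. t j \<le> t (Suc j))"
  by (auto simp: time_simplex_def PiE_iff)

lemma tail_in_time_simplex:
  "tail_coords a b t \<in> time_simplex b E
    \<longleftrightarrow> (\<forall>j\<in>{1..b}. t (a + j) \<in> E) \<and> (\<forall>j\<in>{1..<b}. t (a + j) \<le> t (a + Suc j))"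
  by (auto simp: time_simplex_def tail_coords_def PiE_iff)

lemma ball_shift: "(\<forall>j\<in>{1..<k - i}. Q (i + j)) \<longleftrightarrow> (\<forall>j\<in>{i<..<k}. Q j)" for i k :: nat
proof (intro iffI ballI)
  fix j assume Q: "\<forall>j\<in>{1..<k - i}. Q (i + j)" and j: "j \<in> {i<..<k}"
  have "Q (i + (j - i))" using Q j by (intro Q[rule_format]) auto
  then show "Q j" using j by simp
qed auto

text \<open>In an ordered tuple the points up to \<open>s\<close> form an initial segment, so
  precisely one cut position contributes, namely their number. Conversely, a nonzero summand forces
  the tuple to lie in the simplex.\<close>

lemma time_simplex_split:
  assumes t: "t \<in> space (cube k)"
  shows "indicat_real (time_simplex k E) t
    = (\<Sum>i=0..k. indicat_real (time_simplex i (E \<inter> {..s})) (fst (split_coords i (k - i) t))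
        * indicat_real (time_simplex (k - i) (E \<inter> {s<..})) (snd (split_coords i (k - i) t)))"
proof -
  define P where "P i \<longleftrightarrow> restrict t {1..i} \<in> time_simplex i (E \<inter> {..s})
      \<and> tail_coords i (k - i) t \<in> time_simplex (k - i) (E \<inter> {s<..})" for i
  define S where "S = {j \<in> {1..k}. t j \<le> s}"
  have rt: "restrict t {1..k} = t"
    using t by (simp add: space_cube PiE_iff extensional_restrict)
  have T: "t \<in> time_simplex k E \<longleftrightarrow> (\<forall>j\<in>{1..k}. t j \<in> E) \<and> (\<forall>j\<in>{1..<k}. t j \<le> t (Suc j))"
    using restrict_in_time_simplex[of t k E] by (simp only: rt)
  have PD: "(\<forall>j\<in>{1..i}. t j \<in> E \<and> t j \<le> s) \<and> (\<forall>j\<in>{1..<i}. t j \<le> t (Suc j))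
      \<and> (\<forall>j\<in>{i<..k}. t j \<in> E \<and> s < t j) \<and> (\<forall>j\<in>{i<..<k}. t j \<le> t (Suc j)) \<longleftrightarrow> P i" if "i \<le> k" for i
  proof -
    have all: "(\<forall>j\<in>{1..k - i}. Q (i + j)) \<longleftrightarrow> (\<forall>j\<in>{i<..k}. Q j)" for Q
      using ball_shift[of "Suc k" i Q] that
      by (simp add: Suc_diff_le atLeastLessThanSuc_atLeastAtMost greaterThanLessThan_eq
          atMost_atLeast0 lessThan_Suc_atMost greaterThanAtMost_def del: One_nat_def)
    show ?thesis
      unfolding P_def restrict_in_time_simplex tail_in_time_simplex
      using all[of "\<lambda>j. t j \<in> E \<inter> {s<..}"] ball_shift[of k i "\<lambda>j. t j \<le> t (Suc j)"] by auto
  qed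
  have card: "i = card S" and simp: "t \<in> time_simplex k E" if i: "i \<le> k" "P i" for i
  proof -
    have D: "\<And>j. j \<in> {1..i} \<Longrightarrow> t j \<in> E \<and> t j \<le> s" "\<And>j. j \<in> {1..<i} \<Longrightarrow> t j \<le> t (Suc j)"
      "\<And>j. j \<in> {i<..k} \<Longrightarrow> t j \<in> E \<and> s < t j" "\<And>j. j \<in> {i<..<k} \<Longrightarrow> t j \<le> t (Suc j)"
      using PD[OF i(1)] i(2) by auto
    have "S = {1..i}"
    proof (intro set_eqI iffI)
      fix j assume "j \<in> S"
      then show "j \<in> {1..i}" using D(3)[of j] by (cases "j \<le> i") (auto simp: S_def)
    qed (use D(1) i(1) in \<open>auto simp: S_def\<close>)
    then show "i = card S" by simp
    have "t j \<in> E" if "j \<in> {1..k}" for j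
      using D(1)[of j] D(3)[of j] that by (cases "j \<le> i") auto
    moreover have "t j \<le> t (Suc j)" if "j \<in> {1..<k}" for j
    proof -
      consider "j < i" | "j = i" | "i < j" by linarith
      then show ?thesis
      proof cases
        \<comment> \<open>At the junction the comparison passes through \<open>s\<close>: the left
          part ends at or before \<open>s\<close>, the right part starts after it.\<close>
        case 2
        then have "t j \<le> s" "s < t (Suc j)" using D(1)[of j] D(3)[of "Suc j"] that by auto
        then show ?thesis by simp
      qed (use D(2)[of j] D(4)[of j] that in auto)
    qed
    ultimately show "t \<in> time_simplex k E" by (simp add: T)
  qed
  have "S \<subseteq> {1..k}" by (auto simp: S_def)
  from card_mono[OF _ this] have S: "card S \<le> k" by simp
  have PS: "P (card S)" if "t \<in> time_simplex k E"
  proof -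
    have D: "\<And>j. j \<in> {1..k} \<Longrightarrow> t j \<in> E" "\<forall>j\<in>{1..<k}. t j \<le> t (Suc j)" using that T by auto
    have eq: "S = {1..card S}"
    proof (rule down_closed_interval)
      show "S \<subseteq> {1..k}" by (auto simp: S_def)
      fix i j assume ij: "j \<in> S" "1 \<le> i" "i \<le> j"
      then have "t i \<le> t j" by (intro chain_mono[OF D(2)]) (auto simp: S_def)
      with ij show "i \<in> S" by (auto simp: S_def)
    qed
    have le: "t j \<le> s" if "j \<in> {1..card S}" for j
      using subsetD[OF equalityD2[OF eq] that] by (simp add: S_def)
    have gt: "s < t j" if "j \<in> {card S<..k}" for j
    proof (rule ccontr)
      assume "\<not> s < t j"
      then have "j \<in> S" using that by (auto simp: S_def)
      from subsetD[OF equalityD1[OF eq] this] show False using that by simp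
    qed
    show ?thesis
      using PD[OF S] le gt D S by auto
  qed
  have "(\<Sum>i=0..k. indicat_real (time_simplex i (E \<inter> {..s})) (fst (split_coords i (k - i) t))
        * indicat_real (time_simplex (k - i) (E \<inter> {s<..})) (snd (split_coords i (k - i) t)))
    = (\<Sum>i=0..k. if i = card S then of_bool (t \<in> time_simplex k E) else 0)"
  proof (intro sum.cong refl)
    fix i assume i: "i \<in> {0..k}"
    have "P i \<longleftrightarrow> i = card S \<and> t \<in> time_simplex k E"
      using card[of i] simp[of i] PS i by auto
    then show "indicat_real (time_simplex i (E \<inter> {..s})) (fst (split_coords i (k - i) t))
        * indicat_real (time_simplex (k - i) (E \<inter> {s<..})) (snd (split_coords i (k - i) t))
      = (if i = card S then of_bool (t \<in> time_simplex k E) else 0)"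
      by (auto simp: split_coords_def P_def indicator_def)
  qed
  also have "\<dots> = indicat_real (time_simplex k E) t"
    using S by (simp add: indicator_def)
  finally show ?thesis ..
qed


locale integrable_density =
  fixes h :: "real \<Rightarrow> 'a::{real_normed_algebra_1, banach}" and H :: 'a
  assumes h: "has_strong_integral lborel h H"
begin

lemma has_iterated_integral:
  assumes "simple_function (cube k) w"
  shows "has_strong_integral (cube k) (\<lambda>t. w t *\<^sub>R path_product h k t) (iterated_integral h k w)"
proof -
  obtain y where "has_strong_integral (cube k) (path_product h k) y"
    using has_strong_integral_path_product[OF h] by blast
  then obtain x where x: "has_strong_integral (cube k) (\<lambda>t. w t *\<^sub>R path_product h k t) x"
    using has_strong_integral_simple_weight assms by blast
  then have "iterated_integral h k w = x"
    unfolding iterated_integral_def by (rule bochner_integral_normed_eq) simp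
  with x show ?thesis by simp
qed

lemma iterated_integral_cong_AE:
  assumes "simple_function (cube k) w" "simple_function (cube k) w'" "AE t in cube k. w t = w' t"
  shows "iterated_integral h k w = iterated_integral h k w'"
  by (rule has_strong_integral_AE_unique[OF has_iterated_integral[OF assms(1)] has_iterated_integral[OF assms(2)]])
    (use assms(3) in eventually_elim, simp)

lemma iterated_integral_sum:
  assumes "finite I" "\<And>i. i \<in> I \<Longrightarrow> simple_function (cube k) (w i)"
  shows "iterated_integral h k (\<lambda>t. \<Sum>i\<in>I. c i * w i t) = (\<Sum>i\<in>I. c i *\<^sub>R iterated_integral h k (w i))"
proof -
  have "has_strong_integral (cube k) (\<lambda>t. \<Sum>i\<in>I. c i *\<^sub>R (w i t *\<^sub>R path_product h k t)) (\<Sum>i\<in>I. c i *\<^sub>R iterated_integral h k (w i))"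
    using assms by (intro has_strong_integral_sum has_strong_integral_scaleR has_iterated_integral)
  then have "has_strong_integral (cube k) (\<lambda>t. (\<Sum>i\<in>I. c i * w i t) *\<^sub>R path_product h k t) (\<Sum>i\<in>I. c i *\<^sub>R iterated_integral h k (w i))"
    by (rule has_strong_integral_cong[rotated]) (simp add: scaleR_sum_left)
  then show ?thesis unfolding iterated_integral_def by (rule bochner_integral_normed_eq) simp
qed

lemma simple_function_split:
  assumes "simple_function (cube a) w" "simple_function (cube b) w'"
  shows "simple_function (cube (a + b)) (\<lambda>t. w (fst (split_coords a b t)) * w' (snd (split_coords a b t)) :: real)"
  by (intro simple_function_mult simple_function_comp[OF _ assms(1)] simple_function_comp[OF _ assms(2)]
      measurable_compose[OF measurable_split_coords measurable_fst]
      measurable_compose[OF measurable_split_coords measurable_snd])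

text \<open>The path product factors along the splitting of the coordinates, so a product of
  integrals corresponds to the tensor product of the weights.\<close>

lemma iterated_integral_mult:
  assumes w: "simple_function (cube a) w" "simple_function (cube b) w'"
  shows "iterated_integral h a w * iterated_integral h b w'
    = iterated_integral h (a + b) (\<lambda>t. w (fst (split_coords a b t)) * w' (snd (split_coords a b t)))"
proof -
  from has_strong_integral_pair_mult[OF sigma_finite_cube has_iterated_integral[OF w(1)] has_iterated_integral[OF w(2)]]
  have "has_strong_integral (cube (a + b)) (\<lambda>t. (w (fst (split_coords a b t)) *\<^sub>R path_product h a (fst (split_coords a b t)))
      * (w' (snd (split_coords a b t)) *\<^sub>R path_product h b (snd (split_coords a b t))))
      (iterated_integral h a w * iterated_integral h b w')"
    by (rule has_strong_integral_distr[OF measurable_split_coords distr_split_coords])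
  then have "has_strong_integral (cube (a + b))
      (\<lambda>t. (w (fst (split_coords a b t)) * w' (snd (split_coords a b t))) *\<^sub>R path_product h (a + b) t)
      (iterated_integral h a w * iterated_integral h b w')"
    by (rule has_strong_integral_cong[rotated]) (simp add: path_product_split)
  then show ?thesis
    unfolding iterated_integral_def[of h "a + b"] by (intro bochner_integral_normed_eq[symmetric]) auto
qed

section \<open>The time-ordered exponential as a power series\<close>

lemma simple_function_time_simplex:
  "E \<in> sets borel \<Longrightarrow> simple_function (cube k) (indicat_real (time_simplex k E))"
  by (intro simple_function_indicator time_simplex_sets)

definition ordered_exp :: "real set \<Rightarrow> 'a fps" where
  "ordered_exp E = Abs_fps (\<lambda>k. iterated_integral h k (indicat_real (time_simplex k E)))"

lemma ordered_exp_nth: "fps_nth (ordered_exp E) k = iterated_integral h k (indicat_real (time_simplex k E))"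
  by (simp add: ordered_exp_def)

definition variation :: "real set \<Rightarrow> real" where
  "variation E = (LINT t|lborel. indicat_real E t * norm (h t))"

lemma integrable_norm: "integrable lborel (\<lambda>t. norm (h t))"
proof (rule integrableI_bounded)
  show "(\<lambda>t. norm (h t)) \<in> borel_measurable lborel"
    by (rule has_strong_integral_measurable_norm[OF h])
  show "(\<integral>\<^sup>+t. ennreal (norm (norm (h t))) \<partial>lborel) < \<infinity>"
    using has_strong_integral_norm_le(2)[OF h] by simp
qed

lemma integrable_indicator_norm:
  "E \<in> sets borel \<Longrightarrow> integrable lborel (\<lambda>t. indicat_real E t * norm (h t))"
  using integrable_mult_indicator[OF _ integrable_norm, of E] by simp

lemma variation_nonneg: "0 \<le> variation E"
  unfolding variation_def by (intro Bochner_Integration.integral_nonneg) simp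

lemma nn_integral_variation:
  assumes "E \<in> sets borel"
  shows "(\<integral>\<^sup>+t. ennreal (indicat_real E t * norm (h t)) \<partial>lborel) = ennreal (variation E)"
  unfolding variation_def by (intro nn_integral_eq_integral integrable_indicator_norm assms) simp

lemma variation_split:
  assumes "E \<in> sets borel"
  shows "variation E = variation (E \<inter> {..s}) + variation (E \<inter> {s<..})"
proof -
  have "variation (E \<inter> {..s}) + variation (E \<inter> {s<..})
    = (LINT t|lborel. indicat_real (E \<inter> {..s}) t * norm (h t) + indicat_real (E \<inter> {s<..}) t * norm (h t))"
    unfolding variation_def using assms
    by (intro Bochner_Integration.integral_add[symmetric] integrable_indicator_norm) auto
  also have "\<dots> = variation E"
    unfolding variation_def by (intro Bochner_Integration.integral_cong) (auto split: split_indicator)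
  finally show ?thesis ..
qed

text \<open>The distribution function of the measure with density |h| on \<open>E\<close> is
  continuous because points are null, so it attains half of the total mass.\<close>

lemma variation_half:
  assumes E: "E \<in> sets borel"
  shows "\<exists>s. variation (E \<inter> {..s}) = variation E / 2"
proof -
  define N where "N = density lborel (\<lambda>t. ennreal (indicat_real E t * norm (h t)))"
  have meas: "(\<lambda>t. ennreal (indicat_real E t * norm (h t))) \<in> borel_measurable lborel"
    using integrable_indicator_norm[OF E] by (intro measurable_compose[OF borel_measurable_integrable measurable_ennreal])
  have em: "emeasure N S = ennreal (variation (E \<inter> S))" if "S \<in> sets borel" for S
  proof -
    have "emeasure N S = (\<integral>\<^sup>+t. ennreal (indicat_real E t * norm (h t)) * indicator S t \<partial>lborel)"
      unfolding N_def using meas that by (intro emeasure_density) auto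
    also have "\<dots> = (\<integral>\<^sup>+t. ennreal (indicat_real (E \<inter> S) t * norm (h t)) \<partial>lborel)"
      by (intro nn_integral_cong) (auto split: split_indicator)
    finally show ?thesis using nn_integral_variation[of "E \<inter> S"] E that by simp
  qed
  have ms: "measure N S = variation (E \<inter> S)" if "S \<in> sets borel" for S
    using em[OF that] variation_nonneg by (simp add: measure_def)
  interpret N: finite_measure N
    by (rule finite_measureI) (use em[of UNIV] in \<open>simp add: N_def\<close>)
  interpret N: finite_borel_measure N
    by unfold_locales (simp add: N_def)
  have cdf: "cdf N s = variation (E \<inter> {..s})" for s by (simp add: cdf_def ms)
  have total: "measure N (space N) = variation E" using ms[of UNIV] by (simp add: N_def)
  have "isCont (cdf N) x" for x
  proof -
    have "variation (E \<inter> {x}) = (LINT t|(lborel :: real measure). 0)"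
      unfolding variation_def
    proof (rule Bochner_Integration.integral_cong_AE)
      show "AE t in lborel. indicat_real (E \<inter> {x}) t * norm (h t) = 0"
        using AE_lborel_singleton[of x] by eventually_elim (auto split: split_indicator)
    qed (use E integrable_indicator_norm[of "E \<inter> {x}"] in \<open>auto intro: borel_measurable_integrable\<close>)
    then show ?thesis by (simp add: N.isCont_cdf ms)
  qed
  then have cont: "continuous_on S (cdf N)" for S by (simp add: continuous_at_imp_continuous_on)
  show ?thesis
  proof (cases "variation E = 0")
    case True
    then show ?thesis using variation_split[OF E, of 0] variation_nonneg
      by (intro exI[of _ 0]) (smt (verit) divide_eq_0_iff)
  next
    case False
    then have pos: "0 < variation E" using variation_nonneg[of E] by simp
    have "eventually (\<lambda>s. variation E / 2 < cdf N s) at_top"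
      using N.cdf_lim_at_top pos by (intro order_tendstoD(1)[of _ "variation E"]) (auto simp: total)
    then obtain b where b: "\<And>s. b \<le> s \<Longrightarrow> variation E / 2 < cdf N s"
      by (auto simp: eventually_at_top_linorder)
    have "eventually (\<lambda>s. cdf N s < variation E / 2) at_bot"
      using N.cdf_lim_at_bot pos by (intro order_tendstoD(2)[of _ 0]) auto
    then obtain a where a: "\<And>s. s \<le> a \<Longrightarrow> cdf N s < variation E / 2"
      by (auto simp: eventually_at_bot_linorder)
    have "\<exists>s. min a b \<le> s \<and> s \<le> b \<and> cdf N s = variation E / 2"
      by (intro IVT' cont) (use a[of "min a b"] b[of b] in auto)
    then show ?thesis by (auto simp: cdf)
  qed
qed

text \<open>Dropping the order constraint enlarges the simplex to a full power of \<open>E\<close>,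
  on which the bound factors. The lost 1/k! is affordable.\<close>

lemma nn_integral_path_product_le:
  assumes E: "E \<in> sets borel"
  shows "(\<integral>\<^sup>+t. norm (indicat_real (time_simplex k E) t *\<^sub>R path_product h k t) \<partial>cube k) \<le> ennreal (variation E ^ k)"
proof -
  have "(\<integral>\<^sup>+t. norm (indicat_real (time_simplex k E) t *\<^sub>R path_product h k t) \<partial>cube k)
    \<le> (\<integral>\<^sup>+t. (\<Prod>i\<in>{1..k}. ennreal (indicat_real E (t i) * norm (h (t i)))) \<partial>cube k)"
  proof (intro nn_integral_mono)
    fix t :: "nat \<Rightarrow> real"
    have "norm (indicat_real (time_simplex k E) t *\<^sub>R path_product h k t) \<le> (\<Prod>i\<in>{1..k}. indicat_real E (t i) * norm (h (t i)))"
    proof (cases "t \<in> time_simplex k E")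
      case True
      then have "indicat_real E (t i) = 1" if "i \<in> {1..k}" for i
        using that by (auto simp: time_simplex_def PiE_iff indicator_def)
      then have "(\<Prod>i\<in>{1..k}. indicat_real E (t i) * norm (h (t i))) = (\<Prod>i\<in>{1..k}. norm (h (t i)))"
        by (intro prod.cong) auto
      then show ?thesis using norm_path_product_le[of h k t] True by simp
    qed (simp add: prod_nonneg)
    then show "ennreal (norm (indicat_real (time_simplex k E) t *\<^sub>R path_product h k t))
        \<le> (\<Prod>i\<in>{1..k}. ennreal (indicat_real E (t i) * norm (h (t i))))"
      by (subst prod_ennreal) (auto intro: ennreal_leI)
  qed
  also have "\<dots> = (\<Prod>i\<in>{1..k}. \<integral>\<^sup>+t. ennreal (indicat_real E t * norm (h t)) \<partial>lborel)"
    using integrable_indicator_norm[OF E]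
    by (intro lborel_product.product_nn_integral_prod)
      (auto intro!: measurable_compose[OF borel_measurable_integrable measurable_ennreal])
  also have "\<dots> = ennreal (variation E ^ k)"
    using nn_integral_variation[OF E] variation_nonneg by (simp add: ennreal_power)
  finally show ?thesis .
qed

lemma norm_ordered_exp_nth:
  assumes E: "E \<in> sets borel"
  shows "norm (fps_nth (ordered_exp E) k) \<le> variation E ^ k"
proof -
  have "ennreal (norm (fps_nth (ordered_exp E) k)) \<le> ennreal (variation E ^ k)"
    unfolding ordered_exp_nth
    using has_strong_integral_norm_le(1)[OF has_iterated_integral[OF simple_function_time_simplex[OF E]]]
      nn_integral_path_product_le[OF E] by (rule order_trans)
  then show ?thesis using variation_nonneg by (simp add: ennreal_le_iff)
qed

text \<open>Chen's identity for concatenation: the pointwise splitting of the simplex is integrated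
  coefficient by coefficient.\<close>

lemma ordered_exp_split:
  assumes E: "E \<in> sets borel"
  shows "ordered_exp E = ordered_exp (E \<inter> {..s}) * ordered_exp (E \<inter> {s<..})"
proof (rule fps_ext)
  fix k
  let ?w = "\<lambda>i t. indicat_real (time_simplex i (E \<inter> {..s})) (fst (split_coords i (k - i) t))
        * indicat_real (time_simplex (k - i) (E \<inter> {s<..})) (snd (split_coords i (k - i) t))"
  have meas: "E \<inter> {..s} \<in> sets borel" "E \<inter> {s<..} \<in> sets borel" using E by auto
  have w: "simple_function (cube k) (?w i)" if "i \<in> {0..k}" for i
    using simple_function_split[OF simple_function_time_simplex[OF meas(1), of i] simple_function_time_simplex[OF meas(2), of "k - i"]]
      that by simp
  have "fps_nth (ordered_exp (E \<inter> {..s}) * ordered_exp (E \<inter> {s<..})) k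
    = (\<Sum>i=0..k. iterated_integral h i (indicat_real (time_simplex i (E \<inter> {..s})))
        * iterated_integral h (k - i) (indicat_real (time_simplex (k - i) (E \<inter> {s<..}))))"
    by (simp add: fps_mult_nth ordered_exp_nth)
  also have "\<dots> = (\<Sum>i=0..k. 1 *\<^sub>R iterated_integral h k (?w i))"
  proof (intro sum.cong refl)
    fix i assume "i \<in> {0..k}"
    then show "iterated_integral h i (indicat_real (time_simplex i (E \<inter> {..s})))
        * iterated_integral h (k - i) (indicat_real (time_simplex (k - i) (E \<inter> {s<..})))
      = 1 *\<^sub>R iterated_integral h k (?w i)"
      using iterated_integral_mult[OF simple_function_time_simplex[OF meas(1), of i]
          simple_function_time_simplex[OF meas(2), of "k - i"]] by simp
  qed
  also have "\<dots> = iterated_integral h k (\<lambda>t. \<Sum>i=0..k. 1 * ?w i t)"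
    by (rule iterated_integral_sum[symmetric]) (use w in auto)
  also have "\<dots> = iterated_integral h k (indicat_real (time_simplex k E))"
  proof (rule iterated_integral_cong_AE)
    show "simple_function (cube k) (\<lambda>t. \<Sum>i=0..k. 1 * ?w i t)"
      using w by (intro simple_function_sum) auto
    show "AE t in cube k. (\<Sum>i=0..k. 1 * ?w i t) = indicat_real (time_simplex k E) t"
      by (rule AE_I2) (simp add: time_simplex_split[of _ k E s])
  qed (rule simple_function_time_simplex[OF E])
  finally show "fps_nth (ordered_exp E) k = fps_nth (ordered_exp (E \<inter> {..s}) * ordered_exp (E \<inter> {s<..})) k"
    by (simp add: ordered_exp_nth)
qed

lemma ordered_exp_nth_0: "fps_nth (ordered_exp E) 0 = 1"
proof -
  have sp: "space (cube 0) = {\<lambda>_. undefined}" by (simp add: space_PiM)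
  have em: "emeasure (cube 0) (space (cube 0)) = 1" by (simp add: PiM_empty)
  let ?f = "\<lambda>t. indicat_real (time_simplex 0 E) t *\<^sub>R path_product h 0 t"
  have f: "?f t = 1" if "t \<in> space (cube 0)" for t
  proof -
    have "t = (\<lambda>_. undefined)" using that unfolding sp by simp
    then show ?thesis by (simp add: time_simplex_def)
  qed
  have sb: "simple_integrable (cube 0) (\<lambda>t. 1 :: 'a)"
    using em by (intro simple_bochner_integrable.intros) auto
  define C where "C = cube 0"
  have "integral_simple C (\<lambda>t. 1 :: 'a) = 1"
    using em sp unfolding C_def[symmetric]
    by (simp add: simple_bochner_integral_def measure_def)
  then have "has_strong_integral (cube 0) (\<lambda>t. 1 :: 'a) 1"
    using has_strong_integral_simple[OF sb] by (simp only: C_def)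
  then have "has_strong_integral (cube 0) ?f 1"
    by (rule has_strong_integral_cong[rotated]) (rule f[symmetric])
  then show ?thesis
    unfolding ordered_exp_nth iterated_integral_def by (rule bochner_integral_normed_eq) simp
qed

sublocale ordered_products ordered_exp variation
  by unfold_locales
    (rule ordered_exp_nth_0 variation_nonneg | (rule norm_ordered_exp_nth ordered_exp_split
      variation_split variation_half, assumption))+

end

section \<open>The Magnus terms as averages of the resolvent transform\<close>

definition descents :: "nat \<Rightarrow> (nat \<Rightarrow> real) \<Rightarrow> nat" where
  "descents k t = card {i \<in> {1..<k}. t (Suc i) < t i}"

definition resolvent_weight :: "real \<Rightarrow> nat \<Rightarrow> (nat \<Rightarrow> real) \<Rightarrow> real" where
  "resolvent_weight m k t = (\<Prod>i\<in>{1..<k}. if t i \<le> t (Suc i) then 1 - m else - m)"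

lemma resolvent_weight_eq_power:
  assumes "0 < k"
  shows "resolvent_weight m k t = (1 - m) ^ (k - 1 - descents k t) * (- m) ^ descents k t"
proof -
  have eq: "{1..<k} \<inter> - {i. t i \<le> t (Suc i)} = {i \<in> {1..<k}. t (Suc i) < t i}" by auto
  have "card ({1..<k} \<inter> P) + card ({1..<k} \<inter> - P) = card {1..<k}" for P
  proof -
    have "card ({1..<k} \<inter> P) + card ({1..<k} \<inter> - P) = card (({1..<k} \<inter> P) \<union> ({1..<k} \<inter> - P))"
      by (intro card_Un_disjoint[symmetric]) auto
    also have "({1..<k} \<inter> P) \<union> ({1..<k} \<inter> - P) = {1..<k}" by auto
    finally show ?thesis .
  qed
  from this[of "{i. t i \<le> t (Suc i)}"] have "card ({1..<k} \<inter> {i. t i \<le> t (Suc i)}) = k - 1 - descents k t"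
    unfolding eq descents_def by simp
  then show ?thesis
    by (simp add: resolvent_weight_def prod.If_cases eq descents_def del: One_nat_def)
qed

lemma descents_less:
  assumes "0 < k"
  shows "descents k t < k"
proof -
  have "{i \<in> {1..<k}. t (Suc i) < t i} \<subseteq> {1..<k}" by auto
  from card_mono[OF _ this] have "descents k t \<le> k - 1" by (simp add: descents_def)
  then show ?thesis using assms by simp
qed

lemma resolvent_weight_eq_sum:
  assumes "0 < k"
  shows "resolvent_weight m k t = (\<Sum>d<k. ((1 - m) ^ (k - 1 - d) * (- m) ^ d) * of_bool (descents k t = d))"
proof -
  have "(\<Sum>d<k. ((1 - m) ^ (k - 1 - d) * (- m) ^ d) * of_bool (descents k t = d))
    = (\<Sum>d<k. if d = descents k t then (1 - m) ^ (k - 1 - d) * (- m) ^ d else 0)"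
    by (intro sum.cong) auto
  then show ?thesis using descents_less[OF assms, of t] by (simp add: resolvent_weight_eq_power[OF assms])
qed

lemma simple_function_descents: "simple_function (cube k) (\<lambda>t. of_bool (descents k t = d) :: real)"
proof -
  have comp: "(\<lambda>t. t i) \<in> borel_measurable (cube k)" if "i \<in> {1..k}" for i
    using measurable_component_singleton[OF that, of "\<lambda>_. lborel :: real measure"] by simp
  have "simple_function (cube k) (\<lambda>t. \<Sum>i\<in>{1..<k}. indicat_real {t \<in> space (cube k). t (Suc i) < t i} t)"
  proof (intro simple_function_sum simple_function_indicator)
    fix i assume "i \<in> {1..<k}"
    then show "{t \<in> space (cube k). t (Suc i) < t i} \<in> sets (cube k)"
      by (intro borel_measurable_less comp) auto
  qed
  from simple_function_compose1[OF this, of "\<lambda>x. of_bool (x = real d)"]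
  have "simple_function (cube k) (\<lambda>t. of_bool ((\<Sum>i\<in>{1..<k}. indicat_real {t \<in> space (cube k). t (Suc i) < t i} t) = real d) :: real)" .
  moreover have "(\<Sum>i\<in>{1..<k}. indicat_real {t \<in> space (cube k). t (Suc i) < t i} t) = real (descents k t)"
    if "t \<in> space (cube k)" for t
  proof -
    have "(\<Sum>i\<in>{1..<k}. indicat_real {t \<in> space (cube k). t (Suc i) < t i} t) = (\<Sum>i\<in>{1..<k}. if t (Suc i) < t i then 1 else 0)"
      using that by (intro sum.cong) (auto simp: indicator_def)
    also have "\<dots> = real (card ({1..<k} \<inter> {i. t (Suc i) < t i}))" by (subst sum.If_cases) simp_all
    finally show ?thesis by (simp add: descents_def Int_def)
  qed
  ultimately show ?thesis
    by (subst simple_function_cong[where g = "\<lambda>t. of_bool ((\<Sum>i\<in>{1..<k}. indicat_real {t \<in> space (cube k). t (Suc i) < t i} t) = real d)"]) simp_all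
qed

lemma simple_function_resolvent_weight:
  assumes "0 < k"
  shows "simple_function (cube k) (resolvent_weight m k)"
  unfolding resolvent_weight_eq_sum[OF assms, abs_def]
  by (intro simple_function_sum simple_function_mult simple_function_const simple_function_descents)

text \<open>The pointwise form of X (1 + m (A - 1)) = A - 1. The factor of the pair (n, n + 1) is
  the ascent indicator minus \<open>m\<close>, so lengthening the weight by one pair releases
  exactly the next summand. The case n = k is the goal; a general \<open>n\<close> makes the
  induction possible.\<close>

lemma resolvent_weight_recursion:
  assumes "1 \<le> n" "n \<le> k"
  shows "resolvent_weight m n t * of_bool (\<forall>j\<in>{n - 1<..<k}. t j \<le> t (Suc j))
    + m * (\<Sum>i\<in>{1..<n}. resolvent_weight m i t * of_bool (\<forall>j\<in>{i<..<k}. t j \<le> t (Suc j)))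
    = of_bool (\<forall>j\<in>{1..<k}. t j \<le> t (Suc j))"
  using assms
proof (induction n rule: dec_induct)
  case base
  have "{0<..<k} = {1..<k}" by auto
  then show ?case by (simp add: resolvent_weight_def)
next
  case (step n)
  define D :: "nat \<Rightarrow> real" where "D i = of_bool (\<forall>j\<in>{i<..<k}. t j \<le> t (Suc j))" for i
  have w: "resolvent_weight m (Suc n) t = resolvent_weight m n t * (of_bool (t n \<le> t (Suc n)) - m)"
    using step(1) by (simp add: resolvent_weight_def)
  have "{n - 1<..<k} = insert n {n<..<k}" using step by auto
  then have D: "D (n - 1) = of_bool (t n \<le> t (Suc n)) * D n" by (simp add: D_def)
  have "resolvent_weight m (Suc n) t * D n + m * (\<Sum>i\<in>{1..<Suc n}. resolvent_weight m i t * D i)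
    = resolvent_weight m n t * D (n - 1) + m * (\<Sum>i\<in>{1..<n}. resolvent_weight m i t * D i)"
    unfolding D w using step(1) by (simp add: algebra_simps)
  then show ?case using step unfolding D_def by simp
qed

text \<open>The Beta integral B(a + 1, b + 1). With a = asc and b = des it produces the Magnus
  coefficient asc! des! / k!, as then a + b + 1 = k.\<close>

lemma beta_nat_integral:
  "((\<lambda>l::real. l ^ a * (1 - l) ^ b) has_integral fact a * fact b / fact (a + b + 1)) {0..1}"
proof (induction b arbitrary: a)
  case 0
  have "((\<lambda>l::real. l ^ a) has_integral (1 ^ Suc a / real (Suc a) - 0 ^ Suc a / real (Suc a))) {0..1}"
  proof (rule fundamental_theorem_of_calculus)
    fix l :: real
    have "((\<lambda>l. l ^ Suc a / real (Suc a)) has_real_derivative real (Suc a) * l ^ a / real (Suc a)) (at l within {0..1})"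
      by (auto intro!: derivative_eq_intros simp del: power_Suc of_nat_Suc)
    then show "((\<lambda>l. l ^ Suc a / real (Suc a)) has_vector_derivative l ^ a) (at l within {0..1})"
      by (simp add: has_real_derivative_iff_has_vector_derivative del: power_Suc of_nat_Suc)
  qed simp
  moreover have "fact a * fact 0 / fact (a + 0 + 1) = 1 / real (Suc a)"
    by (simp del: of_nat_Suc)
  ultimately show ?case by simp
next
  case (Suc b)
  \<comment> \<open>Integration by parts: the antiderivative l^(a+1) (1 - l)^(b+1) / (a + 1)
    vanishes at both ends.\<close>
  have "((\<lambda>l::real. l ^ a * (1 - l) ^ Suc b - real (Suc b) / real (Suc a) * (l ^ Suc a * (1 - l) ^ b)) has_integral
      (1 ^ Suc a * (1 - 1) ^ Suc b / real (Suc a) - 0 ^ Suc a * (1 - 0) ^ Suc b / real (Suc a))) {0..1}"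
  proof (rule fundamental_theorem_of_calculus)
    fix l :: real
    have d1: "((\<lambda>l. l ^ Suc a) has_real_derivative real (Suc a) * l ^ a) (at l within {0..1})"
      using DERIV_power[OF DERIV_ident, where n = "Suc a"] by simp
    have "((\<lambda>l. 1 - l) has_real_derivative - 1) (at l within {0..1})"
      by (auto intro!: derivative_eq_intros)
    from DERIV_power[OF this, where n = "Suc b"]
    have d2: "((\<lambda>l. (1 - l) ^ Suc b) has_real_derivative - (real (Suc b) * (1 - l) ^ b)) (at l within {0..1})"
      by simp
    have "((\<lambda>l. l ^ Suc a * (1 - l) ^ Suc b / real (Suc a)) has_real_derivative
       (l ^ Suc a * - (real (Suc b) * (1 - l) ^ b) + real (Suc a) * l ^ a * (1 - l) ^ Suc b) / real (Suc a)) (at l within {0..1})"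
      by (rule DERIV_cdivide[OF DERIV_mult'[OF d1 d2]])
    moreover have "l ^ Suc a * - (real (Suc b) * (1 - l) ^ b) + real (Suc a) * l ^ a * (1 - l) ^ Suc b
      = real (Suc a) * l ^ a * (1 - l) ^ Suc b - l ^ Suc a * (real (Suc b) * (1 - l) ^ b)" by simp
    ultimately have "((\<lambda>l. l ^ Suc a * (1 - l) ^ Suc b / real (Suc a)) has_real_derivative
       (real (Suc a) * l ^ a * (1 - l) ^ Suc b - l ^ Suc a * (real (Suc b) * (1 - l) ^ b)) / real (Suc a)) (at l within {0..1})"
      by (simp only:)
    moreover have "(real (Suc a) * l ^ a * (1 - l) ^ Suc b - l ^ Suc a * (real (Suc b) * (1 - l) ^ b)) / real (Suc a)
      = l ^ a * (1 - l) ^ Suc b - real (Suc b) / real (Suc a) * (l ^ Suc a * (1 - l) ^ b)"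
      unfolding diff_divide_distrib by (simp del: power_Suc of_nat_Suc)
    ultimately show "((\<lambda>l. l ^ Suc a * (1 - l) ^ Suc b / real (Suc a)) has_vector_derivative
       l ^ a * (1 - l) ^ Suc b - real (Suc b) / real (Suc a) * (l ^ Suc a * (1 - l) ^ b)) (at l within {0..1})"
      by (simp only: has_real_derivative_iff_has_vector_derivative)
  qed simp
  from has_integral_add[OF this has_integral_mult_right[OF Suc.IH[of "Suc a"], of "real (Suc b) / real (Suc a)"]]
  have "((\<lambda>l::real. l ^ a * (1 - l) ^ Suc b) has_integral real (Suc b) / real (Suc a) * (fact (Suc a) * fact b / fact (Suc a + b + 1))) {0..1}"
    by simp
  moreover have "real (Suc b) / real (Suc a) * (fact (Suc a) * fact b / fact (Suc a + b + 1))
      = fact a * fact (Suc b) / fact (a + Suc b + 1)"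
    by (simp add: field_simps del: of_nat_Suc)
  ultimately show ?case by (simp only:)
qed

text \<open>For \<open>u\<close> with distinct coordinates, \<open>rank k u\<close> is the unique permutation \<open>\<sigma>\<close> such that \<open>u \<circ> \<sigma>\<^sup>-\<^sup>1\<close> is increasing.\<close>

definition rank :: "nat \<Rightarrow> (nat \<Rightarrow> real) \<Rightarrow> nat \<Rightarrow> nat" where
  "rank k u i = (if i \<in> {1..k} then card {j \<in> {1..k}. u j \<le> u i} else i)"

section \<open>Orderings of a tuple as permutations\<close>

lemma rank_less_iff:
  assumes "i \<in> {1..k}" "j \<in> {1..k}"
  shows "rank k u i < rank k u j \<longleftrightarrow> u i < u j"
proof
  assume "u i < u j"
  then have "{l \<in> {1..k}. u l \<le> u i} \<subseteq> {l \<in> {1..k}. u l \<le> u j}"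
    and "j \<in> {l \<in> {1..k}. u l \<le> u j}" "j \<notin> {l \<in> {1..k}. u l \<le> u i}"
    using assms by auto
  then have "{l \<in> {1..k}. u l \<le> u i} \<subset> {l \<in> {1..k}. u l \<le> u j}" by blast
  then show "rank k u i < rank k u j" using assms by (simp add: rank_def psubset_card_mono del: One_nat_def)
next
  assume less: "rank k u i < rank k u j"
  show "u i < u j"
  proof (rule ccontr)
    assume "\<not> u i < u j"
    then have "{l \<in> {1..k}. u l \<le> u j} \<subseteq> {l \<in> {1..k}. u l \<le> u i}" by auto
    from card_mono[OF _ this] have "rank k u j \<le> rank k u i" using assms by (simp add: rank_def del: One_nat_def)
    with less show False by simp
  qed
qed

lemma rank_permutes:
  assumes u: "inj_on u {1..k}"
  shows "rank k u permutes {1..k}"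
proof (rule bij_imp_permutes)
  have inj: "inj_on (rank k u) {1..k}"
  proof (rule inj_onI)
    fix i j assume ij: "i \<in> {1..k}" "j \<in> {1..k}" and "rank k u i = rank k u j"
    then have "\<not> u i < u j" "\<not> u j < u i" by (simp_all flip: rank_less_iff[where k = k and u = u] del: atLeastAtMost_iff)
    then have "u i = u j" by simp
    then show "i = j" using inj_onD[OF u _ ij] by simp
  qed
  have "rank k u ` {1..k} \<subseteq> {1..k}"
  proof (rule image_subsetI)
    fix i assume i: "i \<in> {1..k}"
    define c where "c = card {j \<in> {1..k}. u j \<le> u i}"
    have "0 < c" unfolding c_def by (subst card_gt_0_iff) (use i in auto)
    moreover have "c \<le> card {1..k}" unfolding c_def by (rule card_mono) auto
    moreover have "rank k u i = c" using i by (simp only: rank_def c_def if_True)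
    ultimately show "rank k u i \<in> {1..k}" by simp
  qed
  then show "bij_betw (rank k u) {1..k} {1..k}"
    using endo_inj_surj[OF _ _ inj] inj by (simp add: bij_betw_def)
qed (auto simp: rank_def)

lemma des_rank: "inj_on u {1..k} \<Longrightarrow> des k (rank k u) = descents k u"
  unfolding des_def descents_def
  by (intro arg_cong[where f = card] Collect_cong) (auto simp: rank_less_iff)

lemma asc_rank:
  assumes u: "inj_on u {1..k}" and k: "0 < k"
  shows "asc k (rank k u) = k - 1 - descents k u"
proof -
  have "rank k u i \<noteq> rank k u (Suc i)" for i
    using permutes_inj[OF rank_permutes[OF u]] by (metis injD n_not_Suc_n)
  then have "{1..<k} = {i \<in> {1..<k}. rank k u i < rank k u (Suc i)} \<union> {i \<in> {1..<k}. rank k u i > rank k u (Suc i)}"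
    by (auto simp: neq_iff)
  moreover have "card ({i \<in> {1..<k}. rank k u i < rank k u (Suc i)} \<union> {i \<in> {1..<k}. rank k u i > rank k u (Suc i)})
      = asc k (rank k u) + des k (rank k u)"
    unfolding asc_def des_def by (rule card_Un_disjoint) auto
  ultimately have "card {1..<k} = asc k (rank k u) + des k (rank k u)" by (simp only:)
  then show ?thesis using k by (simp add: des_rank[OF u])
qed

text \<open>The images of the ordered simplex under permutations of the coordinates are the order
  chambers of the cube; a point without ties lies in just one of them.\<close>

lemma permuted_in_simplex_iff:
  assumes \<sigma>: "\<sigma> permutes {1..k}" and u: "inj_on u {1..k}"
  shows "permute_coords k (inv \<sigma>) u \<in> time_simplex k UNIV \<longleftrightarrow> \<sigma> = rank k u"
proof
  have in1: "\<sigma> i \<in> {1..k} \<longleftrightarrow> i \<in> {1..k}" for i by (rule permutes_in_image[OF \<sigma>])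
  have in2: "inv \<sigma> i \<in> {1..k} \<longleftrightarrow> i \<in> {1..k}" for i by (rule permutes_in_image[OF permutes_inv[OF \<sigma>]])
  have inv: "\<sigma> (inv \<sigma> i) = i" "inv \<sigma> (\<sigma> i) = i" for i by (rule permutes_inverses[OF \<sigma>])+
  let ?t = "permute_coords k (inv \<sigma>) u"
  have t\<sigma>: "?t (\<sigma> i) = u i" if "i \<in> {1..k}" for i
    using that in1[of i] by (simp add: permute_coords_def inv)
  {
    assume "?t \<in> time_simplex k UNIV"
    then have chain: "\<forall>i\<in>{1..<k}. ?t i \<le> ?t (Suc i)" by (simp add: time_simplex_def)
    have le: "u i \<le> u j" if "i \<in> {1..k}" "j \<in> {1..k}" "\<sigma> i \<le> \<sigma> j" for i j
      using chain_mono[OF chain _ that(3)] in1[of i] in1[of j] that by (simp add: t\<sigma>)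
    have iff: "u j \<le> u i \<longleftrightarrow> \<sigma> j \<le> \<sigma> i" if "i \<in> {1..k}" "j \<in> {1..k}" for i j
    proof
      assume ji: "u j \<le> u i"
      show "\<sigma> j \<le> \<sigma> i"
      proof (rule ccontr)
        assume "\<not> \<sigma> j \<le> \<sigma> i"
        then have "u i \<le> u j" using le that by simp
        with ji have "u i = u j" by simp
        then have "i = j" using inj_onD[OF u] that by blast
        with \<open>\<not> \<sigma> j \<le> \<sigma> i\<close> show False by simp
      qed
    qed (use le that in simp)
    show "\<sigma> = rank k u"
    proof
      fix i
      show "\<sigma> i = rank k u i"
      proof (cases "i \<in> {1..k}")
        case True
        \<comment> \<open>\<sigma> carries the indices whose coordinate is at most
          \<open>u i\<close> onto the first \<open>\<sigma> i\<close> numbers, so counting them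
          gives \<open>\<sigma> i\<close>.\<close>
        have "\<sigma> ` {j \<in> {1..k}. u j \<le> u i} = {1..\<sigma> i}"
        proof (intro set_eqI iffI)
          fix p assume "p \<in> \<sigma> ` {j \<in> {1..k}. u j \<le> u i}"
          then obtain j where j: "j \<in> {1..k}" "u j \<le> u i" "p = \<sigma> j" by blast
          then show "p \<in> {1..\<sigma> i}" using iff[OF True j(1)] in1[of j] by auto
        next
          fix p assume p: "p \<in> {1..\<sigma> i}"
          then have "p \<in> {1..k}" using in1[of i] True by auto
          then have "inv \<sigma> p \<in> {1..k}" using in2 by blast
          moreover from this have "u (inv \<sigma> p) \<le> u i" using iff[OF True] p by (simp add: inv)
          ultimately show "p \<in> \<sigma> ` {j \<in> {1..k}. u j \<le> u i}" by (intro image_eqI[of _ _ "inv \<sigma> p"]) (simp_all add: inv)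
        qed
        then have "card {j \<in> {1..k}. u j \<le> u i} = \<sigma> i"
          using card_image[OF inj_on_subset[OF permutes_inj[OF \<sigma>] subset_UNIV], of "{j \<in> {1..k}. u j \<le> u i}"] by simp
        then show ?thesis using True by (simp add: rank_def del: One_nat_def)
      next
        case False
        then show ?thesis using permutes_not_in[OF \<sigma> False] by (simp only: rank_def if_False)
      qed
    qed
  }
  assume r: "\<sigma> = rank k u"
  have "?t p \<le> ?t (Suc p)" if p: "p \<in> {1..<k}" for p
  proof -
    have ij: "inv \<sigma> p \<in> {1..k}" "inv \<sigma> (Suc p) \<in> {1..k}" using in2 p by auto
    have "rank k u (inv \<sigma> p) < rank k u (inv \<sigma> (Suc p))"
      unfolding r[symmetric] inv by simp
    then have "u (inv \<sigma> p) < u (inv \<sigma> (Suc p))" using rank_less_iff[OF ij] by simp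
    then show ?thesis using p by (simp add: permute_coords_def)
  qed
  then show "?t \<in> time_simplex k UNIV"
    by (simp add: time_simplex_def permute_coords_def)
qed

context integrable_density
begin

text \<open>The asserted coefficients are collected in a series \<open>V\<close>, which is checked
  against the equation that characterizes the resolvent transform.\<close>

lemma resolvent_ordered_exp_nth:
  assumes k: "0 < k"
  shows "fps_nth (fps_resolvent m (ordered_exp UNIV)) k = iterated_integral h k (resolvent_weight m k)"
proof -
  let ?A = "ordered_exp UNIV"
  define V where "V = Abs_fps (\<lambda>k. if k = 0 then 0 else iterated_integral h k (resolvent_weight m k))"
  have A0: "fps_nth ?A 0 = 1" by (rule ordered_exp_nth_0)
  have "V * (1 + fps_real m * (?A - 1)) = ?A - 1"
  proof (rule fps_ext)
    fix n
    show "fps_nth (V * (1 + fps_real m * (?A - 1))) n = fps_nth (?A - 1) n"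
    proof (cases "n = 0")
      case True
      then show ?thesis by (simp add: V_def A0)
    next
      case False
      then have n: "0 < n" by simp
      let ?w = "\<lambda>i t. resolvent_weight m i (fst (split_coords i (n - i) t))
        * indicat_real (time_simplex (n - i) UNIV) (snd (split_coords i (n - i) t))"
      have w: "simple_function (cube n) (?w i)" if "i \<in> {1..<n}" for i
        using simple_function_split[OF simple_function_resolvent_weight[of i m] simple_function_time_simplex[of UNIV "n - i"]] that
        by simp
      have sw: "simple_function (cube n) (if i = n then resolvent_weight m n else ?w i)" if "i \<in> {1..n}" for i
        using w[of i] that simple_function_resolvent_weight[OF n] by (cases "i = n") auto
      have "V * (1 + fps_real m * (?A - 1)) = V + fps_real m * (V * (?A - 1))"
        by (simp only: distrib_left mult_1_right mult.assoc[symmetric] fps_real_commute[of V m])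
      then have "fps_nth (V * (1 + fps_real m * (?A - 1))) n = fps_nth V n + m *\<^sub>R fps_nth (V * (?A - 1)) n"
        by (simp add: of_real_def)
      also have "fps_nth (V * (?A - 1)) n = (\<Sum>i=0..n. fps_nth V i * fps_nth (?A - 1) (n - i))"
        by (simp add: fps_mult_nth)
      also have "\<dots> = (\<Sum>i\<in>{1..<n}. fps_nth V i * fps_nth (?A - 1) (n - i))"
      proof (rule sum.mono_neutral_right)
        show "\<forall>i\<in>{0..n} - {1..<n}. fps_nth V i * fps_nth (?A - 1) (n - i) = 0"
        proof
          fix i assume "i \<in> {0..n} - {1..<n}"
          then have "i = 0 \<or> i = n" by auto
          then show "fps_nth V i * fps_nth (?A - 1) (n - i) = 0" by (auto simp: V_def A0)
        qed
      qed auto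
      also have "\<dots> = (\<Sum>i\<in>{1..<n}. iterated_integral h n (?w i))"
      proof (intro sum.cong refl)
        fix i assume i: "i \<in> {1..<n}"
        then have "fps_nth V i * fps_nth (?A - 1) (n - i)
          = iterated_integral h i (resolvent_weight m i) * iterated_integral h (n - i) (indicat_real (time_simplex (n - i) UNIV))"
          by (simp add: V_def ordered_exp_nth)
        also have "\<dots> = iterated_integral h (i + (n - i)) (?w i)"
          using i by (intro iterated_integral_mult simple_function_resolvent_weight simple_function_time_simplex) auto
        finally show "fps_nth V i * fps_nth (?A - 1) (n - i) = iterated_integral h n (?w i)" using i by simp
      qed
      \<comment> \<open>The leading term becomes the index i = n of the same sum, so that all
        weights can be added inside one integral.\<close>
      also have "fps_nth V n + m *\<^sub>R (\<Sum>i\<in>{1..<n}. iterated_integral h n (?w i))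
        = (\<Sum>i\<in>{1..n}. (if i = n then 1 else m) *\<^sub>R iterated_integral h n (if i = n then resolvent_weight m n else ?w i))"
      proof -
        have "{1..n} = insert n {1..<n}" using n by auto
        then show ?thesis using n by (simp add: V_def scaleR_sum_right)
      qed
      also have "\<dots> = iterated_integral h n (\<lambda>t. \<Sum>i\<in>{1..n}. (if i = n then 1 else m) * (if i = n then resolvent_weight m n else ?w i) t)"
        by (rule iterated_integral_sum[OF finite_atLeastAtMost sw, symmetric])
      also have "\<dots> = iterated_integral h n (indicat_real (time_simplex n UNIV))"
      proof (rule iterated_integral_cong_AE)
        show "simple_function (cube n) (\<lambda>t. \<Sum>i\<in>{1..n}. (if i = n then 1 else m) * (if i = n then resolvent_weight m n else ?w i) t)"
          by (intro simple_function_sum simple_function_mult simple_function_const sw)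
        show "AE t in cube n. (\<Sum>i\<in>{1..n}. (if i = n then 1 else m) * (if i = n then resolvent_weight m n else ?w i) t)
          = indicat_real (time_simplex n UNIV) t"
        proof (rule AE_I2)
          fix t assume t: "t \<in> space (cube n)"
          have wt: "?w i t = resolvent_weight m i t * of_bool (\<forall>j\<in>{i<..<n}. t j \<le> t (Suc j))" if "i \<in> {1..<n}" for i
          proof -
            have "resolvent_weight m i (restrict t {1..i}) = resolvent_weight m i t"
              unfolding resolvent_weight_def by (intro prod.cong) auto
            moreover have "tail_coords i (n - i) t \<in> time_simplex (n - i) UNIV \<longleftrightarrow> (\<forall>j\<in>{i<..<n}. t j \<le> t (Suc j))"
              using ball_shift[of n i "\<lambda>j. t j \<le> t (Suc j)"] by (simp add: tail_in_time_simplex)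
            ultimately show ?thesis by (simp add: split_coords_def indicator_def)
          qed
          have "{1..n} = insert n {1..<n}" using n by auto
          then have "(\<Sum>i\<in>{1..n}. (if i = n then 1 else m) * (if i = n then resolvent_weight m n else ?w i) t)
            = resolvent_weight m n t + (\<Sum>i\<in>{1..<n}. m * ?w i t)"
            by simp
          also have "(\<Sum>i\<in>{1..<n}. m * ?w i t)
            = m * (\<Sum>i\<in>{1..<n}. resolvent_weight m i t * of_bool (\<forall>j\<in>{i<..<n}. t j \<le> t (Suc j)))"
            unfolding sum_distrib_left by (intro sum.cong refl) (simp only: wt)
          also have "resolvent_weight m n t + \<dots> = of_bool (\<forall>j\<in>{1..<n}. t j \<le> t (Suc j))"
          proof -
            have "{n - 1<..<n} = {}" by auto
            then show ?thesis using resolvent_weight_recursion[of n n m t] n by simp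
          qed
          also have "\<dots> = indicat_real (time_simplex n UNIV) t"
            using t by (auto simp: time_simplex_def space_cube)
          finally show "(\<Sum>i\<in>{1..n}. (if i = n then 1 else m) * (if i = n then resolvent_weight m n else ?w i) t)
            = indicat_real (time_simplex n UNIV) t" .
        qed
      qed (rule simple_function_time_simplex, simp)
      finally show ?thesis using n by (simp add: ordered_exp_nth)
    qed
  qed
  then have "V = fps_resolvent m ?A" by (rule fps_resolvent_unique[OF A0])
  then have "fps_nth (fps_resolvent m ?A) k = fps_nth V k" by simp
  also have "\<dots> = iterated_integral h k (resolvent_weight m k)"
    using k by (simp add: V_def)
  finally show ?thesis .
qed

text \<open>Isolates the dependence on \<lambda>: these elements are fixed, and the coefficients of
  the resolvent transform are polynomials in \<open>m\<close> with values in their span.\<close>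

definition descent_integral :: "nat \<Rightarrow> nat \<Rightarrow> 'a" where
  "descent_integral k d = iterated_integral h k (\<lambda>t. of_bool (descents k t = d))"

lemma resolvent_ordered_exp_nth_sum:
  assumes k: "0 < k"
  shows "fps_nth (fps_resolvent m (ordered_exp UNIV)) k
    = (\<Sum>d<k. ((1 - m) ^ (k - 1 - d) * (- m) ^ d) *\<^sub>R descent_integral k d)"
proof -
  have "resolvent_weight m k = (\<lambda>t. \<Sum>d<k. ((1 - m) ^ (k - 1 - d) * (- m) ^ d) * of_bool (descents k t = d))"
    by (rule ext) (rule resolvent_weight_eq_sum[OF k])
  then show ?thesis
    unfolding resolvent_ordered_exp_nth[OF k] descent_integral_def
    by (simp only: iterated_integral_sum[OF finite_lessThan simple_function_descents])
qed

text \<open>For each \<sigma>, permuting the coordinates turns the integral over the simplex into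
  one over the order chamber of \<sigma>. The chambers fill the cube up to a null set, and the
  Magnus coefficient depends only on the number of descents.\<close>

lemma magnus_term_eq_sum:
  assumes k: "0 < k"
  shows "magnus_term k UNIV h
    = (\<Sum>d<k. ((-1) ^ d * (fact (k - 1 - d) * fact d / fact k)) *\<^sub>R descent_integral k d)"
proof -
  let ?P = "{\<sigma>. \<sigma> permutes {1..k}}"
  define c :: "(nat \<Rightarrow> nat) \<Rightarrow> real" where "c \<sigma> = (-1) ^ des k \<sigma> * (fact (asc k \<sigma>) * fact (des k \<sigma>) / fact k)" for \<sigma>
  define e :: "nat \<Rightarrow> real" where "e d = (-1) ^ d * (fact (k - 1 - d) * fact d / fact k)" for d
  define w where "w \<sigma> u = indicat_real (time_simplex k UNIV) (permute_coords k (inv \<sigma>) u)" for \<sigma> u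
  have fin: "finite ?P" by (rule finite_permutations) simp
  have sw: "simple_function (cube k) (w \<sigma>)" if "\<sigma> \<in> ?P" for \<sigma>
    unfolding w_def using that
    by (intro simple_function_comp[OF measurable_permute_coords simple_function_time_simplex] permutes_inv) auto
  have one: "has_strong_integral (cube k) (\<lambda>t. indicat_real (time_simplex k UNIV) t *\<^sub>R path_product h k (permute_coords k \<sigma> t))
      (iterated_integral h k (w \<sigma>))" if "\<sigma> \<in> ?P" for \<sigma>
  proof -
    have \<sigma>: "\<sigma> permutes {1..k}" using that by simp
    have "has_strong_integral (cube k) (\<lambda>t. w \<sigma> (permute_coords k \<sigma> t) *\<^sub>R path_product h k (permute_coords k \<sigma> t))
      (iterated_integral h k (w \<sigma>))"
      by (rule has_strong_integral_distr[OF measurable_permute_coords[OF \<sigma>] distr_permute_coords[OF \<sigma>] has_iterated_integral[OF sw[OF that]]])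
    moreover have "w \<sigma> (permute_coords k \<sigma> t) = indicat_real (time_simplex k UNIV) t" if t: "t \<in> space (cube k)" for t
    proof -
      have "permute_coords k (inv \<sigma>) (permute_coords k \<sigma> t) = t"
      proof (rule extensionalityI[of _ "{1..k}"])
        show "t \<in> extensional {1..k}" using t by (simp add: space_cube PiE_iff)
        fix i assume i: "i \<in> {1..k}"
        then have "inv \<sigma> i \<in> {1..k}" using permutes_in_image[OF permutes_inv[OF \<sigma>]] by blast
        then show "permute_coords k (inv \<sigma>) (permute_coords k \<sigma> t) i = t i"
          using i by (simp add: permute_coords_def permutes_inverses[OF \<sigma>])
      qed (simp add: permute_coords_def)
      then show ?thesis by (simp add: w_def)
    qed
    ultimately show ?thesis
      by (elim has_strong_integral_cong[rotated]) simp
  qed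
  have "has_strong_integral (cube k) (\<lambda>t. \<Sum>\<sigma>\<in>?P. c \<sigma> *\<^sub>R (indicat_real (time_simplex k UNIV) t *\<^sub>R path_product h k (permute_coords k \<sigma> t)))
      (\<Sum>\<sigma>\<in>?P. c \<sigma> *\<^sub>R iterated_integral h k (w \<sigma>))"
    by (intro has_strong_integral_sum has_strong_integral_scaleR one fin)
  moreover have "(\<Sum>\<sigma>\<in>?P. c \<sigma> *\<^sub>R (indicat_real (time_simplex k UNIV) t *\<^sub>R path_product h k (permute_coords k \<sigma> t)))
      = indicat_real (time_simplex k UNIV) t *\<^sub>R magnus_commutator k (\<lambda>i. h (t i))" for t
  proof -
    have "path_product h k (permute_coords k \<sigma> t) = prod_list (map (\<lambda>i. h (t (\<sigma> i))) [1..<Suc k])" for \<sigma>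
      unfolding path_product_def by (intro arg_cong[where f = prod_list] map_cong) (auto simp: permute_coords_def)
    then show ?thesis
      by (simp add: magnus_commutator_def c_def scaleR_sum_right mult.commute del: upt_Suc)
  qed
  ultimately have "magnus_term k UNIV h = (\<Sum>\<sigma>\<in>?P. c \<sigma> *\<^sub>R iterated_integral h k (w \<sigma>))"
    unfolding magnus_term_def time_ordered_integral_def by (intro bochner_integral_normed_eq) auto
  also have "\<dots> = iterated_integral h k (\<lambda>u. \<Sum>\<sigma>\<in>?P. c \<sigma> * w \<sigma> u)"
    by (rule iterated_integral_sum[symmetric, OF fin sw])
  also have "\<dots> = iterated_integral h k (\<lambda>u. \<Sum>d<k. e d * of_bool (descents k u = d))"
  proof (rule iterated_integral_cong_AE)
    show "simple_function (cube k) (\<lambda>u. \<Sum>\<sigma>\<in>?P. c \<sigma> * w \<sigma> u)"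
      by (intro simple_function_sum simple_function_mult simple_function_const sw)
    show "simple_function (cube k) (\<lambda>u. \<Sum>d<k. e d * of_bool (descents k u = d))"
      by (intro simple_function_sum simple_function_mult simple_function_const simple_function_descents)
    show "AE u in cube k. (\<Sum>\<sigma>\<in>?P. c \<sigma> * w \<sigma> u) = (\<Sum>d<k. e d * of_bool (descents k u = d))"
      using AE_cube_inj[of k]
    proof eventually_elim
      case (elim u)
      have "(\<Sum>\<sigma>\<in>?P. c \<sigma> * w \<sigma> u) = (\<Sum>\<sigma>\<in>?P. if \<sigma> = rank k u then c (rank k u) else 0)"
        by (intro sum.cong refl) (auto simp: w_def permuted_in_simplex_iff[OF _ elim] indicator_def simp del: One_nat_def)
      also have "\<dots> = c (rank k u)" using fin rank_permutes[OF elim] by simp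
      also have "\<dots> = e (descents k u)" by (simp add: c_def e_def des_rank[OF elim] asc_rank[OF elim k])
      also have "\<dots> = (\<Sum>d<k. if d = descents k u then e d else 0)"
        using descents_less[OF k, of u] by simp
      also have "\<dots> = (\<Sum>d<k. e d * of_bool (descents k u = d))" by (intro sum.cong) auto
      finally show ?case .
    qed
  qed
  also have "\<dots> = (\<Sum>d<k. e d *\<^sub>R descent_integral k d)"
    unfolding descent_integral_def by (rule iterated_integral_sum[OF finite_lessThan simple_function_descents])
  finally show ?thesis by (simp add: e_def)
qed

text \<open>For each number \<open>d\<close> of descents this is the Beta integral, with \<lambda> =
  \<open>l\<close> and m = 1 - \<open>l\<close>.\<close>

lemma magnus_term_has_integral:
  assumes k: "0 < k"
  shows "((\<lambda>l. fps_nth (fps_resolvent (1 - l) (ordered_exp UNIV)) k) has_integral magnus_term k UNIV h) {0..1}"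
  unfolding magnus_term_eq_sum[OF k] resolvent_ordered_exp_nth_sum[OF k]
proof (intro has_integral_sum finite_lessThan)
  fix d assume d: "d \<in> {..<k}"
  have "((\<lambda>l::real. (-1) ^ d * (l ^ (k - 1 - d) * (1 - l) ^ d)) has_integral (-1) ^ d * (fact (k - 1 - d) * fact d / fact (k - 1 - d + d + 1))) {0..1}"
    by (intro has_integral_mult_right beta_nat_integral)
  moreover have "k - 1 - d + d + 1 = k" using d by simp
  moreover have "(1 - (1 - l)) ^ (k - 1 - d) * (- (1 - l)) ^ d = (-1) ^ d * (l ^ (k - 1 - d) * (1 - l) ^ d)" for l :: real
    using power_mult_distrib[of "-1" "1 - l" d] by simp
  ultimately have "((\<lambda>l::real. (1 - (1 - l)) ^ (k - 1 - d) * (- (1 - l)) ^ d) has_integral (-1) ^ d * (fact (k - 1 - d) * fact d / fact k)) {0..1}"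
    by (simp only:)
  then show "((\<lambda>l. ((1 - (1 - l)) ^ (k - 1 - d) * (- (1 - l)) ^ d) *\<^sub>R descent_integral k d) has_integral
      ((-1) ^ d * (fact (k - 1 - d) * fact d / fact k)) *\<^sub>R descent_integral k d) {0..1}"
    by (rule has_integral_linear[OF _ bounded_linear_scaleR_left, unfolded comp_def])
qed

end

section \<open>Gain near a Lebesgue point\<close>

context integrable_density
begin

section \<open>Distance of the density to a constant, and its differentiation\<close>

lemma measurable_norm_diff: "(\<lambda>t. norm (h t - c)) \<in> borel_measurable lborel"
proof -
  obtain s where s: "\<And>i. simple_integrable lborel (s i)"
    "\<And>t. (\<lambda>i. s i t) \<longlonglongrightarrow> h t"
    using h unfolding has_strong_integral_def by auto
  show ?thesis
  proof (rule borel_measurable_LIMSEQ_real)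
    show "(\<lambda>t. norm (s i t - c)) \<in> borel_measurable lborel" for i
      by (rule borel_measurable_simple_function[OF simple_function_compose1[OF simple_integrable_simple_function[OF s(1)]]])
    show "(\<lambda>i. norm (s i t - c)) \<longlonglongrightarrow> norm (h t - c)" for t
      by (intro tendsto_intros s)
  qed
qed

lemma integrable_norm_diff:
  assumes E: "E \<in> sets borel" and fin: "emeasure lborel E < \<infinity>"
  shows "integrable lborel (\<lambda>t. indicat_real E t * norm (h t - c))"
proof (rule Bochner_Integration.integrable_bound)
  show "integrable lborel (\<lambda>t. norm (h t) + indicat_real E t * norm c)"
    using E fin by (intro Bochner_Integration.integrable_add integrable_norm integrable_mult_left) auto
  show "(\<lambda>t. indicat_real E t * norm (h t - c)) \<in> borel_measurable lborel"
    using E by (intro borel_measurable_times measurable_norm_diff) auto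
  show "AE t in lborel. norm (indicat_real E t * norm (h t - c)) \<le> norm (norm (h t) + indicat_real E t * norm c)"
    by (rule AE_I2) (use norm_triangle_ineq4 in \<open>auto split: split_indicator\<close>)
qed

text \<open>Serves as the additive error \<open>D\<close> of the second-order estimate; for c = 0 it
  is the variation.\<close>

definition deviation :: "'a \<Rightarrow> real set \<Rightarrow> real" where
  "deviation c E = (LINT t|lborel. indicat_real E t * norm (h t - c))"

lemma deviation_0: "deviation 0 E = variation E"
  by (simp add: deviation_def variation_def)

lemma deviation_split:
  assumes "E \<in> sets borel" "emeasure lborel E < \<infinity>"
  shows "deviation c E = deviation c (E \<inter> {..s}) + deviation c (E \<inter> {s<..})"
proof -
  have fin: "emeasure lborel (E \<inter> F) < \<infinity>" for F
    using emeasure_mono[of "E \<inter> F" E lborel] assms by (auto intro: le_less_trans)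
  have "deviation c (E \<inter> {..s}) + deviation c (E \<inter> {s<..})
    = (LINT t|lborel. indicat_real (E \<inter> {..s}) t * norm (h t - c) + indicat_real (E \<inter> {s<..}) t * norm (h t - c))"
    unfolding deviation_def using assms fin
    by (intro Bochner_Integration.integral_add[symmetric] integrable_norm_diff) auto
  also have "\<dots> = deviation c E"
    unfolding deviation_def by (intro Bochner_Integration.integral_cong) (auto split: split_indicator)
  finally show ?thesis ..
qed

lemma deviation_interval: "deviation c {x<..x + \<delta>} = integral (cbox x (x + \<delta>)) (\<lambda>t. norm (h t - c))"
  and norm_diff_integrable_on: "(\<lambda>t. norm (h t - c)) integrable_on cbox a b"
proof -
  have si: "set_integrable lborel {a..b} (\<lambda>t. norm (h t - c))" for a b
    unfolding set_integrable_def using integrable_norm_diff[of "{a..b}" c] by (simp add: emeasure_lborel_Icc_eq)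
  show "(\<lambda>t. norm (h t - c)) integrable_on cbox a b"
    using set_borel_integral_eq_integral(1)[OF si] by simp
  have "deviation c {x<..x + \<delta>} = deviation c {x..x + \<delta>}"
    unfolding deviation_def
  proof (rule Bochner_Integration.integral_cong_AE)
    show "AE t in lborel. indicat_real {x<..x + \<delta>} t * norm (h t - c) = indicat_real {x..x + \<delta>} t * norm (h t - c)"
      using AE_lborel_singleton[of x] by eventually_elim (auto split: split_indicator)
  qed (intro borel_measurable_times measurable_norm_diff; simp)+
  also have "\<dots> = integral (cbox x (x + \<delta>)) (\<lambda>t. norm (h t - c))"
    using set_borel_integral_eq_integral(2)[OF si[of x "x + \<delta>"]]
    by (simp add: deviation_def set_lebesgue_integral_def)
  finally show "deviation c {x<..x + \<delta>} = integral (cbox x (x + \<delta>)) (\<lambda>t. norm (h t - c))" .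
qed

text \<open>Lebesgue differentiation of the real function |h - c|; the exceptional null set depends
  on \<open>c\<close>.\<close>

lemma deviation_differentiable:
  obtains N where "negligible N"
    "\<And>x e. x \<notin> N \<Longrightarrow> 0 < e \<Longrightarrow> \<exists>d>0. \<forall>\<delta>. 0 < \<delta> \<and> \<delta> < d \<longrightarrow> \<bar>deviation c {x<..x + \<delta>} - norm (h x - c) * \<delta>\<bar> < e * \<delta>"
proof -
  obtain N where N: "negligible N"
    "\<And>x e. \<lbrakk>x \<notin> N; 0 < e\<rbrakk> \<Longrightarrow> \<exists>d>0. \<forall>\<delta>. 0 < \<delta> \<and> \<delta> < d \<longrightarrow>
        norm (integral (cbox x (x + \<delta> *\<^sub>R One)) (\<lambda>t. norm (h t - c)) /\<^sub>R \<delta> ^ DIM(real) - norm (h x - c)) < e"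
    using integrable_ccontinuous_explicit[OF norm_diff_integrable_on] by metis
  show ?thesis
  proof (rule that[OF N(1)])
    fix x e :: real assume "x \<notin> N" "0 < e"
    from N(2)[OF this] obtain d where d: "d > 0" "\<And>\<delta>. 0 < \<delta> \<Longrightarrow> \<delta> < d \<Longrightarrow>
        norm (integral (cbox x (x + \<delta> *\<^sub>R One)) (\<lambda>t. norm (h t - c)) /\<^sub>R \<delta> ^ DIM(real) - norm (h x - c)) < e"
      by blast
    have "\<bar>deviation c {x<..x + \<delta>} - norm (h x - c) * \<delta>\<bar> < e * \<delta>" if "0 < \<delta>" "\<delta> < d" for \<delta>
    proof -
      have "\<bar>deviation c {x<..x + \<delta>} / \<delta> - norm (h x - c)\<bar> < e"
        using d(2)[OF that] by (simp add: deviation_interval divide_inverse mult.commute)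
      moreover have "\<bar>deviation c {x<..x + \<delta>} - norm (h x - c) * \<delta>\<bar> = \<bar>deviation c {x<..x + \<delta>} / \<delta> - norm (h x - c)\<bar> * \<delta>"
      proof -
        have "deviation c {x<..x + \<delta>} - norm (h x - c) * \<delta> = (deviation c {x<..x + \<delta>} / \<delta> - norm (h x - c)) * \<delta>"
          using that by (simp add: left_diff_distrib)
        then show ?thesis using that by (simp add: abs_mult)
      qed
      ultimately show ?thesis using that by simp
    qed
    then show "\<exists>d>0. \<forall>\<delta>. 0 < \<delta> \<and> \<delta> < d \<longrightarrow> \<bar>deviation c {x<..x + \<delta>} - norm (h x - c) * \<delta>\<bar> < e * \<delta>"
      using d(1) by blast
  qed
qed

text \<open>A point \<open>x\<close> with \<open>h x\<close> nonzero is chosen outside the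
  exceptional sets of a countable family of constants. The family contains the values of the simple
  approximants, hence elements arbitrarily close to \<open>h x\<close>, and near \<open>x\<close>
  the mean of |h - c| is governed by |h x - c|.\<close>

lemma almost_constant_interval:
  assumes pos: "0 < variation UNIV" and \<eta>: "0 < \<eta>" "\<eta> \<le> 1" and e0: "0 < e0"
  obtains x \<delta> c where "0 < \<delta>" "0 < variation {x<..x + \<delta>}" "variation {x<..x + \<delta>} \<le> e0"
    "deviation c {x<..x + \<delta>} \<le> \<eta> * variation {x<..x + \<delta>}" "norm c * \<delta> \<le> 4 * variation {x<..x + \<delta>}"
proof -
  obtain s where s: "\<And>i. simple_integrable lborel (s i)"
    "\<And>t. (\<lambda>i. s i t) \<longlonglongrightarrow> h t"
    using h unfolding has_strong_integral_def by auto
  \<comment> \<open>0 is included so that the variation itself can be differentiated at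
    \<open>x\<close>.\<close>
  define C where "C = insert 0 (\<Union>i. range (s i))"
  have "finite (range (s i))" for i
    using simple_functionD(1)[OF simple_integrable_simple_function[OF s(1)[of i]]] by simp
  then have C: "countable C" unfolding C_def by (intro countable_insert countable_UN) (auto intro: countable_finite)
  have "\<exists>N. negligible N \<and> (\<forall>x e. x \<notin> N \<longrightarrow> 0 < e \<longrightarrow>
      (\<exists>d>0. \<forall>\<delta>. 0 < \<delta> \<and> \<delta> < d \<longrightarrow> \<bar>deviation c {x<..x + \<delta>} - norm (h x - c) * \<delta>\<bar> < e * \<delta>))" for c
    by (rule deviation_differentiable[of c]) blast
  then obtain N where N: "\<And>c. negligible (N c)"
    "\<And>c x e. x \<notin> N c \<Longrightarrow> 0 < e \<Longrightarrow>
      \<exists>d>0. \<forall>\<delta>. 0 < \<delta> \<and> \<delta> < d \<longrightarrow> \<bar>deviation c {x<..x + \<delta>} - norm (h x - c) * \<delta>\<bar> < e * \<delta>"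
    by metis
  have neg: "negligible (\<Union>c\<in>C. N c)"
    using C N(1) by (intro negligible_countable_Union) auto
  have "\<exists>x. x \<notin> (\<Union>c\<in>C. N c) \<and> h x \<noteq> 0"
  proof (rule ccontr)
    assume "\<not> (\<exists>x. x \<notin> (\<Union>c\<in>C. N c) \<and> h x \<noteq> 0)"
    then have "AE x in lebesgue. norm (h x) = 0"
      using neg by (intro AE_I'[of "\<Union>c\<in>C. N c"]) (auto simp: negligible_iff_null_sets)
    then have "AE x in lborel. norm (h x) = 0" by (simp add: AE_completion_iff)
    then have "variation UNIV = (LINT t|(lborel :: real measure). 0)"
      unfolding variation_def using integrable_norm by (intro Bochner_Integration.integral_cong_AE) auto
    with pos show False by simp
  qed
  then obtain x where x: "\<And>c. c \<in> C \<Longrightarrow> x \<notin> N c" "h x \<noteq> 0" by blast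
  define a where "a = norm (h x)"
  have a: "0 < a" using x by (simp add: a_def)
  \<comment> \<open>With this tolerance the deviation is at most 2 e \<delta> = \<eta> a \<delta> /
    4, while the variation is at least 7/8 a \<delta>.\<close>
  define e where "e = \<eta> / 8 * a"
  have e: "0 < e" "e \<le> a / 8" using \<eta> a by (simp_all add: e_def)
  have "eventually (\<lambda>i. dist (s i x) (h x) < e) sequentially"
    using s(2)[of x] e(1) by (rule tendstoD)
  then obtain i where i: "norm (h x - s i x) < e"
    by (auto simp: eventually_sequentially dist_norm norm_minus_commute)
  \<comment> \<open>\<open>h x\<close> itself need not belong to the countable family, so a nearby
    member is taken as the constant.\<close>
  define c where "c = s i x"
  have cC: "c \<in> C" "0 \<in> C" by (auto simp: C_def c_def)
  obtain d1 where d1: "d1 > 0" "\<And>\<delta>. 0 < \<delta> \<Longrightarrow> \<delta> < d1 \<Longrightarrow> \<bar>deviation c {x<..x + \<delta>} - norm (h x - c) * \<delta>\<bar> < e * \<delta>"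
    using N(2)[OF x(1)[OF cC(1)] e(1)] by blast
  obtain d2 where d2: "d2 > 0" "\<And>\<delta>. 0 < \<delta> \<Longrightarrow> \<delta> < d2 \<Longrightarrow> \<bar>variation {x<..x + \<delta>} - a * \<delta>\<bar> < e * \<delta>"
    using N(2)[OF x(1)[OF cC(2)] e(1)] by (auto simp: deviation_0 a_def)
  \<comment> \<open>The last term keeps the variation, which is at most 9/8 a \<delta>, below
    \<open>e0\<close>.\<close>
  define \<delta> where "\<delta> = min (min (d1 / 2) (d2 / 2)) (e0 / (2 * a))"
  have \<delta>: "0 < \<delta>" "\<delta> < d1" "\<delta> < d2" "\<delta> \<le> e0 / (2 * a)"
    using d1(1) d2(1) e0 a by (auto simp: \<delta>_def min_def)
  define V where "V = variation {x<..x + \<delta>}"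
  have V: "\<bar>V - a * \<delta>\<bar> < e * \<delta>" unfolding V_def by (rule d2(2)[OF \<delta>(1,3)])
  have e\<delta>: "e * \<delta> \<le> a * \<delta> / 8" using mult_right_mono[OF e(2), of \<delta>] \<delta>(1) by simp
  have a\<delta>: "0 < a * \<delta>" "a * \<delta> \<le> e0 / 2"
    using a \<delta> by (simp_all add: pos_le_divide_eq mult.commute)
  have V1: "7 / 8 * (a * \<delta>) \<le> V" "V \<le> e0" using V e\<delta> a\<delta> by linarith+
  have D: "deviation c {x<..x + \<delta>} \<le> \<eta> * V"
  proof -
    have "norm (h x - c) * \<delta> \<le> e * \<delta>" using i \<delta> by (intro mult_right_mono) (auto simp: c_def)
    then have "deviation c {x<..x + \<delta>} \<le> 2 * (e * \<delta>)" using d1(2)[OF \<delta>(1,2)] by linarith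
    also have "\<dots> = \<eta> * (a * \<delta> / 4)" by (simp add: e_def)
    also have "\<dots> \<le> \<eta> * V" using V1 a\<delta> \<eta> by (intro mult_left_mono) auto
    finally show ?thesis .
  qed
  have "norm c \<le> a + e"
    using norm_triangle_ineq2[of c "h x"] i by (simp add: a_def c_def norm_minus_commute)
  then have "norm c * \<delta> \<le> (a + e) * \<delta>" using \<delta> by (intro mult_right_mono) auto
  then have "norm c * \<delta> \<le> 4 * V" using V1 e\<delta> a\<delta> by (simp add: distrib_right)
  then show ?thesis
    using that[of \<delta> x c] \<delta>(1) V1 a\<delta> D by (simp add: V_def)
qed

section \<open>First-order coefficients as integrals of the density\<close>

lemma has_integral_indicator:
  assumes E: "E \<in> sets borel"
  shows "has_strong_integral lborel (\<lambda>t. indicat_real E t *\<^sub>R h t) (fps_nth (ordered_exp E) 1)"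
proof -
  have "simple_function lborel (indicat_real E)" using E by (intro simple_function_indicator) simp
  then obtain y where y: "has_strong_integral lborel (\<lambda>t. indicat_real E t *\<^sub>R h t) y"
    using has_strong_integral_simple_weight[OF h] by blast
  have "distr (cube 1) lborel (\<lambda>x. x 1) = lborel"
    using lborel_product.distr_singleton[of 1] by simp
  then have "has_strong_integral (cube 1) (\<lambda>t. indicat_real E (t 1) *\<^sub>R h (t 1)) y"
    using measurable_component_singleton[of 1 "{1..1}" "\<lambda>_. lborel"]
    by (intro has_strong_integral_distr[OF _ _ y]) auto
  then have "has_strong_integral (cube 1) (\<lambda>t. indicat_real (time_simplex 1 E) t *\<^sub>R path_product h 1 t) y"
  proof (rule has_strong_integral_cong[rotated])
    fix t assume "t \<in> space (cube 1)"
    then have "t \<in> time_simplex 1 E \<longleftrightarrow> t 1 \<in> E" by (auto simp: space_PiM time_simplex_def PiE_iff)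
    then show "indicat_real E (t 1) *\<^sub>R h (t 1) = indicat_real (time_simplex 1 E) t *\<^sub>R path_product h 1 t"
      by (simp add: indicator_def path_product_def)
  qed
  then have "fps_nth (ordered_exp E) 1 = y"
    unfolding ordered_exp_nth iterated_integral_def by (rule bochner_integral_normed_eq) simp
  then show ?thesis using y by simp
qed

lemma has_strong_integral_indicator_const:
  assumes E: "E \<in> sets borel" "emeasure lborel E < \<infinity>"
  shows "has_strong_integral lborel (\<lambda>t. indicat_real E t *\<^sub>R c) (measure lborel E *\<^sub>R c)"
proof -
  have sb: "simple_integrable lborel (indicat_real E)"
  proof
    have "{t \<in> space lborel. indicat_real E t \<noteq> 0} = E" by (auto simp: indicator_def)
    then show "emeasure lborel {t \<in> space lborel. indicat_real E t \<noteq> 0} \<noteq> \<infinity>" using E by simp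
  qed (use E in \<open>intro simple_function_indicator, simp\<close>)
  have "integral_simple lborel (indicat_real E) = measure lborel E"
    using simple_bochner_integral_eq_nn_integral[OF sb] E
    by (simp add: ennreal_indicator emeasure_eq_ennreal_measure)
  then have "has_strong_integral lborel (indicat_real E) (measure lborel E)"
    using has_strong_integral_simple[OF sb] by simp
  then show ?thesis by (rule has_strong_integral_bounded_linear[OF bounded_linear_scaleR_left])
qed

text \<open>The left side is the norm of the integral of h - c over \<open>E\<close>.\<close>

lemma ordered_exp_nth_1_approx:
  assumes E: "E \<in> sets borel" "emeasure lborel E < \<infinity>"
  shows "norm (fps_nth (ordered_exp E) 1 - measure lborel E *\<^sub>R c) \<le> deviation c E"
proof -
  have "ennreal (norm (fps_nth (ordered_exp E) 1 - measure lborel E *\<^sub>R c))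
    \<le> (\<integral>\<^sup>+t. norm (indicat_real E t *\<^sub>R h t - indicat_real E t *\<^sub>R c) \<partial>lborel)"
    by (rule has_strong_integral_norm_le(1)[OF has_strong_integral_diff[OF has_integral_indicator[OF E(1)]
          has_strong_integral_indicator_const[OF E]]])
  also have "\<dots> = (\<integral>\<^sup>+t. ennreal (indicat_real E t * norm (h t - c)) \<partial>lborel)"
    by (simp flip: scaleR_diff_right)
  also have "\<dots> = ennreal (deviation c E)"
    unfolding deviation_def by (intro nn_integral_eq_integral integrable_norm_diff E) simp
  finally show ?thesis
    by (subst (asm) ennreal_le_iff) (auto simp: deviation_def intro!: Bochner_Integration.integral_nonneg)
qed

text \<open>Radius and constant are common to all \<lambda>, which is what later allows integration
  over \<lambda> term by term.\<close>

theorem uniform_resolvent_bound: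
  assumes V: "variation UNIV \<le> 2"
  shows "\<exists>\<rho> C. 1 < \<rho> \<and> (\<forall>m\<in>{0..1}. fps_bound \<rho> (fps_resolvent m (ordered_exp UNIV)) C)"
proof (cases "variation UNIV < 2")
  case True
  then show ?thesis by (intro resolvent_bound_subcritical) auto
next
  case False
  with V have V2: "variation UNIV = 2" by simp
  obtain x \<delta> c where J: "0 < \<delta>" "0 < variation {x<..x + \<delta>}" "variation {x<..x + \<delta>} \<le> 1 / 1000"
    "deviation c {x<..x + \<delta>} \<le> 1 / 1000 * variation {x<..x + \<delta>}" "norm c * \<delta> \<le> 4 * variation {x<..x + \<delta>}"
    by (rule almost_constant_interval[where \<eta> = "1 / 1000" and ?e0.0 = "1 / 1000", OF _ _ _ _ that])
      (simp_all add: V2)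
  let ?J = "{x<..x + \<delta>}"
  have fin: "emeasure lborel E < \<infinity>" if "E \<in> sets borel" "E \<subseteq> ?J" for E
  proof -
    have "emeasure lborel E \<le> emeasure lborel ?J" using that by (intro emeasure_mono) auto
    also have "\<dots> < \<infinity>" using J(1) by simp
    finally show ?thesis .
  qed
  have M: "norm (fps_nth (ordered_exp ?J) 2 - (1/2) *\<^sub>R (fps_nth (ordered_exp ?J) 1 * fps_nth (ordered_exp ?J) 1))
    \<le> norm c * measure lborel ?J * deviation c ?J + (deviation c ?J)\<^sup>2 / 2"
  proof (rule second_order_bound)
    fix E assume E: "E \<in> sets borel" "E \<subseteq> ?J"
    show "norm (fps_nth (ordered_exp E) 1 - measure lborel E *\<^sub>R c) \<le> deviation c E"
      by (rule ordered_exp_nth_1_approx[OF E(1) fin[OF E]])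
    fix s
    show "deviation c E = deviation c (E \<inter> {..s}) + deviation c (E \<inter> {s<..})"
      by (rule deviation_split[OF E(1) fin[OF E]])
    have "measure lborel ((E \<inter> {..s}) \<union> (E \<inter> {s<..})) = measure lborel (E \<inter> {..s}) + measure lborel (E \<inter> {s<..})"
    proof -
      have "E \<inter> {..s} \<subseteq> ?J" "E \<inter> {s<..} \<subseteq> ?J" using E(2) by auto
      from fin[OF _ this(1)] fin[OF _ this(2)] show ?thesis using E(1) by (intro measure_Union) auto
    qed
    moreover have "(E \<inter> {..s}) \<union> (E \<inter> {s<..}) = E" by auto
    ultimately show "measure lborel E = measure lborel (E \<inter> {..s}) + measure lborel (E \<inter> {s<..})" by simp
  qed auto
  define v where "v = variation ?J"
  have "0 \<le> deviation c ?J" unfolding deviation_def by (intro Bochner_Integration.integral_nonneg) simp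
  moreover have "norm c * measure lborel ?J \<le> 4 * v" using J by (simp add: v_def)
  \<comment> \<open>With both parameters equal to 1/1000 this is about v^2 / 250, well below the
    permitted v^2 / 64.\<close>
  ultimately have "norm c * measure lborel ?J * deviation c ?J + (deviation c ?J)\<^sup>2 / 2 \<le> 4 * v * (1 / 1000 * v) + (1 / 1000 * v)\<^sup>2 / 2"
    using J by (intro add_mono mult_mono[of "norm c * measure lborel ?J"] divide_right_mono power_mono) (auto simp: v_def)
  also have "\<dots> \<le> v\<^sup>2 / 64" by (simp add: power2_eq_square)
  finally have M64: "norm (fps_nth (ordered_exp ?J) 2 - (1/2) *\<^sub>R (fps_nth (ordered_exp ?J) 1 * fps_nth (ordered_exp ?J) 1))
    \<le> (variation ?J)\<^sup>2 / 64"
    using M by (simp add: v_def)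
  have "?J = UNIV \<inter> {x<..} \<inter> {..x + \<delta>}" by auto
  then show ?thesis
    using V2 J(2,3) M64 by (intro resolvent_bound_critical[of UNIV ?J x "x + \<delta>"]) auto
qed

end

section \<open>Evaluation of absolutely summable power series\<close>

lemma fps_bound_antimono:
  assumes "0 \<le> r" "r \<le> s" "fps_bound s F c"
  shows "fps_bound r F c"
proof (rule fps_boundI)
  fix n
  have "fps_wsum r F n \<le> fps_wsum s F n"
    unfolding fps_wsum_def using assms(1,2) by (intro sum_mono mult_left_mono power_mono) auto
  also have "\<dots> \<le> c" by (rule fps_boundD[OF assms(3)])
  finally show "fps_wsum r F n \<le> c" .
qed

text \<open>Evaluation at t = 1. On series of finite l^1 norm it respects sums and products, which
  transfers the formal identities to the algebra.\<close>

definition fps_sum :: "'a::real_normed_algebra_1 fps \<Rightarrow> 'a" where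
  "fps_sum F = (\<Sum>k. fps_nth F k)"

lemma fps_bound_summable:
  assumes "fps_bound 1 F c"
  shows "summable (\<lambda>k. norm (fps_nth F k))"
proof (rule summableI_nonneg_bounded)
  fix n
  have "(\<Sum>k<n. norm (fps_nth F k)) \<le> fps_wsum 1 F n"
    unfolding fps_wsum_def by (simp, intro sum_mono2) auto
  also have "\<dots> \<le> c" by (rule fps_boundD[OF assms])
  finally show "(\<Sum>k<n. norm (fps_nth F k)) \<le> c" .
qed simp

context
  fixes F G :: "'a::{real_normed_algebra_1, banach} fps" and c d :: real
  assumes F: "fps_bound 1 F c" and G: "fps_bound 1 G d"
begin

lemma fps_sum_mult: "fps_sum (F * G) = fps_sum F * fps_sum G"
proof -
  have "fps_nth (F * G) = (\<lambda>k. \<Sum>i\<le>k. fps_nth F i * fps_nth G (k - i))"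
    by (rule ext) (simp add: fps_mult_nth atLeast0AtMost)
  then show ?thesis
    unfolding fps_sum_def Cauchy_product[OF fps_bound_summable[OF F] fps_bound_summable[OF G]] by simp
qed

lemma fps_sum_add: "fps_sum (F + G) = fps_sum F + fps_sum G"
proof -
  have "fps_nth (F + G) = (\<lambda>k. fps_nth F k + fps_nth G k)" by (rule ext) simp
  then show ?thesis
    unfolding fps_sum_def
    using suminf_add[OF summable_norm_cancel[OF fps_bound_summable[OF F]] summable_norm_cancel[OF fps_bound_summable[OF G]]]
    by simp
qed

lemma fps_sum_diff: "fps_sum (F - G) = fps_sum F - fps_sum G"
proof -
  have "fps_nth (F - G) = (\<lambda>k. fps_nth F k - fps_nth G k)" by (rule ext) simp
  then show ?thesis
    unfolding fps_sum_def
    using suminf_diff[OF summable_norm_cancel[OF fps_bound_summable[OF F]] summable_norm_cancel[OF fps_bound_summable[OF G]]]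
    by simp
qed

end

lemma fps_sum_const: "fps_sum (fps_const c) = c"
proof -
  have "fps_nth (fps_const c) = (\<lambda>k. if k = 0 then c else 0)" by auto
  then show ?thesis unfolding fps_sum_def using sums_single[of 0 "\<lambda>_. c"] by (simp add: sums_iff)
qed

lemma fps_sum_split_head:
  fixes F :: "'a::{real_normed_algebra_1, banach} fps"
  assumes "fps_bound 1 F c"
  shows "fps_sum F = fps_nth F 0 + (\<Sum>k. fps_nth F (Suc k))"
  unfolding fps_sum_def
  using suminf_split_head[OF summable_norm_cancel[OF fps_bound_summable[OF assms]]] by simp

lemma fps_sum_1: "fps_sum 1 = 1"
  using fps_sum_const[of 1] by simp

text \<open>The inverse of 1 + m (A - 1) is expressed through \<open>X\<close> itself, so a bound on
  \<open>X\<close> bounds the inverse as well. A formal right inverse \<open>G\<close> makes it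
  two-sided.\<close>

lemma fps_resolvent_inverse:
  fixes A :: "'a::real_algebra_1 fps" and m :: real
  assumes A: "fps_nth A 0 = 1"
  defines "X \<equiv> fps_resolvent m A"
  shows "(1 - fps_real m * X) * (1 + fps_real m * (A - 1)) = 1"
    and "(1 + fps_real m * (A - 1)) * (1 - fps_real m * X) = 1"
    and "(A - 1) * (1 - fps_real m * X) = X"
proof -
  let ?U = "1 + fps_real m * (A - 1)" and ?P = "1 - fps_real m * X"
  have X: "X * ?U = A - 1" unfolding X_def by (rule fps_resolvent_eq[OF A])
  have "?P * ?U = ?U - fps_real m * (X * ?U)" by (simp add: left_diff_distrib mult.assoc)
  then show PU: "?P * ?U = 1" unfolding X by simp
  obtain G where G: "?U * G = 1" using fps_has_inverse[of ?U] A by auto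
  have "?P = ?P * (?U * G)" unfolding G by simp
  also have "\<dots> = G" unfolding mult.assoc[symmetric] PU by simp
  finally show UP: "?U * ?P = 1" using G by simp
  have "X = X * (?U * ?P)" unfolding UP by simp
  also have "\<dots> = (A - 1) * ?P" unfolding mult.assoc[symmetric] X ..
  finally show "(A - 1) * ?P = X" ..
qed

lemma exp_R_eq_iterated:
  "exp_R E h = 1 + (\<Sum>k. iterated_integral h (Suc k) (indicat_real (time_simplex (Suc k) E)))"
  unfolding exp_R_def time_ordered_integral_prod_list ..

lemma is_inverse_of_unique: "is_inverse_of y x \<Longrightarrow> is_inverse_of z x \<Longrightarrow> y = z"
  unfolding is_inverse_of_def by (metis mult.assoc mult.left_neutral mult.right_neutral)

locale subcritical_density = integrable_density h H
  for h :: "real \<Rightarrow> 'a::{real_normed_algebra_1, banach}" and H +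
  assumes variation_le: "variation UNIV \<le> 2"
begin

abbreviation "A \<equiv> ordered_exp UNIV"
abbreviation "X m \<equiv> fps_resolvent m A"

text \<open>Radius and constant are fixed once for all \<open>m\<close>; the constant belongs to the
  radius already chosen.\<close>

definition "bound_radius = (SOME \<rho>. 1 < \<rho> \<and> (\<exists>C. \<forall>m\<in>{0..1}. fps_bound \<rho> (X m) C))"
definition "bound_const = (SOME C. \<forall>m\<in>{0..1}. fps_bound bound_radius (X m) C)"

lemma radius_gt_1: "1 < bound_radius"
  and X_bound: "m \<in> {0..1} \<Longrightarrow> fps_bound bound_radius (X m) bound_const"
proof -
  have 1: "\<exists>\<rho>. 1 < \<rho> \<and> (\<exists>C. \<forall>m\<in>{0..1}. fps_bound \<rho> (X m) C)"
    using uniform_resolvent_bound[OF variation_le] by blast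
  have 2: "1 < bound_radius \<and> (\<exists>C. \<forall>m\<in>{0..1}. fps_bound bound_radius (X m) C)"
    unfolding bound_radius_def by (rule someI_ex[OF 1])
  have "\<forall>m\<in>{0..1}. fps_bound bound_radius (X m) bound_const"
    unfolding bound_const_def by (rule someI_ex) (use 2 in blast)
  with 2 show "1 < bound_radius" "m \<in> {0..1} \<Longrightarrow> fps_bound bound_radius (X m) bound_const" by auto
qed

lemma X_bound_1: "m \<in> {0..1} \<Longrightarrow> fps_bound 1 (X m) bound_const"
  using fps_bound_antimono[OF _ _ X_bound] radius_gt_1 by simp

lemma A_bound: "fps_bound 1 (A - 1) bound_const" and A_bound': "fps_bound 1 A (bound_const + 1)"
proof -
  \<comment> \<open>At m = 0 the bound on the transform is a bound on \<open>A - 1\<close>, so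
    convergence of the exponential series is a special case.\<close>
  have "X 0 = A - 1" using fps_resolvent_eq[OF ordered_exp_nth_0[of UNIV], of 0] by simp
  then show *: "fps_bound 1 (A - 1) bound_const" using X_bound_1[of 0] by simp
  show "fps_bound 1 A (bound_const + 1)" using fps_bound_add[OF _ * fps_bound_1] by simp
qed

lemma fps_real_bound: "0 \<le> m \<Longrightarrow> fps_bound 1 (fps_real m :: 'a fps) m"
  by (rule fps_bound_const) simp

lemma bound_1_mX: "m \<in> {0..1} \<Longrightarrow> fps_bound 1 (1 - fps_real m * X m) (1 + m * bound_const)"
  by (intro fps_bound_diff fps_bound_mult fps_bound_1 fps_real_bound X_bound_1) auto

lemma exp_R_eq: "exp_R UNIV h = fps_sum A"
proof -
  have "fps_sum A = fps_nth A 0 + (\<Sum>k. fps_nth A (Suc k))"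
    by (rule fps_sum_split_head[OF A_bound'])
  then show ?thesis
    by (simp only: exp_R_eq_iterated ordered_exp_nth_0) (simp only: ordered_exp_nth)
qed

text \<open>Evaluating the formal identities shows that the value of
  \<open>1 - fps_real m * X m\<close> is the inverse meant by the description operator.\<close>

lemma resolvent_at_1:
  assumes l: "l \<in> {0..1}"
  shows "(fps_sum A - 1) * (THE y. is_inverse_of y (l *\<^sub>R 1 + (1 - l) *\<^sub>R fps_sum A)) = fps_sum (X (1 - l))"
proof -
  define m where "m = 1 - l"
  have m: "m \<in> {0..1}" "0 \<le> m" using l by (auto simp: m_def)
  let ?U = "1 + fps_real m * (A - 1)" and ?P = "1 - fps_real m * X m"
  note P = bound_1_mX[OF m(1)] and mA = fps_bound_mult[OF _ fps_real_bound[OF m(2)] A_bound]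
  have U: "fps_bound 1 ?U (1 + m * bound_const)"
    by (intro fps_bound_add mA fps_bound_1) auto
  have sA: "fps_sum (A - 1) = fps_sum A - 1"
    using fps_sum_diff[OF A_bound' fps_bound_1] by (simp add: fps_sum_1)
  have "fps_sum ?U = 1 + of_real m * (fps_sum A - 1)"
    using fps_sum_add[OF fps_bound_1 mA] fps_sum_mult[OF fps_real_bound[OF m(2)] A_bound]
    by (simp add: fps_sum_1 fps_sum_const sA)
  also have "\<dots> = l *\<^sub>R 1 + (1 - l) *\<^sub>R fps_sum A"
    by (simp add: m_def of_real_def algebra_simps)
  finally have sU: "fps_sum ?U = l *\<^sub>R 1 + (1 - l) *\<^sub>R fps_sum A" .
  have "fps_sum ?U * fps_sum ?P = 1" "fps_sum ?P * fps_sum ?U = 1"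
    unfolding fps_sum_mult[OF U P, symmetric] fps_sum_mult[OF P U, symmetric]
    by (simp_all only: fps_resolvent_inverse[OF ordered_exp_nth_0] fps_sum_1)
  then have "is_inverse_of (fps_sum ?P) (l *\<^sub>R 1 + (1 - l) *\<^sub>R fps_sum A)"
    by (simp add: is_inverse_of_def sU)
  then have "(THE y. is_inverse_of y (l *\<^sub>R 1 + (1 - l) *\<^sub>R fps_sum A)) = fps_sum ?P"
    by (intro the_equality is_inverse_of_unique)
  then have "(fps_sum A - 1) * (THE y. is_inverse_of y (l *\<^sub>R 1 + (1 - l) *\<^sub>R fps_sum A)) = fps_sum ((A - 1) * ?P)"
    by (simp only: fps_sum_mult[OF A_bound P] sA)
  then show ?thesis
    by (simp only: fps_resolvent_inverse[OF ordered_exp_nth_0] m_def)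
qed

lemma norm_X_nth_le:
  assumes "m \<in> {0..1}"
  shows "norm (fps_nth (X m) k) \<le> bound_const * (1 / bound_radius) ^ k"
proof -
  have "norm (fps_nth (X m) k) * bound_radius ^ k \<le> bound_const"
    using fps_bound_nth[OF _ X_bound[OF assms]] radius_gt_1 by simp
  then show ?thesis using radius_gt_1 by (simp add: field_simps power_one_over)
qed

lemma summable_bound: "summable (\<lambda>k. bound_const * (1 / bound_radius) ^ k)"
  using radius_gt_1 by (intro summable_mult summable_geometric) simp

text \<open>Each Magnus term is an average over \<lambda> of coefficients that obey the same
  geometric bound.\<close>

lemma norm_magnus_term_le: "norm (magnus_term (Suc k) UNIV h) \<le> bound_const * (1 / bound_radius) ^ Suc k"
proof -
  have "norm (magnus_term (Suc k) UNIV h) \<le> bound_const * (1 / bound_radius) ^ Suc k * measure lborel (cbox 0 (1::real))"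
  proof (rule has_integral_bound)
    show "((\<lambda>l. fps_nth (X (1 - l)) (Suc k)) has_integral magnus_term (Suc k) UNIV h) (cbox 0 1)"
      using magnus_term_has_integral[of "Suc k"] by simp
    show "0 \<le> bound_const * (1 / bound_radius) ^ Suc k"
      by (rule order_trans[OF norm_ge_zero norm_X_nth_le[of 0]]) simp
    show "norm (fps_nth (X (1 - l)) (Suc k)) \<le> bound_const * (1 / bound_radius) ^ Suc k" if "l \<in> cbox 0 1" for l
      using that by (intro norm_X_nth_le) simp
  qed
  then show ?thesis by simp
qed

lemma magnus_summable: "summable (\<lambda>k. norm (magnus_term (Suc k) UNIV h))"
  using norm_magnus_term_le
  by (intro summable_comparison_test'[OF summable_bound[THEN summable_Suc_iff[THEN iffD2]]]) simp

text \<open>The geometric bound is uniform in \<lambda>, so by the Weierstrass test the series and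
  the integral over \<lambda> can be exchanged.\<close>

lemma log_alg_eq: "log_alg (exp_R UNIV h) = (\<Sum>k. magnus_term (Suc k) UNIV h)"
proof -
  \<comment> \<open>The Magnus series starts at 1 and the power series at 0; the transform has
    constant coefficient 0, hence this value at 0.\<close>
  define \<mu> where "\<mu> k = (if k = 0 then 0 else magnus_term k UNIV h)" for k
  let ?f = "\<lambda>n l. \<Sum>k<n. fps_nth (X (1 - l)) k"
  have \<mu>: "((\<lambda>l. fps_nth (X (1 - l)) k) has_integral \<mu> k) {0..1}" for k
    using magnus_term_has_integral[of k] by (cases "k = 0") (simp_all add: \<mu>_def fps_resolvent_nth_0 ordered_exp_nth_0)
  have "uniform_limit {0..1} ?f (\<lambda>l. \<Sum>k. fps_nth (X (1 - l)) k) sequentially"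
    by (rule Weierstrass_m_test[OF norm_X_nth_le summable_bound]) simp
  moreover have "continuous_on {0..1} (?f n)" for n
  proof (intro continuous_on_sum)
    fix k
    show "continuous_on {0..1} (\<lambda>l. fps_nth (X (1 - l)) k)"
    proof (cases "k = 0")
      case False
      then show ?thesis by (simp only: resolvent_ordered_exp_nth_sum neq0_conv) (intro continuous_intros)
    qed (simp add: fps_resolvent_nth_0 ordered_exp_nth_0)
  qed
  ultimately obtain I J where I: "\<And>n. (?f n has_integral I n) {0..1}"
    and J: "((\<lambda>l. \<Sum>k. fps_nth (X (1 - l)) k) has_integral J) {0..1}" and IJ: "I \<longlonglongrightarrow> J"
    by (rule uniform_limit_integral) auto
  have "I = (\<lambda>n. \<Sum>k<n. \<mu> k)"
    by (rule ext, rule has_integral_unique[OF I]) (intro has_integral_sum \<mu> finite_lessThan)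
  then have "\<mu> sums J" using IJ unfolding sums_def by simp
  then have "(\<lambda>k. \<mu> (Suc k)) sums J" by (subst sums_Suc_iff) (simp add: \<mu>_def)
  then have "(\<Sum>k. magnus_term (Suc k) UNIV h) = J" by (simp add: \<mu>_def sums_iff)
  moreover have "log_alg (exp_R UNIV h) = integral {0..1} (\<lambda>l. \<Sum>k. fps_nth (X (1 - l)) k)"
    unfolding log_alg_def exp_R_eq by (intro integral_cong) (rule trans[OF resolvent_at_1 fps_sum_def])
  ultimately show ?thesis using J by (simp add: integral_unique)
qed

end


section \<open>Complex parameters\<close>

lemma bounded_linear_scaleC: "bounded_linear (\<lambda>x::'a::complex_banach_algebra. t *\<^sub>C x)"
proof (rule bounded_linear_intro[where K = "cmod t"])
  fix r :: real and x y :: 'a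
  show "t *\<^sub>C (x + y) = t *\<^sub>C x + t *\<^sub>C y" by (rule scaleC_add_right)
  show "t *\<^sub>C r *\<^sub>R x = r *\<^sub>R t *\<^sub>C x"
    by (simp only: scaleC_of_real[symmetric] scaleC_scaleC mult.commute)
  show "norm (t *\<^sub>C x) \<le> norm x * cmod t" by (simp add: norm_scaleC mult.commute)
qed

lemma one_scaleC: "1 *\<^sub>C x = (x :: 'a::complex_banach_algebra)"
  using scaleC_of_real[of 1 x] by simp

lemma path_product_scaleC:
  fixes h :: "real \<Rightarrow> 'a::complex_banach_algebra"
  shows "path_product (\<lambda>s. z *\<^sub>C h s) k t = z ^ k *\<^sub>C path_product h k t"
proof (induction k)
  case (Suc k)
  then show ?case by (simp add: path_product_Suc mult_scaleC_left mult_scaleC_right scaleC_scaleC mult.commute)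
qed (simp add: one_scaleC)

text \<open>Substitution of z t for t. It respects sums and products, so one estimate for the
  original series covers every complex multiple of the density with |z| <= 1.\<close>

definition fps_dilate :: "complex \<Rightarrow> 'a::complex_banach_algebra fps \<Rightarrow> 'a fps" where
  "fps_dilate z F = Abs_fps (\<lambda>k. z ^ k *\<^sub>C fps_nth F k)"

lemma fps_dilate_nth: "fps_nth (fps_dilate z F) k = z ^ k *\<^sub>C fps_nth F k"
  by (simp add: fps_dilate_def)

lemma fps_dilate_mult: "fps_dilate z (F * G) = fps_dilate z F * fps_dilate z G"
proof (rule fps_ext)
  fix k
  interpret bounded_linear "\<lambda>x. z ^ k *\<^sub>C x :: 'a" by (rule bounded_linear_scaleC)
  show "fps_nth (fps_dilate z (F * G)) k = fps_nth (fps_dilate z F * fps_dilate z G) k"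
    unfolding fps_mult_nth fps_dilate_nth sum
    by (intro sum.cong refl)
      (simp add: mult_scaleC_left mult_scaleC_right scaleC_scaleC flip: power_add)
qed

lemma fps_dilate_const: "fps_dilate z (fps_const c) = fps_const c"
proof (rule fps_ext)
  fix k
  interpret bounded_linear "\<lambda>x. z ^ k *\<^sub>C x :: 'a" by (rule bounded_linear_scaleC)
  show "fps_nth (fps_dilate z (fps_const c)) k = fps_nth (fps_const c) k"
    using zero by (cases k) (simp_all add: fps_dilate_nth one_scaleC)
qed

lemma fps_dilate_1: "fps_dilate z 1 = 1"
  using fps_dilate_const[of z 1] by simp

lemma fps_dilate_add: "fps_dilate z (F + G) = fps_dilate z F + fps_dilate z G"
  by (rule fps_ext) (simp add: fps_dilate_nth scaleC_add_right)

lemma fps_dilate_diff: "fps_dilate z (F - G) = fps_dilate z F - fps_dilate z G"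
  using fps_dilate_add[of z "F - G" G] by simp

lemma fps_dilate_bound:
  assumes z: "cmod z \<le> 1" and F: "fps_bound 1 F c"
  shows "fps_bound 1 (fps_dilate z F) c"
proof (rule fps_boundI)
  fix n
  have "fps_wsum 1 (fps_dilate z F) n \<le> fps_wsum 1 F n"
    unfolding fps_wsum_def fps_dilate_nth norm_scaleC norm_power
    using z by (intro sum_mono mult_right_mono) (simp_all add: mult_left_le_one_le power_le_one)
  also have "\<dots> \<le> c" by (rule fps_boundD[OF F])
  finally show "fps_wsum 1 (fps_dilate z F) n \<le> c" .
qed

text \<open>For s >= 0 one has A + s = (1 + s) (1 + m (A - 1)) with m = 1 / (1 + s) in (0, 1], and
  the dilation of 1 - m X inverts the second factor.\<close>

lemma log_exists_dilate:
  fixes h :: "real \<Rightarrow> 'a::complex_banach_algebra"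
  assumes "subcritical_density h H" and z: "cmod z \<le> 1"
  shows "log_exists (exp_R UNIV (\<lambda>s. z *\<^sub>C h s))"
proof -
  interpret subcritical_density h H by fact
  let ?A = "fps_dilate z A"
  have A': "fps_bound 1 ?A (bound_const + 1)" by (rule fps_dilate_bound[OF z A_bound'])
  have A1: "fps_bound 1 (?A - 1) bound_const"
    using fps_dilate_bound[OF z A_bound] by (simp add: fps_dilate_diff fps_dilate_1)
  have sA: "fps_sum (?A - 1) = fps_sum ?A - 1"
    using fps_sum_diff[OF A' fps_bound_1] by (simp add: fps_sum_1)
  have nth: "iterated_integral (\<lambda>s. z *\<^sub>C h s) k (indicat_real (time_simplex k UNIV)) = fps_nth ?A k" for k
  proof -
    interpret T: bounded_linear "\<lambda>x. z ^ k *\<^sub>C x :: 'a" by (rule bounded_linear_scaleC)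
    have "has_strong_integral (cube k) (\<lambda>t. z ^ k *\<^sub>C (indicat_real (time_simplex k UNIV) t *\<^sub>R path_product h k t)) (fps_nth ?A k)"
      unfolding fps_dilate_nth ordered_exp_nth
      by (intro has_strong_integral_bounded_linear[OF bounded_linear_scaleC] has_iterated_integral simple_function_time_simplex) simp
    then show ?thesis
      unfolding iterated_integral_def[of "\<lambda>s. z *\<^sub>C h s"]
      by (rule bochner_integral_normed_eq) (simp add: path_product_scaleC T.scaleR)
  qed
  have "fps_sum ?A = fps_nth ?A 0 + (\<Sum>k. fps_nth ?A (Suc k))"
    by (rule fps_sum_split_head[OF A'])
  then have expA: "exp_R UNIV (\<lambda>s. z *\<^sub>C h s) = fps_sum ?A"
    by (simp only: exp_R_eq_iterated nth) (simp add: fps_dilate_nth ordered_exp_nth_0 one_scaleC)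
  have inv: "\<exists>y. is_inverse_of y (fps_sum ?A - complex_of_real (- s) *\<^sub>C 1)" if s: "0 \<le> s" for s
  proof -
    define m where "m = 1 / (1 + s)"
    have m: "m \<in> {0..1}" "0 \<le> m" "m \<noteq> 0" "(1 + s) * m = 1" using s by (auto simp: m_def)
    let ?U = "1 + fps_real m * (?A - 1)" and ?P = "fps_dilate z (1 - fps_real m * X m)"
    note P = fps_dilate_bound[OF z bound_1_mX[OF m(1)]] and mA = fps_bound_mult[OF _ fps_real_bound[OF m(2)] A1]
    have U: "fps_bound 1 ?U (1 + m * bound_const)"
      by (intro fps_bound_add mA fps_bound_1) auto
    have Ud: "?U = fps_dilate z (1 + fps_real m * (A - 1))"
      by (simp add: fps_dilate_add fps_dilate_mult fps_dilate_diff fps_dilate_1 fps_dilate_const)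
    have "fps_sum ?U = 1 + of_real m * (fps_sum ?A - 1)"
      using fps_sum_add[OF fps_bound_1 mA] fps_sum_mult[OF fps_real_bound[OF m(2)] A1]
      by (simp add: fps_sum_1 fps_sum_const sA)
    then have "(1 + s) *\<^sub>R fps_sum ?U = (1 + s) *\<^sub>R 1 + ((1 + s) * m) *\<^sub>R (fps_sum ?A - 1)"
      by (simp add: of_real_def scaleR_add_right)
    also have "\<dots> = fps_sum ?A - complex_of_real (- s) *\<^sub>C 1"
      unfolding m(4) scaleC_of_real by (simp add: algebra_simps)
    finally have sU: "fps_sum ?A - complex_of_real (- s) *\<^sub>C 1 = (1 + s) *\<^sub>R fps_sum ?U" ..
    have "fps_sum ?U * fps_sum ?P = 1" "fps_sum ?P * fps_sum ?U = 1"
      unfolding fps_sum_mult[OF U P, symmetric] fps_sum_mult[OF P U, symmetric]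
      unfolding Ud fps_dilate_mult[symmetric]
      by (simp_all only: fps_resolvent_inverse[OF ordered_exp_nth_0] fps_sum_1 fps_dilate_1)
    then have "is_inverse_of (m *\<^sub>R fps_sum ?P) ((1 + s) *\<^sub>R fps_sum ?U)"
      using m(4) by (simp add: is_inverse_of_def mult.commute[of m])
    then show ?thesis unfolding sU by blast
  qed
  have "complex_of_real r \<notin> spectrum (fps_sum ?A)" if "r \<le> 0" for r
    using inv[of "- r"] that by (simp add: spectrum_def)
  then show ?thesis unfolding log_exists_def expA by auto
qed


section \<open>Reduction to a Borel density on the real line\<close>

lemma has_bochner_integral_normed_cong_AE:
  assumes "AE z in M. f z = g z" "has_bochner_integral_normed M f x"
  shows "has_bochner_integral_normed M g x"
proof -
  obtain f' where f': "has_strong_integral M f' x" "AE z in M. f z = f' z"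
    using assms(2) by (rule has_bochner_integral_normed_imp_strong)
  have "AE z in M. f' z = g z" using f'(2) assms(1) by eventually_elim simp
  with f'(1) show ?thesis by (rule has_strong_integral_imp_normed)
qed

lemma bochner_integral_normed_cong_AE:
  assumes "AE z in M. f z = g z"
  shows "bochner_integral_normed M f = bochner_integral_normed M g"
proof -
  have "AE z in M. g z = f z" using assms by eventually_elim simp
  then have "has_bochner_integral_normed M f = has_bochner_integral_normed M g"
    using assms has_bochner_integral_normed_cong_AE by (intro ext iffI) blast+
  then show ?thesis by (simp add: bochner_integral_normed_def bochner_integrable_normed_def)
qed

text \<open>Where some coordinate lies outside \<open>I\<close>, the second condition on
  \<open>F\<close> makes the right-hand integrand vanish too; ordered products and Magnus
  commutators satisfy it. For k = 0 the two integrands coincide.\<close>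

lemma time_ordered_integral_extend:
  fixes h g :: "real \<Rightarrow> 'a::real_normed_vector"
  assumes eq: "AE s in lborel. indicat_real I s *\<^sub>R h s = g s" and z: "\<And>s. s \<notin> I \<Longrightarrow> g s = 0"
    and F: "\<And>X Y. (\<And>i. i \<in> {1..k} \<Longrightarrow> X i = Y i) \<Longrightarrow> F X = F Y" "\<And>X i. i \<in> {1..k} \<Longrightarrow> X i = 0 \<Longrightarrow> F X = 0"
  shows "time_ordered_integral k I F h = time_ordered_integral k UNIV F g"
  unfolding time_ordered_integral_def
proof (rule bochner_integral_normed_cong_AE)
  show "AE t in cube k. indicat_real (time_simplex k I) t *\<^sub>R F (\<lambda>i. h (t i)) = indicat_real (time_simplex k UNIV) t *\<^sub>R F (\<lambda>i. g (t i))"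
    using AE_cube_all[OF eq, of k] AE_space
  proof eventually_elim
    case (elim t)
    show ?case
    proof (cases "\<forall>i\<in>{1..k}. t i \<in> I")
      case True
      then have "h (t i) = g (t i)" if "i \<in> {1..k}" for i using elim(1) that by auto
      then have "F (\<lambda>i. h (t i)) = F (\<lambda>i. g (t i))" by (rule F(1))
      moreover have "t \<in> time_simplex k I \<longleftrightarrow> t \<in> time_simplex k UNIV"
        using True by (auto simp: time_simplex_def PiE_iff)
      ultimately show ?thesis by (simp add: indicator_def)
    next
      case False
      then obtain i where i: "i \<in> {1..k}" "t i \<notin> I" by blast
      then have "F (\<lambda>i. g (t i)) = 0" using z by (intro F(2)[OF i(1)]) simp
      moreover have "t \<notin> time_simplex k I" using i by (auto simp: time_simplex_def PiE_iff)
      ultimately show ?thesis by simp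
    qed
  qed
qed

section \<open>Extension by zero for the exponential and the Magnus terms\<close>

lemma prod_list_eq_0: "0 \<in> set xs \<Longrightarrow> prod_list xs = (0 :: 'a::semiring_1)"
  by (induction xs) auto

lemma exp_R_extend:
  fixes h g :: "real \<Rightarrow> 'a::real_normed_algebra_1"
  assumes "AE s in lborel. indicat_real I s *\<^sub>R h s = g s" "\<And>s. s \<notin> I \<Longrightarrow> g s = 0"
  shows "exp_R I h = exp_R UNIV g"
proof -
  have "time_ordered_integral k I (\<lambda>X. prod_list (map X [1..<Suc k])) h
    = time_ordered_integral k UNIV (\<lambda>X. prod_list (map X [1..<Suc k])) g" for k
  proof (rule time_ordered_integral_extend[OF assms])
    show "prod_list (map X [1..<Suc k]) = prod_list (map Y [1..<Suc k])"
      if "\<And>i. i \<in> {1..k} \<Longrightarrow> X i = Y i" for X Y :: "nat \<Rightarrow> 'a"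
      using that by (intro arg_cong[where f = prod_list] map_cong) auto
    show "prod_list (map X [1..<Suc k]) = 0" if "i \<in> {1..k}" "X i = 0" for X :: "nat \<Rightarrow> 'a" and i
      using that by (intro prod_list_eq_0) (auto intro!: image_eqI[of _ X i] simp del: upt_Suc)
  qed auto
  then show ?thesis unfolding exp_R_def by (simp only:)
qed

lemma magnus_commutator_cong:
  assumes "\<And>i. i \<in> {1..k} \<Longrightarrow> X i = Y i"
  shows "magnus_commutator k X = magnus_commutator k Y"
  unfolding magnus_commutator_def
proof (intro sum.cong refl arg_cong2[where f = scaleR] arg_cong[where f = prod_list] map_cong)
  fix \<sigma> i assume "\<sigma> \<in> {\<sigma>. \<sigma> permutes {1..k}}" "i \<in> set [1..<Suc k]"
  then have "\<sigma> i \<in> {1..k}" using permutes_in_image[of \<sigma> "{1..k}" i] by auto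
  then show "X (\<sigma> i) = Y (\<sigma> i)" by (rule assms)
qed

text \<open>Every variable occurs in each of the permuted products.\<close>

lemma magnus_commutator_eq_0:
  assumes i: "i \<in> {1..k}" and X: "X i = 0"
  shows "magnus_commutator k X = 0"
  unfolding magnus_commutator_def
proof (intro sum.neutral ballI)
  fix \<sigma> assume "\<sigma> \<in> {\<sigma>. \<sigma> permutes {1..k}}"
  then have \<sigma>: "\<sigma> permutes {1..k}" by simp
  have "inv \<sigma> i \<in> {1..k}" using permutes_in_image[OF permutes_inv[OF \<sigma>]] i by blast
  then have "X (\<sigma> (inv \<sigma> i)) \<in> set (map (\<lambda>i. X (\<sigma> i)) [1..<Suc k])" by (auto simp del: upt_Suc)
  then have "prod_list (map (\<lambda>i. X (\<sigma> i)) [1..<Suc k]) = 0"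
    by (intro prod_list_eq_0) (simp only: permutes_inverses(1)[OF \<sigma>] X)
  then show "((- 1) ^ des k \<sigma> * (fact (asc k \<sigma>) * fact (des k \<sigma>) / fact k)) *\<^sub>R prod_list (map (\<lambda>i. X (\<sigma> i)) [1..<Suc k]) = 0"
    by (simp only: scaleR_zero_right)
qed

lemma magnus_term_extend:
  fixes h g :: "real \<Rightarrow> 'a::real_normed_algebra_1"
  assumes "AE s in lborel. indicat_real I s *\<^sub>R h s = g s" "\<And>s. s \<notin> I \<Longrightarrow> g s = 0"
  shows "magnus_term k I h = magnus_term k UNIV g"
  unfolding magnus_term_def
  by (rule time_ordered_integral_extend[OF assms magnus_commutator_cong magnus_commutator_eq_0])

lemma borel_density:
  assumes "h bochner_integrable_on I"
  obtains g G where "has_strong_integral lborel g G" "AE s in lborel. indicat_real I s *\<^sub>R h s = g s" "\<And>s. s \<notin> I \<Longrightarrow> g s = 0"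
proof -
  obtain G where G: "has_bochner_integral_normed lborel (\<lambda>s. indicat_real I s *\<^sub>R h s) G"
    using assms by (auto simp: bochner_integrable_on_def bochner_integrable_normed_def)
  obtain g where g: "has_strong_integral lborel g G" "AE s in lborel. indicat_real I s *\<^sub>R h s = g s"
    "\<And>s. indicat_real I s *\<^sub>R h s = 0 \<Longrightarrow> g s = 0"
    using has_bochner_integral_normed_imp_strong[OF G] by metis
  show ?thesis by (rule that[OF g(1,2)]) (use g(3) in simp)
qed

text \<open>The integral over \<open>I\<close> refers to the completed measure and to
  \<open>h\<close> itself. It equals the variation of \<open>g\<close>, since \<open>g\<close>
  differs from the extension of \<open>h\<close> by zero only on a null set.\<close>

lemma subcritical_densityI:
  assumes g: "has_strong_integral lborel g G" and eq: "AE s in lborel. indicat_real I s *\<^sub>R h s = g s"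
    and le: "(LINT t:I|lebesgue. norm (h t)) \<le> 2"
  shows "subcritical_density g G"
proof -
  interpret integrable_density g G by unfold_locales (rule g)
  have ae: "AE s in lebesgue. norm (g s) = indicat_real I s *\<^sub>R norm (h s)"
    unfolding AE_completion_iff using eq by eventually_elim (metis abs_of_nonneg indicator_pos_le norm_scaleR real_scaleR_def)
  have m: "(\<lambda>s. norm (g s)) \<in> borel_measurable lebesgue"
    by (rule measurable_completion[OF has_strong_integral_measurable_norm[OF g]])
  have "(LINT t:I|lebesgue. norm (h t)) = (LINT t|lebesgue. norm (g t))"
    unfolding set_lebesgue_integral_def
    using ae by (intro Bochner_Integration.integral_cong_AE borel_measurable_AE[OF m ae] m) auto
  also have "\<dots> = (LINT t|lborel. norm (g t))"
    by (rule integral_completion[OF has_strong_integral_measurable_norm[OF g]])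
  also have "\<dots> = variation UNIV" by (simp add: variation_def)
  finally show ?thesis using le by unfold_locales simp
qed

lemma magnus_expansion:
  fixes h :: "real \<Rightarrow> 'a::{real_normed_algebra_1, banach}"
  assumes "h bochner_integrable_on I" "(LINT t:I|lebesgue. norm (h t)) \<le> 2"
  shows "summable (\<lambda>k. norm (magnus_term (Suc k) I h))"
    and "log_alg (exp_R I h) = (\<Sum>k. magnus_term (Suc k) I h)"
proof -
  obtain g G where g: "has_strong_integral lborel g G" "AE s in lborel. indicat_real I s *\<^sub>R h s = g s" "\<And>s. s \<notin> I \<Longrightarrow> g s = 0"
    by (rule borel_density[OF assms(1) that])
  interpret subcritical_density g G by (rule subcritical_densityI[OF g(1,2) assms(2)])
  have m: "magnus_term k I h = magnus_term k UNIV g" for k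
    by (rule magnus_term_extend[OF g(2)]) (rule g(3))
  have e: "exp_R I h = exp_R UNIV g"
    by (rule exp_R_extend[OF g(2)]) (rule g(3))
  show "summable (\<lambda>k. norm (magnus_term (Suc k) I h))"
    unfolding m by (rule magnus_summable)
  show "log_alg (exp_R I h) = (\<Sum>k. magnus_term (Suc k) I h)"
    unfolding m e by (rule log_alg_eq)
qed

lemma M_controlled_of_variation_le:
  fixes h :: "real \<Rightarrow> 'a::complex_banach_algebra"
  assumes "h bochner_integrable_on I" "(LINT t:I|lebesgue. norm (h t)) \<le> 2"
  shows "M_controlled I h"
  unfolding M_controlled_def
proof (intro allI impI)
  fix z assume z: "cmod z \<le> 1"
  obtain g G where g: "has_strong_integral lborel g G" "AE s in lborel. indicat_real I s *\<^sub>R h s = g s" "\<And>s. s \<notin> I \<Longrightarrow> g s = 0"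
    by (rule borel_density[OF assms(1) that])
  have sub: "subcritical_density g G" by (rule subcritical_densityI[OF g(1,2) assms(2)])
  interpret T: bounded_linear "\<lambda>x. z *\<^sub>C x :: 'a" by (rule bounded_linear_scaleC)
  have "exp_R I (\<lambda>s. z *\<^sub>C h s) = exp_R UNIV (\<lambda>s. z *\<^sub>C g s)"
  proof (rule exp_R_extend)
    show "AE s in lborel. indicat_real I s *\<^sub>R (z *\<^sub>C h s) = z *\<^sub>C g s"
      using g(2) by eventually_elim (simp flip: T.scaleR)
  qed (simp add: g(3) T.zero)
  then show "log_exists (exp_R I (\<lambda>s. z *\<^sub>C h s))" using log_exists_dilate[OF sub z] by simp
qed

lemma M_controlled_imp_log_exists: "M_controlled I h \<Longrightarrow> log_exists (exp_R I h)"
  unfolding M_controlled_def by (drule spec[of _ 1]) (simp add: one_scaleC)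


section \<open>Complexification\<close>

lemma bounded_linear_complexify: "bounded_linear (complexify :: 'a::real_normed_vector \<Rightarrow> _)"
  by (rule bounded_linear_intro[where K = 1]) (simp_all add: complexification_eq_iff)

lemma complexify_mult: "complexify (a * b) = complexify a * complexify b" for a b :: "'a::real_algebra_1"
  by (simp add: complexification_eq_iff)

lemma complexify_1: "complexify 1 = (1 :: 'a::real_algebra_1 complexification)"
  by (simp add: complexification_eq_iff)

lemma path_product_complexify:
  fixes h :: "real \<Rightarrow> 'a::real_normed_algebra_1"
  shows "path_product (\<lambda>s. complexify (h s)) k t = complexify (path_product h k t)"
proof (induction k)
  case (Suc k)
  then show ?case by (simp add: path_product_Suc complexify_mult)
qed (simp add: complexify_1)

lemma complexify_bochner_integrable_on:
  fixes h :: "real \<Rightarrow> 'a::real_normed_vector"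
  assumes "h bochner_integrable_on I"
  shows "(\<lambda>t. complexify (h t)) bochner_integrable_on I"
proof -
  interpret T: bounded_linear "complexify :: 'a \<Rightarrow> _" by (rule bounded_linear_complexify)
  obtain g G where g: "has_strong_integral lborel g G" "AE s in lborel. indicat_real I s *\<^sub>R h s = g s"
    using assms by (rule borel_density)
  have "AE s in lborel. complexify (g s) = indicat_real I s *\<^sub>R complexify (h s)"
    using g(2) by eventually_elim (simp flip: T.scaleR)
  from has_strong_integral_imp_normed[OF has_strong_integral_bounded_linear[OF bounded_linear_complexify g(1)] this]
  show ?thesis unfolding bochner_integrable_on_def bochner_integrable_normed_def by blast
qed

text \<open>The embedding is linear, multiplicative and continuous, so it passes through integrals,
  products and the sum; the bound on the variation supplies the summability for the last.\<close>

lemma exp_R_complexify: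
  fixes h :: "real \<Rightarrow> 'a::{real_normed_algebra_1, banach}"
  assumes "h bochner_integrable_on I" "(LINT t:I|lebesgue. norm (h t)) \<le> 2"
  shows "exp_R I (\<lambda>s. complexify (h s)) = complexify (exp_R I h)"
proof -
  interpret T: bounded_linear "complexify :: 'a \<Rightarrow> _" by (rule bounded_linear_complexify)
  obtain g G where g: "has_strong_integral lborel g G" "AE s in lborel. indicat_real I s *\<^sub>R h s = g s" "\<And>s. s \<notin> I \<Longrightarrow> g s = 0"
    by (rule borel_density[OF assms(1) that])
  interpret subcritical_density g G by (rule subcritical_densityI[OF g(1,2) assms(2)])
  let ?w = "\<lambda>k. indicat_real (time_simplex k UNIV)"
  have it: "iterated_integral (\<lambda>s. complexify (g s)) k (?w k) = complexify (iterated_integral g k (?w k))" for k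
  proof -
    have "has_strong_integral (cube k) (\<lambda>t. complexify (?w k t *\<^sub>R path_product g k t)) (complexify (iterated_integral g k (?w k)))"
      by (intro has_strong_integral_bounded_linear[OF bounded_linear_complexify] has_iterated_integral simple_function_time_simplex) simp
    then show ?thesis
      unfolding iterated_integral_def[of "\<lambda>s. complexify (g s)"]
      by (rule bochner_integral_normed_eq) (simp add: path_product_complexify T.scaleR)
  qed
  have "summable (\<lambda>k. fps_nth A (Suc k))"
    using summable_norm_cancel[OF fps_bound_summable[OF A_bound']] by (subst summable_Suc_iff)
  then have sm: "summable (\<lambda>k. iterated_integral g (Suc k) (?w (Suc k)))" by (simp only: ordered_exp_nth)
  have "exp_R I (\<lambda>s. complexify (h s)) = exp_R UNIV (\<lambda>s. complexify (g s))"
  proof (rule exp_R_extend)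
    show "AE s in lborel. indicat_real I s *\<^sub>R complexify (h s) = complexify (g s)"
      using g(2) by eventually_elim (simp flip: T.scaleR)
  qed (simp add: g(3) T.zero)
  also have "\<dots> = complexify (exp_R UNIV g)"
    unfolding exp_R_eq_iterated it by (simp only: T.add complexify_1 T.suminf[OF sm])
  also have "exp_R UNIV g = exp_R I h"
    by (rule exp_R_extend[OF g(2), symmetric]) (rule g(3))
  finally show ?thesis .
qed

theorem theorem2p37:
  fixes I :: "real set"
    and h :: "real \<Rightarrow> 'a::{real_normed_algebra_1, banach}"
    and g :: "real \<Rightarrow> 'b::complex_banach_algebra"
  assumes "is_interval I"
  shows "(h bochner_integrable_on I \<and> (LINT t:I|lebesgue. norm (h t)) \<le> 2 \<longrightarrow>
            M_controlled I (\<lambda>t. complexify (h t)) \<and>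
            summable (\<lambda>k. norm (magnus_term (Suc k) I h)) \<and>
            log_exists (complexify (exp_R I h)) \<and>
            log_alg (exp_R I h) = (\<Sum>k. magnus_term (Suc k) I h)) \<and>
         (g bochner_integrable_on I \<and> (LINT t:I|lebesgue. norm (g t)) \<le> 2 \<longrightarrow>
            M_controlled I g \<and>
            summable (\<lambda>k. norm (magnus_term (Suc k) I g)) \<and>
            log_exists (exp_R I g) \<and>
            log_alg (exp_R I g) = (\<Sum>k. magnus_term (Suc k) I g))"
proof (intro conjI impI; elim conjE)
  assume h: "h bochner_integrable_on I" "(LINT t:I|lebesgue. norm (h t)) \<le> 2"
  \<comment> \<open>The embedding is isometric, so the bound on the variation carries over.\<close>
  show M: "M_controlled I (\<lambda>t. complexify (h t))"
    using h by (intro M_controlled_of_variation_le complexify_bochner_integrable_on) simp_all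
  show "log_exists (complexify (exp_R I h))"
    using M_controlled_imp_log_exists[OF M] by (simp only: exp_R_complexify[OF h])
qed (intro magnus_expansion M_controlled_of_variation_le M_controlled_imp_log_exists; assumption)+

end
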